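(* Let $K$ be a field of characteristic not equal to $2$. Let $G$ be a finite group acting linearly on a finite-dimensional $K$-vector space $V$, let $K[V]$ be the ring of polynomial functions on $V$, and let $K[V]^G$ be its subring of $G$-invariants. If $K[V]^G$ is a polynomial ring over $K$ and $G$ contains a simple reflection, then the EKL-degree at the origin of the map $\pi\colon \operatorname{Spec} K[V]\to \operatorname{Spec} K[V]^G$ induced by the inclusion $K[V]^G\subset K[V]$ is $$\deg_0^{\mathrm{EKL}}\pi=\frac{\deg_0\pi}{2}\cdot\bigl(\langle 1\rangle+\langle -1\rangle\bigr)\in \mathrm{GW}(K).$$
   Context: $\mathrm{GW}(K)$ denotes the Grothendieck-Witt ring of $K$: the group completion of the semiring (under direct sum and tensor product) of isomorphism classes of nondegenerate symmetric bilinear forms on finite-dimensional $K$-vector spaces. For $u\in K^\times$, $\langle u\rangle\in\mathrm{GW}(K)$ is the class of the form $K\times K\to K$, $(x,y)\mapsto uxy$. EKL-degree. Let $f=(f_1,\dots,f_n)\colon\mathbb{A}^n\to\mathbb{A}^n$ be a morphism of $K$-varieties with $f(0)=0$ and such that $0$ is isolated in its fiber $f^{-1}(0)$. The local algebra of $f$ at $0$ is $Q(f)=K[x_1,\dots,x_n]_{m_0}/(f_1,\dots,f_n)$, where $m_0=(x_1,\dots,x_n)$; it is a finite-dimensional $K$-algebra. The distinguished socle element is $E(f)=\det(a_{ij})\in Q(f)$, where $a_{ij}\in K[x_1,\dots,x_n]$ are any polynomials with $f_i=\sum_j a_{ij}x_j$ for all $i$. For a $K$-linear functional $\phi\colon Q(f)\to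 K$ let $\beta_\phi$ be the symmetric bilinear form $\beta_\phi(a,b)=\phi(ab)$ on $Q(f)$. The EKL-degree $\deg_0^{\mathrm{EKL}}f\in\mathrm{GW}(K)$ is the class of $\beta_\phi$ for any $\phi$ with $\phi(E(f))=1$; it is a known fact that $\beta_\phi$ is then nondegenerate and its class is independent of the choices. The usual local degree is $\deg_0 f=\dim_K Q(f)$, the rank of $\deg_0^{\mathrm{EKL}}f$. Conventions for $\pi$. The source is identified with $\mathbb{A}^{\dim V}$ by linear coordinates on $V$, and the target with $\mathbb{A}^{\dim V}$ by a choice of polynomial generators of $K[V]^G$ vanishing at the origin (for example homogeneous ones); $\deg_0^{\mathrm{EKL}}\pi$ is computed with respect to these identifications, and the statement is for any such choice. A simple reflection is an element of $G$ acting on $V$ as a reflection of order $2$, i.e. fixing a hyperplane pointwise and acting as $-1$ on a complementary line. *)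

theory Defs
  imports
    "HOL-Analysis.Determinants"
    "HOL-Library.Poly_Mapping"
    "HOL-Algebra.Group_Action"
    "HOL-Algebra.QuotRing"
    "Jordan_Normal_Form.VS_Connect"
begin

no_notation vec_nth (infixl \<open>$\<close> 90)
no_notation inner (infix \<open>\<bullet>\<close> 70)
hide_const (open) Determinant.det

section \<open>Symmetric bilinear forms\<close>

abbreviation self_module :: "('k::field, 'k) module" where
  "self_module \<equiv> \<lparr>carrier = UNIV, mult = (*), one = 1, zero = 0, add = (+), smult = (*)\<rparr>"

text \<open>Linearity in the first argument follows from linearity in the second one and symmetry.\<close>

definition nondeg_sym_form :: "('k::field, 'v) module \<Rightarrow> ('v \<Rightarrow> 'v \<Rightarrow> 'k) \<Rightarrow> bool" where
  "nondeg_sym_form V \<beta> \<longleftrightarrow>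
     vectorspace class_ring V \<and> vectorspace.fin_dim class_ring V \<and>
     (\<forall>x\<in>carrier V. linear_map class_ring V self_module (\<beta> x)) \<and>
     (\<forall>x\<in>carrier V. \<forall>y\<in>carrier V. \<beta> x y = \<beta> y x) \<and>
     (\<forall>x\<in>carrier V. (\<forall>y\<in>carrier V. \<beta> x y = 0) \<longrightarrow> x = \<zero>\<^bsub>V\<^esub>)"

definition isometric ::
  "('k::field, 'v) module \<Rightarrow> ('v \<Rightarrow> 'v \<Rightarrow> 'k) \<Rightarrow> ('k, 'w) module \<Rightarrow> ('w \<Rightarrow> 'w \<Rightarrow> 'k) \<Rightarrow> bool" where
  "isometric V \<beta> W \<gamma> \<longleftrightarrow>
     (\<exists>T. linear_map class_ring V W T \<and> bij_betw T (carrier V) (carrier W) \<and>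
       (\<forall>x\<in>carrier V. \<forall>y\<in>carrier V. \<gamma> (T x) (T y) = \<beta> x y))"

definition mat_form :: "'k::field mat \<Rightarrow> 'k vec \<Rightarrow> 'k vec \<Rightarrow> 'k" where
  "mat_form A x y = x \<bullet> (A *\<^sub>v y)"

abbreviation coord_space :: "nat \<Rightarrow> ('k::field, 'k vec) module" where
  "coord_space n \<equiv> module_vec TYPE('k) n"

definition gram_mat :: "'k::field mat \<Rightarrow> bool" where
  "gram_mat A \<longleftrightarrow> square_mat A \<and> nondeg_sym_form (coord_space (dim_row A)) (mat_form A)"

definition iso_gram :: "'k::field mat \<Rightarrow> 'k mat \<Rightarrow> bool" where
  "iso_gram A B \<longleftrightarrow> gram_mat A \<and> gram_mat B \<and>
     isometric (coord_space (dim_row A)) (mat_form A) (coord_space (dim_row B)) (mat_form B)"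

subsection \<open>Isometries of coordinate spaces as matrices\<close>

lemma self_vs: "vectorspace class_ring (self_module :: ('k::field, 'k) module)"
proof -
  have ag: "abelian_group (self_module :: ('k, 'k) module)"
    by (rule abelian_groupI) (auto simp: algebra_simps intro: exI[of _ "- x" for x])
  have "Module.module class_ring (self_module :: ('k, 'k) module)"
    by (rule Module.module.intro[OF class_cring.is_cring ag]) (unfold_locales, auto simp: algebra_simps)
  moreover have "field (class_ring :: 'k ring)" by (rule class_field.field_axioms)
  ultimately show ?thesis unfolding vectorspace_def by blast
qed

lemma mat_eq_by_vec:
  fixes M N :: "'k::field mat"
  assumes M: "M \<in> carrier_mat m n" and N: "N \<in> carrier_mat m n"
    and eq: "\<And>x. x \<in> carrier_vec n \<Longrightarrow> M *\<^sub>v x = N *\<^sub>v x"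
  shows "M = N"
proof (rule eq_matI)
  fix i j assume ij: "i < dim_row N" "j < dim_col N"
  with N have "i < m" "j < n" by auto
  from eq[of "unit_vec n j"] have "(M *\<^sub>v unit_vec n j) $ i = (N *\<^sub>v unit_vec n j) $ i" by simp
  thus "M $$ (i,j) = N $$ (i,j)" using M N \<open>i < m\<close> \<open>j < n\<close>
    by (simp add: scalar_prod_right_unit)
qed (use M N in auto)

lemma mat_form_cong_eq:
  fixes M N :: "'k::field mat"
  assumes M: "M \<in> carrier_mat n n" and N: "N \<in> carrier_mat n n"
    and eq: "\<And>x y. x \<in> carrier_vec n \<Longrightarrow> y \<in> carrier_vec n \<Longrightarrow> mat_form M x y = mat_form N x y"
  shows "M = N"
proof (rule eq_matI)
  fix i j assume ij: "i < dim_row N" "j < dim_col N"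
  with N have ij: "i < n" "j < n" by auto
  from eq[of "unit_vec n i" "unit_vec n j"]
  show "M $$ (i,j) = N $$ (i,j)" using M N ij
    by (simp add: mat_form_def scalar_prod_right_unit scalar_prod_left_unit[of _ n])
qed (use M N in auto)

lemma lin_map_mat:
  fixes T :: "'k::field vec \<Rightarrow> 'k vec"
  assumes T: "T \<in> LinearCombinations.module_hom class_ring (coord_space n) (coord_space m)"
  obtains P where "P \<in> carrier_mat m n" "\<And>x. x \<in> carrier_vec n \<Longrightarrow> T x = P *\<^sub>v x"
proof -
  have Tc: "\<And>x. x \<in> carrier_vec n \<Longrightarrow> T x \<in> carrier_vec m"
    and Ta: "\<And>x y. x \<in> carrier_vec n \<Longrightarrow> y \<in> carrier_vec n \<Longrightarrow> T (x + y) = T x + T y"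
    and Ts: "\<And>c x. x \<in> carrier_vec n \<Longrightarrow> T (c \<cdot>\<^sub>v x) = c \<cdot>\<^sub>v T x"
    using T unfolding LinearCombinations.module_hom_def by (auto simp: module_vec_simps)
  define P where "P = mat m n (\<lambda>(i,j). T (unit_vec n j) $ i)"
  have P: "P \<in> carrier_mat m n" by (simp add: P_def)
  have Pu: "T (unit_vec n j) = P *\<^sub>v unit_vec n j" if "j < n" for j
    using Tc[of "unit_vec n j"] that
    by (intro eq_vecI) (auto simp: P_def scalar_prod_right_unit)
  have "T x = P *\<^sub>v x" if x: "x \<in> carrier_vec n" for x
  proof -
    define y where "y k = vec n (\<lambda>i. if i < k then x $ i else 0)" for k
    have "k \<le> n \<Longrightarrow> T (y k) = P *\<^sub>v y k" for k
    proof (induction k)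
      case 0
      have y0: "y 0 = 0 \<cdot>\<^sub>v 0\<^sub>v n" by (rule eq_vecI) (auto simp: y_def)
      have "T (y 0) = 0 \<cdot>\<^sub>v T (0\<^sub>v n)" unfolding y0 by (rule Ts) simp
      also have "\<dots> = P *\<^sub>v y 0" using Tc[of "0\<^sub>v n"] P unfolding y0
        by (intro eq_vecI) auto
      finally show ?case .
    next
      case (Suc k)
      have yS: "y (Suc k) = y k + x $ k \<cdot>\<^sub>v unit_vec n k"
        by (rule eq_vecI) (auto simp: y_def less_Suc_eq unit_vec_def)
      have c: "y k \<in> carrier_vec n" by (simp add: y_def)
      have "T (y (Suc k)) = T (y k) + x $ k \<cdot>\<^sub>v T (unit_vec n k)"
        unfolding yS using c by (simp add: Ta Ts)
      also have "\<dots> = P *\<^sub>v y (Suc k)" unfolding yS using Suc P c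
        by (simp add: Pu mult_add_distrib_mat_vec mult_mat_vec)
      finally show ?case .
    qed
    moreover have "y n = x" using x by (intro eq_vecI) (auto simp: y_def)
    ultimately show ?thesis by force
  qed
  with P that show ?thesis by blast
qed

definition congr_mat :: "'k::field mat \<Rightarrow> 'k mat \<Rightarrow> bool" where
  "congr_mat A B \<longleftrightarrow> (\<exists>P Q. P \<in> carrier_mat (dim_row B) (dim_row A) \<and>
     Q \<in> carrier_mat (dim_row A) (dim_row B) \<and> P * Q = 1\<^sub>m (dim_row B) \<and>
     Q * P = 1\<^sub>m (dim_row A) \<and> A = P\<^sup>T * B * P)"

lemma mat_form_transform:
  fixes B :: "'k::field mat"
  assumes "B \<in> carrier_mat m m" "P \<in> carrier_mat m n" "x \<in> carrier_vec n" "y \<in> carrier_vec n"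
  shows "mat_form B (P *\<^sub>v x) (P *\<^sub>v y) = mat_form (P\<^sup>T * B * P) x y"
proof -
  have "mat_form (P\<^sup>T * B * P) x y = x \<bullet> (P\<^sup>T *\<^sub>v (B *\<^sub>v (P *\<^sub>v y)))"
    unfolding mat_form_def using assms
    by (simp add: assoc_mult_mat_vec[of _ n m _ n] assoc_mult_mat_vec[of _ n m _ m])
  also have "\<dots> = (P\<^sup>T *\<^sub>v (B *\<^sub>v (P *\<^sub>v y))) \<bullet> x"
    using assms by (intro comm_scalar_prod[of _ n]) auto
  also have "\<dots> = (B *\<^sub>v (P *\<^sub>v y)) \<bullet> (P *\<^sub>v x)"
    by (rule transpose_vec_mult_scalar[of _ m n]) (use assms in auto)
  also have "\<dots> = mat_form B (P *\<^sub>v x) (P *\<^sub>v y)"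
    unfolding mat_form_def using assms by (intro comm_scalar_prod[of _ m]) auto
  finally show ?thesis by simp
qed

lemma isometric_iff_congr:
  fixes A B :: "'k::field mat"
  assumes A: "A \<in> carrier_mat n n" and B: "B \<in> carrier_mat m m"
  shows "isometric (coord_space n) (mat_form A) (coord_space m) (mat_form B) \<longleftrightarrow> congr_mat A B"
proof
  assume "isometric (coord_space n) (mat_form A) (coord_space m) (mat_form B)"
  then obtain T where T: "linear_map class_ring (coord_space n) (coord_space m) T"
    and bij: "bij_betw T (carrier_vec n) (carrier_vec m)"
    and iso: "\<And>x y. x \<in> carrier_vec n \<Longrightarrow> y \<in> carrier_vec n \<Longrightarrow> mat_form B (T x) (T y) = mat_form A x y"
    unfolding isometric_def by (auto simp: module_vec_simps)
  have hom: "T \<in> LinearCombinations.module_hom class_ring (coord_space n) (coord_space m)"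
    using T by (simp add: linear_map_def mod_hom_def mod_hom_axioms_def)
  then obtain P where P: "P \<in> carrier_mat m n" and TP: "\<And>x. x \<in> carrier_vec n \<Longrightarrow> T x = P *\<^sub>v x"
    by (rule lin_map_mat) blast
  define S where "S = inv_into (carrier_vec n) T"
  have Sc: "S y \<in> carrier_vec n" and TS: "T (S y) = y" if "y \<in> carrier_vec m" for y
    using that bij unfolding S_def bij_betw_def by (auto intro: inv_into_into f_inv_into_f)
  have ST: "S (T x) = x" if "x \<in> carrier_vec n" for x
    using that bij unfolding S_def bij_betw_def by auto
  have "S \<in> LinearCombinations.module_hom class_ring (coord_space m) (coord_space n)"
    unfolding LinearCombinations.module_hom_def
  proof (simp add: module_vec_simps, intro conjI allI impI)
    show "S \<in> carrier_vec m \<rightarrow> carrier_vec n" using Sc by auto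
    fix x y :: "'k vec" assume xy: "x \<in> carrier_vec m \<and> y \<in> carrier_vec m"
    have "T (S x + S y) = x + y" using xy Sc TS hom
      unfolding LinearCombinations.module_hom_def by (auto simp: module_vec_simps)
    thus "S (x + y) = S x + S y" using ST[of "S x + S y"] xy Sc by auto
  next
    fix c :: 'k and y :: "'k vec" assume y: "y \<in> carrier_vec m"
    have "T (c \<cdot>\<^sub>v S y) = c \<cdot>\<^sub>v y" using y Sc TS hom
      unfolding LinearCombinations.module_hom_def by (auto simp: module_vec_simps)
    thus "S (c \<cdot>\<^sub>v y) = c \<cdot>\<^sub>v S y" using ST[of "c \<cdot>\<^sub>v S y"] y Sc by auto
  qed
  then obtain Q where Q: "Q \<in> carrier_mat n m" and SQ: "\<And>x. x \<in> carrier_vec m \<Longrightarrow> S x = Q *\<^sub>v x"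
    by (rule lin_map_mat) blast
  have "P * Q = 1\<^sub>m m"
  proof (rule mat_eq_by_vec[of _ m m])
    fix x :: "'k vec" assume x: "x \<in> carrier_vec m"
    have "P * Q *\<^sub>v x = P *\<^sub>v (Q *\<^sub>v x)" by (rule assoc_mult_mat_vec[OF P Q x])
    also have "\<dots> = x" using TS[OF x] SQ[OF x] TP[OF Sc[OF x]] by simp
    finally show "P * Q *\<^sub>v x = 1\<^sub>m m *\<^sub>v x" using x by simp
  qed (use P Q in auto)
  moreover have "Q * P = 1\<^sub>m n"
  proof (rule mat_eq_by_vec[of _ n n])
    fix x :: "'k vec" assume x: "x \<in> carrier_vec n"
    have "Q * P *\<^sub>v x = Q *\<^sub>v (P *\<^sub>v x)" by (rule assoc_mult_mat_vec[OF Q P x])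
    also have "\<dots> = x" using ST[OF x] TP[OF x] SQ[of "T x"] P x by simp
    finally show "Q * P *\<^sub>v x = 1\<^sub>m n *\<^sub>v x" using x by simp
  qed (use P Q in auto)
  moreover have "A = P\<^sup>T * B * P"
  proof (rule mat_form_cong_eq[OF A])
    fix x y :: "'k vec" assume xy: "x \<in> carrier_vec n" "y \<in> carrier_vec n"
    show "mat_form A x y = mat_form (P\<^sup>T * B * P) x y"
      using iso[OF xy] mat_form_transform[OF B P xy] xy by (simp add: TP)
  qed (use P B in auto)
  ultimately show "congr_mat A B" unfolding congr_mat_def
    using A B P Q by (intro exI[of _ P] exI[of _ Q]) simp
next
  assume "congr_mat A B"
  then obtain P Q where P: "P \<in> carrier_mat m n" and Q: "Q \<in> carrier_mat n m"
    and PQ: "P * Q = 1\<^sub>m m" and QP: "Q * P = 1\<^sub>m n" and AB: "A = P\<^sup>T * B * P"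
    unfolding congr_mat_def using A B by auto
  have "linear_map class_ring (coord_space n) (coord_space m) ((*\<^sub>v) P)"
    unfolding linear_map_def mod_hom_def mod_hom_axioms_def
    using vec_vs[of n, where 'a='k] vec_vs[of m, where 'a='k] P
    by (auto simp: vectorspace_def LinearCombinations.module_hom_def module_vec_simps
        mult_add_distrib_mat_vec mult_mat_vec)
  moreover have "bij_betw ((*\<^sub>v) P) (carrier_vec n) (carrier_vec m)"
  proof (rule bij_betw_byWitness[where f' = "(*\<^sub>v) Q"])
    show "\<forall>a\<in>carrier_vec n. Q *\<^sub>v (P *\<^sub>v a) = a"
      by (simp add: assoc_mult_mat_vec[OF Q P, symmetric] QP)
    show "\<forall>a\<in>carrier_vec m. P *\<^sub>v (Q *\<^sub>v a) = a"
      by (simp add: assoc_mult_mat_vec[OF P Q, symmetric] PQ)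
  qed (use P Q in auto)
  moreover have "\<forall>x\<in>carrier_vec n. \<forall>y\<in>carrier_vec n. mat_form B (P *\<^sub>v x) (P *\<^sub>v y) = mat_form A x y"
    using mat_form_transform[OF B P] AB by simp
  ultimately show "isometric (coord_space n) (mat_form A) (coord_space m) (mat_form B)"
    unfolding isometric_def by (auto simp: module_vec_simps)
qed

lemma gram_mat_iff:
  fixes A :: "'k::field mat"
  shows "gram_mat A \<longleftrightarrow> square_mat A \<and> A\<^sup>T = A \<and>
    (\<exists>B \<in> carrier_mat (dim_row A) (dim_row A). A * B = 1\<^sub>m (dim_row A))"
proof (cases "square_mat A")
  case True
  define n where "n = dim_row A"
  have A: "A \<in> carrier_mat n n" using True by (auto simp: n_def)
  have lin: "linear_map class_ring (coord_space n) self_module (mat_form A x)"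
    if "x \<in> carrier_vec n" for x
    unfolding linear_map_def mod_hom_def mod_hom_axioms_def
    using vec_vs[of n, where 'a='k] self_vs[where 'k='k] A that
    by (auto simp: vectorspace_def LinearCombinations.module_hom_def module_vec_simps mat_form_def
        mult_add_distrib_mat_vec[OF A] mult_mat_vec[OF A] scalar_prod_add_distrib[of _ n])
  have tr: "mat_form A y x = mat_form (A\<^sup>T) x y"
    if "x \<in> carrier_vec n" "y \<in> carrier_vec n" for x y
  proof -
    have "mat_form (A\<^sup>T) x y = (A\<^sup>T *\<^sub>v y) \<bullet> x"
      unfolding mat_form_def using A that by (intro comm_scalar_prod[of _ n]) auto
    also have "\<dots> = mat_form A y x" unfolding mat_form_def
      by (rule transpose_vec_mult_scalar[OF A]) (use that in auto)
    finally show ?thesis by simp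
  qed
  have sym: "(\<forall>x\<in>carrier_vec n. \<forall>y\<in>carrier_vec n. mat_form A x y = mat_form A y x) \<longleftrightarrow> A\<^sup>T = A"
    using tr mat_form_cong_eq[of "A\<^sup>T" n A] A by (auto simp: transpose_carrier_mat)
  have nd: "(\<forall>x\<in>carrier_vec n. (\<forall>y\<in>carrier_vec n. mat_form A x y = 0) \<longrightarrow> x = 0\<^sub>v n) \<longleftrightarrow>
      (\<exists>B\<in>carrier_mat n n. A * B = 1\<^sub>m n)" if "A\<^sup>T = A"
  proof -
    have z: "(\<forall>y\<in>carrier_vec n. mat_form A x y = 0) \<longleftrightarrow> A *\<^sub>v x = 0\<^sub>v n" if x: "x \<in> carrier_vec n" for x
    proof
      assume *: "\<forall>y\<in>carrier_vec n. mat_form A x y = 0"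
      show "A *\<^sub>v x = 0\<^sub>v n"
      proof (rule eq_vecI)
        fix i assume "i < dim_vec (0\<^sub>v n :: 'k vec)"
        hence i: "i < n" by simp
        have "(A *\<^sub>v x) $ i = mat_form A (unit_vec n i) x"
          unfolding mat_form_def using A x i by (simp add: scalar_prod_left_unit[of _ n])
        also have "\<dots> = mat_form A x (unit_vec n i)" using tr[of x "unit_vec n i"] x \<open>A\<^sup>T = A\<close> by simp
        also have "\<dots> = 0" using * by simp
        finally show "(A *\<^sub>v x) $ i = 0\<^sub>v n $ i" using i by simp
      qed (use A in auto)
    next
      assume *: "A *\<^sub>v x = 0\<^sub>v n"
      show "\<forall>y\<in>carrier_vec n. mat_form A x y = 0"
      proof
        fix y :: "'k vec" assume y: "y \<in> carrier_vec n"
        have "mat_form A x y = mat_form A y x" using tr[OF y x] \<open>A\<^sup>T = A\<close> by simp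
        also have "\<dots> = 0" using * y by (simp add: mat_form_def)
        finally show "mat_form A x y = 0" .
      qed
    qed
    have "(\<forall>x\<in>carrier_vec n. (\<forall>y\<in>carrier_vec n. mat_form A x y = 0) \<longrightarrow> x = 0\<^sub>v n) \<longleftrightarrow>
        Determinant.det A \<noteq> 0"
      unfolding det_0_iff_vec_prod_zero_field[OF A] using z by blast
    also have "\<dots> \<longleftrightarrow> (\<exists>B\<in>carrier_mat n n. A * B = 1\<^sub>m n)"
    proof
      assume "Determinant.det A \<noteq> 0"
      from det_non_zero_imp_unit[OF A this, where b = "()"]
      show "\<exists>B\<in>carrier_mat n n. A * B = 1\<^sub>m n"
        unfolding Units_def by (auto simp: ring_mat_simps)
    next
      assume "\<exists>B\<in>carrier_mat n n. A * B = 1\<^sub>m n"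
      then obtain B where B: "B \<in> carrier_mat n n" "A * B = 1\<^sub>m n" by blast
      have "Determinant.det A * Determinant.det B = 1"
        using det_mult[OF A B(1)] B(2) by simp
      thus "Determinant.det A \<noteq> 0" by auto
    qed
    finally show ?thesis .
  qed
  show ?thesis unfolding gram_mat_def nondeg_sym_form_def n_def[symmetric]
    using True vec_vs[of n, where 'a='k] vec_space.fin_dim[of n, where 'a='k] lin sym nd
    by (auto simp: module_vec_simps)
qed (simp add: gram_mat_def)

lemma congr_matI:
  assumes "A \<in> carrier_mat n n" "B \<in> carrier_mat m m" "P \<in> carrier_mat m n" "Q \<in> carrier_mat n m"
    and "P * Q = 1\<^sub>m m" "Q * P = 1\<^sub>m n" "A = P\<^sup>T * B * P"
  shows "congr_mat A B"
proof -
  have d: "dim_row A = n" "dim_row B = m" using assms(1,2) by auto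
  show ?thesis unfolding congr_mat_def d using assms(3-7) by blast
qed

lemma congr_matE:
  assumes "congr_mat A B" "A \<in> carrier_mat n n" "B \<in> carrier_mat m m"
  obtains P Q where "P \<in> carrier_mat m n" "Q \<in> carrier_mat n m"
    and "P * Q = 1\<^sub>m m" "Q * P = 1\<^sub>m n" "A = P\<^sup>T * B * P"
proof -
  have d: "dim_row A = n" "dim_row B = m" using assms(2,3) by auto
  show ?thesis using assms(1) that unfolding congr_mat_def d by blast
qed

lemma congr_mat_refl:
  assumes "square_mat A"
  shows "congr_mat A A"
proof -
  define n where "n = dim_row A"
  have A: "A \<in> carrier_mat n n" using assms by (auto simp: n_def)
  have "(1\<^sub>m n)\<^sup>T * A * 1\<^sub>m n = A" using A by simp
  thus ?thesis by (intro congr_matI[OF A A one_carrier_mat one_carrier_mat]) simp_all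
qed

lemma congr_mat_sym:
  assumes "congr_mat A B" "square_mat A" "square_mat B"
  shows "congr_mat B A"
proof -
  define n m where "n = dim_row A" and "m = dim_row B"
  have A: "A \<in> carrier_mat n n" and B: "B \<in> carrier_mat m m" using assms by (auto simp: n_def m_def)
  obtain P Q where P: "P \<in> carrier_mat m n" and Q: "Q \<in> carrier_mat n m"
    and PQ: "P * Q = 1\<^sub>m m" and QP: "Q * P = 1\<^sub>m n" and AB: "A = P\<^sup>T * B * P"
    by (rule congr_matE[OF assms(1) A B])
  have QtPt: "Q\<^sup>T * P\<^sup>T = 1\<^sub>m m"
    using transpose_mult[OF P Q] PQ by simp
  have "Q\<^sup>T * A * Q = Q\<^sup>T * (P\<^sup>T * B * P * Q)"
    unfolding AB using P Q B by (simp add: assoc_mult_mat[of _ m n _ n _ m])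
  also have "P\<^sup>T * B * P * Q = P\<^sup>T * B"
    using P Q B PQ by (simp add: assoc_mult_mat[of _ n m _ n _ m])
  also have "Q\<^sup>T * (P\<^sup>T * B) = Q\<^sup>T * P\<^sup>T * B"
    by (rule assoc_mult_mat[symmetric]) (use P Q B in auto)
  also have "\<dots> = B" using B QtPt by simp
  finally show ?thesis using congr_matI[OF B A Q P QP PQ] by simp
qed

lemma congr_mat_trans:
  assumes "congr_mat A B" "congr_mat B C" "square_mat A" "square_mat B" "square_mat C"
  shows "congr_mat A C"
proof -
  define n m r where "n = dim_row A" and "m = dim_row B" and "r = dim_row C"
  have A: "A \<in> carrier_mat n n" and B: "B \<in> carrier_mat m m" and C: "C \<in> carrier_mat r r"
    using assms by (auto simp: n_def m_def r_def)
  obtain P Q where P: "P \<in> carrier_mat m n" and Q: "Q \<in> carrier_mat n m"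
    and PQ: "P * Q = 1\<^sub>m m" and QP: "Q * P = 1\<^sub>m n" and AB: "A = P\<^sup>T * B * P"
    by (rule congr_matE[OF assms(1) A B])
  obtain R S where R: "R \<in> carrier_mat r m" and S: "S \<in> carrier_mat m r"
    and RS: "R * S = 1\<^sub>m r" and SR: "S * R = 1\<^sub>m m" and BC: "B = R\<^sup>T * C * R"
    by (rule congr_matE[OF assms(2) B C])
  have inv: "R * P * (Q * S) = 1\<^sub>m r" "Q * S * (R * P) = 1\<^sub>m n"
  proof -
    have "R * P * (Q * S) = R * (P * Q * S)"
      using P Q R S by (simp add: assoc_mult_mat[of _ r m _ n _ r] assoc_mult_mat[of _ m n _ m _ r])
    thus "R * P * (Q * S) = 1\<^sub>m r" using PQ RS S by simp
    have "Q * S * (R * P) = Q * (S * R * P)"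
      using P Q R S by (simp add: assoc_mult_mat[of _ n m _ r _ n] assoc_mult_mat[of _ m r _ m _ n])
    thus "Q * S * (R * P) = 1\<^sub>m n" using SR QP P by simp
  qed
  have "(R * P)\<^sup>T * C * (R * P) = P\<^sup>T * R\<^sup>T * C * (R * P)"
    using transpose_mult[OF R P] by simp
  also have "\<dots> = P\<^sup>T * (R\<^sup>T * C * (R * P))"
    using P R C
    by (simp add: assoc_mult_mat[of _ n m _ r _ r] assoc_mult_mat[of _ n m _ r _ n])
  also have "R\<^sup>T * C * (R * P) = B * P" unfolding BC
    using P R C by (simp add: assoc_mult_mat[of _ m r _ m _ n] assoc_mult_mat[of _ m r _ r _ n])
  also have "P\<^sup>T * (B * P) = A" unfolding AB
    using P B by (simp add: assoc_mult_mat[of _ n m _ m _ n])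
  finally show ?thesis
    using P Q R S inv by (intro congr_matI[OF A C, of "R * P" "Q * S"]) auto
qed

lemma congr_mat_perm:
  fixes A B :: "'k::field mat"
  assumes A: "A \<in> carrier_mat n n" and B: "B \<in> carrier_mat m m"
    and bij: "bij_betw \<pi> {0..<n} {0..<m}"
    and eq: "\<And>i j. i < n \<Longrightarrow> j < n \<Longrightarrow> A $$ (i, j) = B $$ (\<pi> i, \<pi> j)"
  shows "congr_mat A B"
proof -
  have \<pi>: "\<pi> i < m" if "i < n" for i using bij that by (auto simp: bij_betw_def)
  have inj: "\<pi> i = \<pi> j \<longleftrightarrow> i = j" if "i < n" "j < n" for i j
    using bij that by (auto simp: bij_betw_def inj_on_def)
  have nm: "n = m" using bij_betw_same_card[OF bij] by simp
  define P :: "'k mat" where "P = mat m n (\<lambda>(i, j). if i = \<pi> j then 1 else 0)"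
  have P: "P \<in> carrier_mat m n" by (simp add: P_def)
  have PtP: "P\<^sup>T * P = 1\<^sub>m n"
  proof (rule eq_matI)
    fix i j assume "i < dim_row (1\<^sub>m n :: 'k mat)" "j < dim_col (1\<^sub>m n :: 'k mat)"
    hence ij: "i < n" "j < n" by auto
    have "(P\<^sup>T * P) $$ (i, j) = (\<Sum>k\<in>{0..<m}. (if k = \<pi> i then 1 else 0) * (if k = \<pi> j then 1 else 0))"
      using ij by (auto simp: P_def scalar_prod_def)
    also have "\<dots> = (if \<pi> i = \<pi> j then 1 else 0)"
      using \<pi>[OF ij(1)] by (simp add: if_distrib[of "\<lambda>x. x * _"] cong: if_cong)
    finally show "(P\<^sup>T * P) $$ (i, j) = 1\<^sub>m n $$ (i, j)" using ij inj by simp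
  qed (use P in auto)
  hence PPt: "P * P\<^sup>T = 1\<^sub>m m"
    using mat_mult_left_right_inverse[of "P\<^sup>T" n P] P nm by auto
  have "A = P\<^sup>T * B * P"
  proof (rule eq_matI)
    fix i j assume "i < dim_row (P\<^sup>T * B * P)" "j < dim_col (P\<^sup>T * B * P)"
    hence ij: "i < n" "j < n" using P by auto
    have 1: "(P\<^sup>T * B) $$ (i, l) = B $$ (\<pi> i, l)" if l: "l < m" for l
    proof -
      have "(P\<^sup>T * B) $$ (i, l) = (\<Sum>k\<in>{0..<m}. (if k = \<pi> i then 1 else 0) * B $$ (k, l))"
        using ij l B by (auto simp: P_def scalar_prod_def)
      also have "\<dots> = B $$ (\<pi> i, l)"
        using \<pi>[OF ij(1)] by (simp add: if_distrib[of "\<lambda>x. x * _"] cong: if_cong)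
      finally show ?thesis .
    qed
    have "(M * P) $$ (i, j) = (\<Sum>l\<in>{0..<m}. M $$ (i, l) * P $$ (l, j))"
      if "M \<in> carrier_mat n m" for M :: "'k mat"
      using that ij P by (simp add: scalar_prod_def)
    from this[of "P\<^sup>T * B"]
    have "(P\<^sup>T * B * P) $$ (i, j) = (\<Sum>l\<in>{0..<m}. (P\<^sup>T * B) $$ (i, l) * P $$ (l, j))"
      using B P by auto
    also have "\<dots> = (\<Sum>l\<in>{0..<m}. B $$ (\<pi> i, l) * (if l = \<pi> j then 1 else 0))"
    proof (rule sum.cong)
      fix l assume "l \<in> {0..<m}"
      hence l: "l < m" by simp
      have Pl: "P $$ (l, j) = (if l = \<pi> j then 1 else 0)" using l ij by (simp add: P_def)
      show "(P\<^sup>T * B) $$ (i, l) * P $$ (l, j) = B $$ (\<pi> i, l) * (if l = \<pi> j then 1 else 0)"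
        unfolding 1[OF l] Pl ..
    qed simp
    also have "\<dots> = B $$ (\<pi> i, \<pi> j)"
      using \<pi>[OF ij(2)] by (simp add: if_distrib[of "\<lambda>x. _ * x"] cong: if_cong)
    finally show "A $$ (i, j) = (P\<^sup>T * B * P) $$ (i, j)" using eq ij by simp
  qed (use A P in auto)
  thus ?thesis by (intro congr_matI[OF A B P _ PPt PtP] transpose_carrier_mat[THEN iffD2] P)
qed

subsection \<open>Orthogonal sums and tensor products of Gram matrices\<close>

definition dsum_mat :: "'k::field mat \<Rightarrow> 'k mat \<Rightarrow> 'k mat" where
  "dsum_mat A B = four_block_mat A (0\<^sub>m (dim_row A) (dim_col B)) (0\<^sub>m (dim_row B) (dim_col A)) B"

text \<open>The basis vector $e_i \otimes e_j$ has index $i \cdot \dim W + j$ in $V \otimes W$.\<close>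

definition kron_mat :: "'k::field mat \<Rightarrow> 'k mat \<Rightarrow> 'k mat" where
  "kron_mat A B = mat (dim_row A * dim_row B) (dim_col A * dim_col B)
     (\<lambda>(i, j). A $$ (i div dim_row B, j div dim_col B) * B $$ (i mod dim_row B, j mod dim_col B))"

lemma dsum_carrier [simp]:
  "A \<in> carrier_mat a b \<Longrightarrow> B \<in> carrier_mat c d \<Longrightarrow> dsum_mat A B \<in> carrier_mat (a + c) (b + d)"
  by (auto simp: dsum_mat_def)

lemma kron_carrier [simp]:
  "A \<in> carrier_mat a b \<Longrightarrow> B \<in> carrier_mat c d \<Longrightarrow> kron_mat A B \<in> carrier_mat (a * c) (b * d)"
  by (auto simp: kron_mat_def)

lemma dsum_mult:
  assumes "A \<in> carrier_mat a b" "B \<in> carrier_mat c d" "A' \<in> carrier_mat b e" "B' \<in> carrier_mat d f"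
  shows "dsum_mat A B * dsum_mat A' B' = dsum_mat (A * A') (B * B')"
proof -
  have "dsum_mat A B * dsum_mat A' B' =
     four_block_mat A (0\<^sub>m a d) (0\<^sub>m c b) B * four_block_mat A' (0\<^sub>m b f) (0\<^sub>m d e) B'"
    using assms by (simp add: dsum_mat_def)
  also have "\<dots> = dsum_mat (A * A') (B * B')"
    by (subst mult_four_block_mat[of _ a b _ d _ c _ _ e _ f]) (use assms in \<open>auto simp: dsum_mat_def\<close>)
  finally show ?thesis .
qed

lemma dsum_transpose: "(dsum_mat A B)\<^sup>T = dsum_mat (A\<^sup>T) (B\<^sup>T)"
  unfolding dsum_mat_def
  by (subst transpose_four_block_mat[of _ "dim_row A" "dim_col A" _ "dim_col B" _ "dim_row B"]) auto

lemma dsum_one: "dsum_mat (1\<^sub>m n) (1\<^sub>m m) = 1\<^sub>m (n + m)"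
  by (simp add: dsum_mat_def)

lemma kron_index_less:
  fixes i a c :: nat
  assumes "i < a * c" shows "i div c < a" "i mod c < c"
  using assms by (auto simp: less_mult_imp_div_less) (cases "c = 0"; simp)

lemma sum_kron:
  fixes f :: "nat \<Rightarrow> nat \<Rightarrow> 'a::comm_monoid_add"
  shows "(\<Sum>k\<in>{0..<b * d}. f (k div d) (k mod d)) = (\<Sum>i\<in>{0..<b}. \<Sum>j\<in>{0..<d}. f i j)"
proof -
  have "(\<Sum>i\<in>{0..<b}. \<Sum>j\<in>{0..<d}. f i j) = (\<Sum>(i,j)\<in>{0..<b} \<times> {0..<d}. f i j)"
    by (simp add: sum.cartesian_product)
  also have "\<dots> = (\<Sum>k\<in>{0..<b * d}. f (k div d) (k mod d))"
  proof (rule sum.reindex_bij_witness[of _ "\<lambda>k. (k div d, k mod d)" "\<lambda>(i,j). i * d + j"])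
    fix x assume "x \<in> {0..<b} \<times> {0..<d}"
    then obtain i j where x: "x = (i, j)" "i < b" "j < d" by auto
    show "(case x of (i, j) \<Rightarrow> i * d + j) \<in> {0..<b * d}"
      using x mult_le_mono1[of "Suc i" b d] by simp
    show "((case x of (i, j) \<Rightarrow> i * d + j) div d, (case x of (i, j) \<Rightarrow> i * d + j) mod d) = x"
      using x by simp
    show "f ((case x of (i, j) \<Rightarrow> i * d + j) div d) ((case x of (i, j) \<Rightarrow> i * d + j) mod d) =
      (case x of (i, j) \<Rightarrow> f i j)" using x by simp
  qed (auto simp: kron_index_less)
  finally show ?thesis by simp
qed

lemma kron_mult:
  assumes A: "A \<in> carrier_mat a b" and B: "B \<in> carrier_mat c d"
    and A': "A' \<in> carrier_mat b e" and B': "B' \<in> carrier_mat d f"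
  shows "kron_mat A B * kron_mat A' B' = kron_mat (A * A') (B * B')"
proof (rule eq_matI)
  fix i j assume "i < dim_row (kron_mat (A * A') (B * B'))" "j < dim_col (kron_mat (A * A') (B * B'))"
  hence ij: "i < a * c" "j < e * f" using assms by (auto simp: kron_mat_def)
  note less = kron_index_less[OF ij(1)] kron_index_less[OF ij(2)]
  have "(kron_mat A B * kron_mat A' B') $$ (i, j) =
      (\<Sum>k\<in>{0..<b * d}. A $$ (i div c, k div d) * B $$ (i mod c, k mod d) *
         (A' $$ (k div d, j div f) * B' $$ (k mod d, j mod f)))"
    using assms ij by (simp add: kron_mat_def scalar_prod_def)
  also have "\<dots> = (\<Sum>k\<in>{0..<b}. \<Sum>l\<in>{0..<d}. A $$ (i div c, k) * B $$ (i mod c, l) *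
         (A' $$ (k, j div f) * B' $$ (l, j mod f)))"
    by (rule sum_kron)
  also have "\<dots> = (\<Sum>k\<in>{0..<b}. A $$ (i div c, k) * A' $$ (k, j div f)) *
      (\<Sum>l\<in>{0..<d}. B $$ (i mod c, l) * B' $$ (l, j mod f))"
    by (simp add: sum_product mult_ac)
  also have "\<dots> = kron_mat (A * A') (B * B') $$ (i, j)"
    using assms ij less by (simp add: kron_mat_def scalar_prod_def)
  finally show "(kron_mat A B * kron_mat A' B') $$ (i, j) = kron_mat (A * A') (B * B') $$ (i, j)" .
qed (use assms in \<open>auto simp: kron_mat_def\<close>)

lemma kron_transpose: "(kron_mat A B)\<^sup>T = kron_mat (A\<^sup>T) (B\<^sup>T)"
  by (rule eq_matI) (auto simp: kron_mat_def kron_index_less)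

lemma kron_one: "kron_mat (1\<^sub>m n) (1\<^sub>m m) = (1\<^sub>m (n * m) :: 'k::field mat)"
proof (rule eq_matI)
  fix i j assume "i < dim_row (1\<^sub>m (n * m) :: 'k mat)" "j < dim_col (1\<^sub>m (n * m) :: 'k mat)"
  hence ij: "i < n * m" "j < n * m" by auto
  have "i = j \<longleftrightarrow> i div m = j div m \<and> i mod m = j mod m" by (metis div_mult_mod_eq)
  thus "kron_mat (1\<^sub>m n) (1\<^sub>m m) $$ (i, j) = (1\<^sub>m (n * m) :: 'k mat) $$ (i, j)"
    using ij kron_index_less[OF ij(1)] kron_index_less[OF ij(2)] by (auto simp: kron_mat_def)
qed (auto simp: kron_mat_def)

text \<open>Both operations are compatible with congruence and with invertibility because they are
  multiplicative; this is used with \<open>F = dsum_mat\<close> and \<open>F = kron_mat\<close>.\<close>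

lemma binop_congr:
  fixes F :: "'k::field mat \<Rightarrow> 'k mat \<Rightarrow> 'k mat" and h :: "nat \<Rightarrow> nat \<Rightarrow> nat"
  assumes carr: "\<And>A B a b c d. A \<in> carrier_mat a b \<Longrightarrow> B \<in> carrier_mat c d \<Longrightarrow> F A B \<in> carrier_mat (h a c) (h b d)"
    and mult: "\<And>A B A' B' a b c d e f. A \<in> carrier_mat a b \<Longrightarrow> B \<in> carrier_mat c d \<Longrightarrow>
      A' \<in> carrier_mat b e \<Longrightarrow> B' \<in> carrier_mat d f \<Longrightarrow> F A B * F A' B' = F (A * A') (B * B')"
    and tr: "\<And>A B. (F A B)\<^sup>T = F (A\<^sup>T) (B\<^sup>T)"
    and one: "\<And>n m. F (1\<^sub>m n) (1\<^sub>m m) = 1\<^sub>m (h n m)"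
  shows "congr_mat A A' \<Longrightarrow> congr_mat B B' \<Longrightarrow> square_mat A \<Longrightarrow> square_mat A' \<Longrightarrow> square_mat B \<Longrightarrow>
      square_mat B' \<Longrightarrow> congr_mat (F A B) (F A' B')"
    and "gram_mat A \<Longrightarrow> gram_mat B \<Longrightarrow> gram_mat (F A B)"
proof -
  assume *: "congr_mat A A'" "congr_mat B B'" "square_mat A" "square_mat A'" "square_mat B" "square_mat B'"
  define n n' m m' where "n = dim_row A" and "n' = dim_row A'" and "m = dim_row B" and "m' = dim_row B'"
  have A: "A \<in> carrier_mat n n" and A': "A' \<in> carrier_mat n' n'"
    and B: "B \<in> carrier_mat m m" and B': "B' \<in> carrier_mat m' m'"
    using * by (auto simp: n_def n'_def m_def m'_def)
  obtain P Q where P: "P \<in> carrier_mat n' n" and Q: "Q \<in> carrier_mat n n'"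
    and PQ: "P * Q = 1\<^sub>m n'" and QP: "Q * P = 1\<^sub>m n" and AA: "A = P\<^sup>T * A' * P"
    by (rule congr_matE[OF *(1) A A'])
  obtain R S where R: "R \<in> carrier_mat m' m" and S: "S \<in> carrier_mat m m'"
    and RS: "R * S = 1\<^sub>m m'" and SR: "S * R = 1\<^sub>m m" and BB: "B = R\<^sup>T * B' * R"
    by (rule congr_matE[OF *(2) B B'])
  show "congr_mat (F A B) (F A' B')"
  proof (rule congr_matI[OF carr[OF A B] carr[OF A' B'] carr[OF P R] carr[OF Q S]])
    show "F P R * F Q S = 1\<^sub>m (h n' m')" using mult[OF P R Q S] PQ RS one by simp
    show "F Q S * F P R = 1\<^sub>m (h n m)" using mult[OF Q S P R] QP SR one by simp
    have "(F P R)\<^sup>T * F A' B' * F P R = F (P\<^sup>T * A') (R\<^sup>T * B') * F P R"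
      using mult[of "P\<^sup>T" n n' "R\<^sup>T" m m' A' n' B' m'] P R A' B' by (simp add: tr)
    also have "\<dots> = F A B" unfolding AA BB
      by (rule mult[of _ n n' _ m m' _ n _ m]) (use P R A' B' in auto)
    finally show "F A B = (F P R)\<^sup>T * F A' B' * F P R" by simp
  qed
next
  assume *: "gram_mat A" "gram_mat B"
  define n m where "n = dim_row A" and "m = dim_row B"
  have A: "A \<in> carrier_mat n n" and B: "B \<in> carrier_mat m m"
    using * unfolding gram_mat_iff by (auto simp: n_def m_def)
  obtain A' B' where A': "A' \<in> carrier_mat n n" "A * A' = 1\<^sub>m n"
    and B': "B' \<in> carrier_mat m m" "B * B' = 1\<^sub>m m"
    and sym: "A\<^sup>T = A" "B\<^sup>T = B"
    using * unfolding gram_mat_iff by (auto simp: n_def m_def)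
  have FAB: "F A B \<in> carrier_mat (h n m) (h n m)" by (rule carr[OF A B])
  moreover have "F A B * F A' B' = 1\<^sub>m (h n m)"
    using mult[OF A B A'(1) B'(1)] A'(2) B'(2) one by simp
  ultimately show "gram_mat (F A B)" unfolding gram_mat_iff
    using carr[OF A'(1) B'(1)] tr[of A B] sym by (auto intro!: bexI[of _ "F A' B'"])
qed

lemmas dsum_congr = binop_congr(1)[of dsum_mat "(+)", OF dsum_carrier dsum_mult dsum_transpose dsum_one]
lemmas dsum_gram = binop_congr(2)[of dsum_mat "(+)", OF dsum_carrier dsum_mult dsum_transpose dsum_one]
lemmas kron_congr = binop_congr(1)[of kron_mat "(*)", OF kron_carrier kron_mult kron_transpose kron_one]
lemmas kron_gram = binop_congr(2)[of kron_mat "(*)", OF kron_carrier kron_mult kron_transpose kron_one]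

lemma dsum_assoc: "dsum_mat (dsum_mat A B) C = dsum_mat A (dsum_mat B C)"
  by (rule eq_matI) (simp_all add: dsum_mat_def less_diff_conv2 add.assoc)

lemma dsum_comm:
  assumes "square_mat A" "square_mat B"
  shows "congr_mat (dsum_mat A B) (dsum_mat B A)"
proof -
  define n m where "n = dim_row A" and "m = dim_row B"
  have A: "A \<in> carrier_mat n n" and B: "B \<in> carrier_mat m m" using assms by (auto simp: n_def m_def)
  show ?thesis
  proof (rule congr_mat_perm[OF dsum_carrier[OF A B] dsum_carrier[OF B A],
        of "\<lambda>i. if i < n then i + m else i - n"])
    show "bij_betw (\<lambda>i. if i < n then i + m else i - n) {0..<n + m} {0..<m + n}"
      by (rule bij_betw_byWitness[where f' = "\<lambda>i. if i < m then i + n else i - m"]) auto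
  qed (use A B in \<open>auto simp: dsum_mat_def\<close>)
qed

lemma kron_comm:
  assumes "square_mat A" "square_mat B"
  shows "congr_mat (kron_mat A B) (kron_mat B A)"
proof -
  define n m where "n = dim_row A" and "m = dim_row B"
  have A: "A \<in> carrier_mat n n" and B: "B \<in> carrier_mat m m" using assms by (auto simp: n_def m_def)
  have swap: "i mod m * n + i div m < m * n" "(i mod m * n + i div m) div n = i mod m"
    "(i mod m * n + i div m) mod n = i div m" if "i < n * m" for i n m :: nat
    using kron_index_less[OF that] mult_le_mono1[of "Suc (i mod m)" m n] by auto
  show ?thesis
  proof (rule congr_mat_perm[OF kron_carrier[OF A B] kron_carrier[OF B A],
        of "\<lambda>i. i mod m * n + i div m"])
    show "bij_betw (\<lambda>i. i mod m * n + i div m) {0..<n * m} {0..<m * n}"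
    proof (rule bij_betw_byWitness[where f' = "\<lambda>i. i mod n * m + i div n"])
      show "\<forall>a\<in>{0..<n * m}. (a mod m * n + a div m) mod n * m + (a mod m * n + a div m) div n = a"
        by (auto simp: swap kron_index_less)
      show "\<forall>a\<in>{0..<m * n}. (a mod n * m + a div n) mod m * n + (a mod n * m + a div n) div m = a"
        by (auto simp: swap kron_index_less)
    qed (auto simp: swap)
    fix i j assume "i < n * m" "j < n * m"
    thus "kron_mat A B $$ (i, j) = kron_mat B A $$ (i mod m * n + i div m, j mod m * n + j div m)"
      using A B by (simp add: kron_mat_def swap kron_index_less)
  qed
qed

lemma kron_assoc: "kron_mat (kron_mat A B) C = kron_mat A (kron_mat B C)"
proof (rule eq_matI)
  fix i j assume "i < dim_row (kron_mat A (kron_mat B C))" "j < dim_col (kron_mat A (kron_mat B C))"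
  hence ij: "i < dim_row A * dim_row B * dim_row C" "j < dim_col A * dim_col B * dim_col C"
    by (auto simp: kron_mat_def mult.assoc)
  have aux: "i div c div b = i div (b * c)" "i div c mod b = i mod (b * c) div c"
    "i mod (b * c) mod c = i mod c" for i b c :: nat
  proof -
    show "i div c div b = i div (b * c)" by (metis div_mult2_eq mult.commute)
    have "i mod (c * b) = c * (i div c mod b) + i mod c" by (rule mod_mult2_eq)
    thus "i div c mod b = i mod (b * c) div c" by (cases "c = 0") (auto simp: mult.commute)
    show "i mod (b * c) mod c = i mod c" by (simp add: mod_mod_cancel)
  qed
  have l: "i mod (b * c) < b * c" if "i < a * b * c" for i a b c :: nat
    using that by (cases "b * c = 0") auto
  show "kron_mat (kron_mat A B) C $$ (i, j) = kron_mat A (kron_mat B C) $$ (i, j)"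
    using ij kron_index_less[OF ij(1)] kron_index_less[OF ij(2)] l[OF ij(1)] l[OF ij(2)]
    by (simp add: kron_mat_def aux mult.assoc)
qed (auto simp: kron_mat_def mult.assoc)

lemma kron_dsum: "kron_mat (dsum_mat A B) C = dsum_mat (kron_mat A C) (kron_mat B C)"
proof (rule eq_matI)
  fix i j assume "i < dim_row (dsum_mat (kron_mat A C) (kron_mat B C))"
    "j < dim_col (dsum_mat (kron_mat A C) (kron_mat B C))"
  hence ij: "i < (dim_row A + dim_row B) * dim_row C" "j < (dim_col A + dim_col B) * dim_col C"
    by (auto simp: kron_mat_def dsum_mat_def algebra_simps)
  have aux: "i div c < a \<longleftrightarrow> i < a * c" "(i - a * c) div c = i div c - a"
     "\<not> i < a * c \<Longrightarrow> (i - a * c) mod c = i mod c" if "i < (a + b) * c" for i a b c :: nat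
  proof -
    have c: "c > 0" using that by (cases c) auto
    show "i div c < a \<longleftrightarrow> i < a * c" using c by (simp add: div_less_iff_less_mult)
    show "(i - a * c) div c = i div c - a"
    proof (cases "i < a * c")
      case True
      thus ?thesis using \<open>i div c < a \<longleftrightarrow> i < a * c\<close> by simp
    next
      case False
      then obtain r where "i = a * c + r" by (metis le_Suc_ex not_less)
      thus ?thesis using c by simp
    qed
    assume "\<not> i < a * c"
    then obtain r where "i = a * c + r" by (metis le_Suc_ex not_less)
    thus "(i - a * c) mod c = i mod c" by simp
  qed
  show "kron_mat (dsum_mat A B) C $$ (i, j) = dsum_mat (kron_mat A C) (kron_mat B C) $$ (i, j)"
    using ij kron_index_less[OF ij(1)] kron_index_less[OF ij(2)] aux[OF ij(1)] aux[OF ij(2)]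
    by (simp add: kron_mat_def dsum_mat_def) (auto simp: algebra_simps)
qed (auto simp: kron_mat_def dsum_mat_def algebra_simps)

subsection \<open>The Grothendieck--Witt ring\<close>

lemma iso_gram_iff: "iso_gram A B \<longleftrightarrow> gram_mat A \<and> gram_mat B \<and> congr_mat A B"
proof -
  have "isometric (coord_space (dim_row A)) (mat_form A) (coord_space (dim_row B)) (mat_form B) \<longleftrightarrow>
      congr_mat A B" if "gram_mat A" "gram_mat B"
    by (rule isometric_iff_congr; rule carrier_matI) (use that in \<open>simp_all add: gram_mat_def\<close>)
  thus ?thesis unfolding iso_gram_def by blast
qed

lemma gram_mat_square: "gram_mat A \<Longrightarrow> square_mat A"
  by (simp add: gram_mat_def)

lemma gram_mat_dim: "gram_mat A \<Longrightarrow> dim_col A = dim_row A"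
  by (simp add: gram_mat_def)

text \<open>Every finite-dimensional space is isomorphic to some \<open>coord_space n\<close>, and every bilinear form
  there is \<open>mat_form A\<close> for a unique \<open>A\<close>. So the following type is the set of isometry classes of
  nondegenerate symmetric bilinear forms on finite-dimensional spaces.\<close>

quotient_type (overloaded) 'k form_class = "'k::field mat" / partial: iso_gram
proof (rule part_equivpI)
  show "\<exists>A::'k mat. iso_gram A A"
    by (intro exI[of _ "0\<^sub>m 0 0"]) (auto simp: iso_gram_iff gram_mat_iff intro!: congr_mat_refl)
  show "symp (iso_gram :: 'k mat \<Rightarrow> _)"
    by (rule sympI) (auto simp: iso_gram_iff intro: congr_mat_sym gram_mat_square)
  show "transp (iso_gram :: 'k mat \<Rightarrow> _)"
    by (rule transpI) (auto simp: iso_gram_iff intro: congr_mat_trans gram_mat_square)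
qed

lemma iso_gram_refl: "gram_mat A \<Longrightarrow> iso_gram A A"
  using iso_gram_iff congr_mat_refl gram_mat_square by blast

lemma iso_gramD: "iso_gram A A \<Longrightarrow> gram_mat A" "iso_gram A B \<Longrightarrow> gram_mat A" "iso_gram A B \<Longrightarrow> gram_mat B"
  by (auto simp: iso_gram_iff)

lemma right_inverse_dim_le:
  fixes P :: "'k::field mat"
  assumes P: "P \<in> carrier_mat m n" and Q: "Q \<in> carrier_mat n m" and PQ: "P * Q = 1\<^sub>m m"
  shows "m \<le> n"
proof (rule ccontr)
  assume "\<not> m \<le> n"
  hence nm: "n < m" by simp
  define P' where "P' = mat m m (\<lambda>(i, j). if j < n then P $$ (i, j) else 0)"
  define Q' where "Q' = mat m m (\<lambda>(i, j). if i < n then Q $$ (i, j) else 0)"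
  have P': "P' \<in> carrier_mat m m" and Q': "Q' \<in> carrier_mat m m" by (auto simp: P'_def Q'_def)
  have "P' * Q' = 1\<^sub>m m"
  proof (rule eq_matI)
    fix i j assume "i < dim_row (1\<^sub>m m :: 'k mat)" "j < dim_col (1\<^sub>m m :: 'k mat)"
    hence ij: "i < m" "j < m" by auto
    have "(P' * Q') $$ (i, j) = (\<Sum>k\<in>{0..<m}. P' $$ (i, k) * Q' $$ (k, j))"
      using ij P' Q' by (simp add: scalar_prod_def)
    also have "\<dots> = (\<Sum>k\<in>{0..<n}. P' $$ (i, k) * Q' $$ (k, j))"
      using nm ij by (intro sum.mono_neutral_right) (auto simp: P'_def)
    also have "\<dots> = (\<Sum>k\<in>{0..<n}. P $$ (i, k) * Q $$ (k, j))"
      using nm ij by (intro sum.cong) (auto simp: P'_def Q'_def)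
    also have "\<dots> = (P * Q) $$ (i, j)" using ij P Q by (simp add: scalar_prod_def)
    finally show "(P' * Q') $$ (i, j) = 1\<^sub>m m $$ (i, j)" using PQ by simp
  qed (use P' Q' in auto)
  hence "Q' * P' = 1\<^sub>m m" by (rule mat_mult_left_right_inverse[OF P' Q'])
  hence "(Q' * P') $$ (n, n) = 1" using nm by simp
  moreover have "(Q' * P') $$ (n, n) = (\<Sum>k\<in>{0..<m}. Q' $$ (n, k) * P' $$ (k, n))"
    using nm P' Q' by (simp add: scalar_prod_def)
  moreover have "\<dots> = 0" using nm by (intro sum.neutral) (auto simp: Q'_def)
  ultimately show False by simp
qed

lemma congr_mat_dim: "congr_mat A B \<Longrightarrow> dim_row A = dim_row B"
  unfolding congr_mat_def by (metis right_inverse_dim_le le_antisym)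

lift_definition form_dim :: "'k::field form_class \<Rightarrow> nat" is dim_row
  by (auto simp: iso_gram_iff congr_mat_dim)

instantiation form_class :: (field) comm_semiring_1
begin

lift_definition zero_form_class :: "'a form_class" is "0\<^sub>m 0 0"
  by (rule iso_gram_refl) (auto simp: gram_mat_iff)

lift_definition one_form_class :: "'a form_class" is "1\<^sub>m 1"
  by (rule iso_gram_refl) (auto simp: gram_mat_iff intro!: bexI[of _ "1\<^sub>m (Suc 0)"])

lift_definition plus_form_class :: "'a form_class \<Rightarrow> 'a form_class \<Rightarrow> 'a form_class" is dsum_mat
  by (auto simp: iso_gram_iff gram_mat_dim intro!: dsum_congr dsum_gram)

lift_definition times_form_class :: "'a form_class \<Rightarrow> 'a form_class \<Rightarrow> 'a form_class" is kron_mat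
  by (auto simp: iso_gram_iff gram_mat_dim intro!: kron_congr kron_gram)

instance
proof
  fix a b c :: "'a form_class"
  show "a + b + c = a + (b + c)"
    by transfer (auto simp: dsum_assoc intro!: iso_gram_refl dsum_gram dest: iso_gramD)
  show comm: "a + b = b + a" for a b :: "'a form_class"
    by transfer (auto simp: iso_gram_iff gram_mat_dim intro!: dsum_comm dsum_gram)
  show "0 + a = a"
  proof transfer
    fix A :: "'a mat" assume A: "iso_gram A A"
    have "dsum_mat (0\<^sub>m 0 0) A = A" by (rule eq_matI) (auto simp: dsum_mat_def)
    thus "iso_gram (dsum_mat (0\<^sub>m 0 0) A) A" using A by simp
  qed
  show "a * b * c = a * (b * c)"
    by transfer (auto simp: kron_assoc intro!: iso_gram_refl kron_gram dest: iso_gramD)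
  show tcomm: "a * b = b * a" for a b :: "'a form_class"
    by transfer (auto simp: iso_gram_iff gram_mat_dim intro!: kron_comm kron_gram)
  show "1 * a = a"
  proof transfer
    fix A :: "'a mat" assume A: "iso_gram A A"
    have "kron_mat (1\<^sub>m 1) A = A" by (rule eq_matI) (auto simp: kron_mat_def)
    thus "iso_gram (kron_mat (1\<^sub>m 1) A) A" using A by simp
  qed
  show "(a + b) * c = a * c + b * c"
    by transfer (auto simp: kron_dsum intro!: iso_gram_refl dsum_gram kron_gram dest: iso_gramD)
  show z: "0 * a = 0" for a :: "'a form_class"
  proof transfer
    fix A :: "'a mat"
    have "kron_mat (0\<^sub>m 0 0) A = 0\<^sub>m 0 0" by (rule eq_matI) (auto simp: kron_mat_def)
    moreover have "iso_gram (0\<^sub>m 0 0 :: 'a mat) (0\<^sub>m 0 0)"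
      by (rule iso_gram_refl) (auto simp: gram_mat_iff)
    ultimately show "iso_gram (kron_mat (0\<^sub>m 0 0) A) (0\<^sub>m 0 0)" by simp
  qed
  show "a * 0 = 0" unfolding tcomm[of a 0] by (rule z)
  show "(0::'a form_class) \<noteq> 1"
    by transfer (auto simp: iso_gram_iff dest: congr_mat_dim)
qed

end

lemma form_dim_plus: "form_dim (a + b) = form_dim a + form_dim b"
  by transfer (simp add: dsum_mat_def)

lemma form_dim_one: "form_dim 1 = 1"
  by transfer simp

text \<open>The pair \<open>(a, b)\<close> stands for the formal difference \<open>a - b\<close>.\<close>

definition gw_rel :: "'k::field form_class \<times> 'k form_class \<Rightarrow> 'k form_class \<times> 'k form_class \<Rightarrow> bool" where
  "gw_rel x y \<longleftrightarrow> (\<exists>k. fst x + snd y + k = fst y + snd x + k)"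

quotient_type (overloaded) 'k gw = "'k::field form_class \<times> 'k form_class" / gw_rel
proof (rule equivpI)
  show "reflp (gw_rel :: 'k form_class \<times> 'k form_class \<Rightarrow> _)"
    by (rule reflpI) (auto simp: gw_rel_def)
  show "symp (gw_rel :: 'k form_class \<times> 'k form_class \<Rightarrow> _)"
    by (rule sympI) (auto simp: gw_rel_def intro: sym)
  show "transp (gw_rel :: 'k form_class \<times> 'k form_class \<Rightarrow> _)"
  proof (rule transpI)
    fix x y z :: "'k form_class \<times> 'k form_class"
    assume "gw_rel x y" "gw_rel y z"
    then obtain k l where kl: "fst x + snd y + k = fst y + snd x + k" "fst y + snd z + l = fst z + snd y + l"
      unfolding gw_rel_def by blast
    have "fst x + snd z + (fst y + snd y + k + l) = (fst x + snd y + k) + (fst y + snd z + l)"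
      by (simp add: ac_simps)
    also have "\<dots> = (fst y + snd x + k) + (fst z + snd y + l)" by (simp only: kl)
    also have "\<dots> = fst z + snd x + (fst y + snd y + k + l)" by (simp add: ac_simps)
    finally show "gw_rel x z" unfolding gw_rel_def by blast
  qed
qed

lemma gw_rel_times_left:
  assumes "gw_rel (a, b) (a', b')"
  shows "gw_rel (a * c + b * d, a * d + b * c) (a' * c + b' * d, a' * d + b' * c)"
proof -
  from assms obtain k where k: "a + b' + k = a' + b + k" unfolding gw_rel_def by auto
  have "(a * c + b * d) + (a' * d + b' * c) + (k * c + k * d) = (a + b' + k) * c + (a' + b + k) * d"
    by (simp add: algebra_simps)
  also have "\<dots> = (a' + b + k) * c + (a + b' + k) * d" by (simp only: k)
  also have "\<dots> = (a' * c + b' * d) + (a * d + b * c) + (k * c + k * d)" by (simp add: algebra_simps)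
  finally show ?thesis unfolding gw_rel_def by auto
qed

lemma gw_rel_times_right:
  assumes "gw_rel (c, d) (c', d')"
  shows "gw_rel (a * c + b * d, a * d + b * c) (a * c' + b * d', a * d' + b * c')"
  using gw_rel_times_left[OF assms, of a b] by (simp add: algebra_simps)

instantiation gw :: (field) comm_ring_1
begin

lift_definition zero_gw :: "'a gw" is "(0, 0)" .
lift_definition one_gw :: "'a gw" is "(1, 0)" .
lift_definition uminus_gw :: "'a gw \<Rightarrow> 'a gw" is "\<lambda>(a, b). (b, a)"
  by (auto simp: gw_rel_def ac_simps) metis
lift_definition plus_gw :: "'a gw \<Rightarrow> 'a gw \<Rightarrow> 'a gw" is "\<lambda>(a, b) (c, d). (a + c, b + d)"
proof (clarsimp simp: gw_rel_def)
  fix a b c d a' b' c' d' k l :: "'a form_class"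
  assume kl: "a + b' + k = a' + b + k" "c + d' + l = c' + d + l"
  have "a + c + (b' + d') + (k + l) = (a + b' + k) + (c + d' + l)" by (simp add: ac_simps)
  also have "\<dots> = (a' + b + k) + (c' + d + l)" by (simp only: kl)
  also have "\<dots> = a' + c' + (b + d) + (k + l)" by (simp add: ac_simps)
  finally show "\<exists>k. a + c + (b' + d') + k = a' + c' + (b + d) + k" by blast
qed
definition minus_gw :: "'a gw \<Rightarrow> 'a gw \<Rightarrow> 'a gw" where "minus_gw x y = x + (- y)"
lift_definition times_gw :: "'a gw \<Rightarrow> 'a gw \<Rightarrow> 'a gw" is
  "\<lambda>(a, b) (c, d). (a * c + b * d, a * d + b * c)"
proof clarsimp
  fix a b c d a' b' c' d' :: "'a form_class"
  assume "gw_rel (a, b) (a', b')" "gw_rel (c, d) (c', d')"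
  from gw_rel_times_left[OF this(1), of c d] gw_rel_times_right[OF this(2), of a' b']
  show "gw_rel (a * c + b * d, a * d + b * c) (a' * c' + b' * d', a' * d' + b' * c')"
    using gw_equivp by (meson equivp_transp)
qed

instance
proof
  fix a b c :: "'a gw"
  show "a + b + c = a + (b + c)" by transfer (auto simp: gw_rel_def ac_simps)
  show "a + b = b + a" by transfer (auto simp: gw_rel_def ac_simps)
  show "0 + a = a" by transfer (auto simp: gw_rel_def)
  show "- a + a = 0" by transfer (auto simp: gw_rel_def ac_simps)
  show "a - b = a + - b" by (rule minus_gw_def)
  show "a * b * c = a * (b * c)" by transfer (auto simp: gw_rel_def algebra_simps)
  show "a * b = b * a" by transfer (auto simp: gw_rel_def algebra_simps)
  show "1 * a = a" by transfer (auto simp: gw_rel_def)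
  show "(a + b) * c = a * c + b * c" by transfer (auto simp: gw_rel_def algebra_simps)
  show "(0::'a gw) \<noteq> 1"
  proof (transfer, clarsimp simp: gw_rel_def)
    fix k :: "'a form_class" assume "k = 1 + k"
    hence "form_dim k = form_dim (1 + k)" by simp
    thus False by (simp add: form_dim_plus form_dim_one)
  qed
qed

end

definition gw_of :: "'k::field form_class \<Rightarrow> 'k gw" where
  "gw_of a = abs_gw (a, 0)"

text \<open>The class of a form on an arbitrary finite-dimensional space is that of any isometric form on a
  coordinate space.\<close>

definition gw_class :: "('k::field, 'v) module \<Rightarrow> ('v \<Rightarrow> 'v \<Rightarrow> 'k) \<Rightarrow> 'k gw" where
  "gw_class V \<beta> = (THE c. \<exists>A. gram_mat A \<and>
     isometric V \<beta> (coord_space (dim_row A)) (mat_form A) \<and> c = gw_of (abs_form_class A))"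

definition gw_unit :: "'k::field \<Rightarrow> 'k gw" where
  "gw_unit u = gw_class self_module (\<lambda>x y. u * x * y)"

section \<open>Polynomials and the local ring at the origin\<close>

type_synonym ('n, 'k) mpoly = "('n \<Rightarrow>\<^sub>0 nat) \<Rightarrow>\<^sub>0 'k"

definition Var :: "'n \<Rightarrow> ('n, 'k::field) mpoly" where
  "Var i = Poly_Mapping.single (Poly_Mapping.single i 1) 1"

definition Const :: "'k::field \<Rightarrow> ('n, 'k) mpoly" where
  "Const c = Poly_Mapping.single 0 c"

definition eval0 :: "('n, 'k::field) mpoly \<Rightarrow> 'k" where
  "eval0 p = Poly_Mapping.lookup p 0"

definition mpoly_subst :: "('m::finite \<Rightarrow> ('n, 'k::field) mpoly) \<Rightarrow> ('m, 'k) mpoly \<Rightarrow> ('n, 'k) mpoly" where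
  "mpoly_subst q p =
     (\<Sum>m\<in>Poly_Mapping.keys p. Const (Poly_Mapping.lookup p m) * (\<Prod>i\<in>UNIV. q i ^ Poly_Mapping.lookup m i))"

lemma eval0_one: "eval0 1 = 1"
  by (simp add: eval0_def lookup_one)

lemma eval0_mult:
  fixes p q :: "('n, 'k::field) mpoly"
  shows "eval0 (p * q) = eval0 p * eval0 q"
proof -
  have zero: "0 = l + m \<longleftrightarrow> l = 0 \<and> m = 0" for l m :: "'n \<Rightarrow>\<^sub>0 nat"
    by (auto simp: poly_mapping_eq_iff lookup_add fun_eq_iff)
  have "eval0 (p * q) = Sum_any (\<lambda>l. Poly_Mapping.lookup p l * Sum_any (\<lambda>m. Poly_Mapping.lookup q m when l = 0 \<and> m = 0))"
    unfolding eval0_def lookup_mult by (simp only: zero)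
  also have "\<dots> = Sum_any (\<lambda>l :: 'n \<Rightarrow>\<^sub>0 nat. (Poly_Mapping.lookup p 0 * Poly_Mapping.lookup q 0) when l = 0)"
  proof (rule Sum_any.cong)
    fix l :: "'n \<Rightarrow>\<^sub>0 nat"
    show "Poly_Mapping.lookup p l * Sum_any (\<lambda>m. Poly_Mapping.lookup q m when l = 0 \<and> m = 0) =
        (Poly_Mapping.lookup p 0 * Poly_Mapping.lookup q 0 when l = 0)"
      by (cases "l = 0") auto
  qed
  also have "\<dots> = Poly_Mapping.lookup p 0 * Poly_Mapping.lookup q 0" by simp
  finally show ?thesis by (simp add: eval0_def)
qed

text \<open>Localisation at the maximal ideal \<open>{p. eval0 p = 0}\<close>; the pair \<open>(p, s)\<close> stands for the
  fraction \<open>p / s\<close>.\<close>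

definition local_rel ::
  "('n, 'k::field) mpoly \<times> ('n, 'k) mpoly \<Rightarrow> ('n, 'k) mpoly \<times> ('n, 'k) mpoly \<Rightarrow> bool" where
  "local_rel x y \<longleftrightarrow> eval0 (snd x) \<noteq> 0 \<and> eval0 (snd y) \<noteq> 0 \<and>
     (\<exists>u. eval0 u \<noteq> 0 \<and> u * (fst x * snd y - fst y * snd x) = 0)"

lemma local_relI:
  "eval0 s \<noteq> 0 \<Longrightarrow> eval0 t \<noteq> 0 \<Longrightarrow> eval0 u \<noteq> 0 \<Longrightarrow> u * (p * t - q * s) = 0 \<Longrightarrow> local_rel (p, s) (q, t)"
  by (auto simp: local_rel_def)

lemma local_rel_eqI:
  "eval0 s \<noteq> 0 \<Longrightarrow> eval0 t \<noteq> 0 \<Longrightarrow> p * t = q * s \<Longrightarrow> local_rel (p, s) (q, t)"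
  by (rule local_relI[of _ _ 1]) (auto simp: eval0_one)

quotient_type (overloaded) ('n, 'k) local_poly = "('n, 'k::field) mpoly \<times> ('n, 'k) mpoly" / partial: local_rel
proof (rule part_equivpI)
  show "\<exists>x :: ('n, 'k) mpoly \<times> ('n, 'k) mpoly. local_rel x x"
    by (intro exI[of _ "(0, 1)"] local_rel_eqI) (auto simp: eval0_one)
  show "symp (local_rel :: ('n, 'k) mpoly \<times> ('n, 'k) mpoly \<Rightarrow> _)"
  proof (rule sympI, clarsimp simp: local_rel_def)
    fix p s q t u :: "('n, 'k) mpoly"
    assume "eval0 u \<noteq> 0" "u * (p * t - q * s) = 0"
    moreover have "u * (q * s - p * t) = - (u * (p * t - q * s))" by (simp add: algebra_simps)
    ultimately show "\<exists>u. eval0 u \<noteq> 0 \<and> u * (q * s - p * t) = 0" by auto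
  qed
  show "transp (local_rel :: ('n, 'k) mpoly \<times> ('n, 'k) mpoly \<Rightarrow> _)"
  proof (rule transpI, clarsimp simp: local_rel_def)
    fix p s q t r w u v :: "('n, 'k) mpoly"
    assume *: "eval0 t \<noteq> 0" "eval0 u \<noteq> 0" "u * (p * t - q * s) = 0" "eval0 v \<noteq> 0" "v * (q * w - r * t) = 0"
    have "(u * v * t) * (p * w - r * s) = v * w * (u * (p * t - q * s)) + u * s * (v * (q * w - r * t))"
      by (simp add: algebra_simps)
    also have "\<dots> = 0" by (simp only: *) simp
    finally show "\<exists>u. eval0 u \<noteq> 0 \<and> u * (p * w - r * s) = 0"
      using * by (intro exI[of _ "u * v * t"]) (auto simp: eval0_mult)
  qed
qed

instantiation local_poly :: (type, field) comm_ring_1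
begin

lift_definition zero_local_poly :: "('a, 'b) local_poly" is "(0, 1)"
  by (rule local_rel_eqI) (auto simp: eval0_one)
lift_definition one_local_poly :: "('a, 'b) local_poly" is "(1, 1)"
  by (rule local_rel_eqI) (auto simp: eval0_one)
lift_definition uminus_local_poly :: "('a, 'b) local_poly \<Rightarrow> ('a, 'b) local_poly" is "\<lambda>(p, s). (- p, s)"
proof (clarsimp simp: local_rel_def)
  fix p s q t u :: "('a, 'b) mpoly"
  assume "eval0 u \<noteq> 0" "u * (p * t - q * s) = 0"
  moreover have "u * (q * s - p * t) = - (u * (p * t - q * s))" by (simp add: algebra_simps)
  ultimately show "\<exists>u. eval0 u \<noteq> 0 \<and> u * (q * s - p * t) = 0" by auto
qed
lift_definition plus_local_poly :: "('a, 'b) local_poly \<Rightarrow> ('a, 'b) local_poly \<Rightarrow> ('a, 'b) local_poly"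
  is "\<lambda>(p, s) (q, t). (p * t + q * s, s * t)"
proof (clarsimp simp: local_rel_def eval0_mult)
  fix p s p' s' q t q' t' u v :: "('a, 'b) mpoly"
  assume *: "eval0 u \<noteq> 0" "u * (p * s' - p' * s) = 0" "eval0 v \<noteq> 0" "v * (q * t' - q' * t) = 0"
  have "(u * v) * ((p * t + q * s) * (s' * t') - (p' * t' + q' * s') * (s * t)) =
      v * t * t' * (u * (p * s' - p' * s)) + u * s * s' * (v * (q * t' - q' * t))"
    by (simp add: algebra_simps)
  also have "\<dots> = 0" by (simp only: *) simp
  finally show "\<exists>u. eval0 u \<noteq> 0 \<and> u * ((p * t + q * s) * (s' * t') - (p' * t' + q' * s') * (s * t)) = 0"
    using * by (intro exI[of _ "u * v"]) (auto simp: eval0_mult)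
qed
definition minus_local_poly :: "('a, 'b) local_poly \<Rightarrow> ('a, 'b) local_poly \<Rightarrow> ('a, 'b) local_poly" where
  "minus_local_poly x y = x + (- y)"
lift_definition times_local_poly :: "('a, 'b) local_poly \<Rightarrow> ('a, 'b) local_poly \<Rightarrow> ('a, 'b) local_poly"
  is "\<lambda>(p, s) (q, t). (p * q, s * t)"
proof (clarsimp simp: local_rel_def eval0_mult)
  fix p s p' s' q t q' t' u v :: "('a, 'b) mpoly"
  assume *: "eval0 u \<noteq> 0" "u * (p * s' - p' * s) = 0" "eval0 v \<noteq> 0" "v * (q * t' - q' * t) = 0"
  have "(u * v) * (p * q * (s' * t') - p' * q' * (s * t)) =
      v * q * t' * (u * (p * s' - p' * s)) + u * p' * s * (v * (q * t' - q' * t))"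
    by (simp add: algebra_simps)
  also have "\<dots> = 0" by (simp only: *) simp
  finally show "\<exists>u. eval0 u \<noteq> 0 \<and> u * (p * q * (s' * t') - p' * q' * (s * t)) = 0"
    using * by (intro exI[of _ "u * v"]) (auto simp: eval0_mult)
qed

instance
proof
  fix a b c :: "('a, 'b) local_poly"
  have d: "eval0 (snd x) \<noteq> 0" if "local_rel x x" for x :: "('a, 'b) mpoly \<times> ('a, 'b) mpoly"
    using that by (simp add: local_rel_def)
  show "a + b + c = a + (b + c)"
    by transfer (auto simp: eval0_mult algebra_simps dest!: d intro!: local_rel_eqI)
  show "a + b = b + a"
    by transfer (auto simp: eval0_mult algebra_simps dest!: d intro!: local_rel_eqI)
  show "0 + a = a"
    by transfer (auto simp: eval0_mult eval0_one algebra_simps dest!: d intro!: local_rel_eqI)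
  show "- a + a = 0"
    by transfer (auto simp: eval0_mult eval0_one algebra_simps dest!: d intro!: local_rel_eqI)
  show "a - b = a + - b" by (rule minus_local_poly_def)
  show "a * b * c = a * (b * c)"
    by transfer (auto simp: eval0_mult algebra_simps dest!: d intro!: local_rel_eqI)
  show "a * b = b * a"
    by transfer (auto simp: eval0_mult algebra_simps dest!: d intro!: local_rel_eqI)
  show "1 * a = a"
    by transfer (auto simp: eval0_mult eval0_one algebra_simps dest!: d intro!: local_rel_eqI)
  show "(a + b) * c = a * c + b * c"
    by transfer (auto simp: eval0_mult algebra_simps dest!: d intro!: local_rel_eqI)
  show "(0 :: ('a, 'b) local_poly) \<noteq> 1"
    by transfer (auto simp: local_rel_def eval0_def)
qed

end

definition to_local :: "('n, 'k::field) mpoly \<Rightarrow> ('n, 'k) local_poly" where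
  "to_local p = abs_local_poly (p, 1)"

section \<open>The local algebra and the EKL-degree\<close>

text \<open>Tuples \<open>f\<close> of polynomials represent morphisms of affine space to itself. The scalar
  multiplication on \<open>Q(f)\<close> is multiplication by residue classes of constants.\<close>

definition local_ideal :: "('n::finite \<Rightarrow> ('n, 'k::field) mpoly) \<Rightarrow> ('n, 'k) local_poly set" where
  "local_ideal f = Idl\<^bsub>class_ring\<^esub> (range (\<lambda>i. to_local (f i)))"

definition residue :: "('n::finite \<Rightarrow> ('n, 'k::field) mpoly) \<Rightarrow> ('n, 'k) mpoly \<Rightarrow> ('n, 'k) local_poly set" where
  "residue f p = local_ideal f +>\<^bsub>class_ring\<^esub> to_local p"

definition local_algebra ::
  "('n::finite \<Rightarrow> ('n, 'k::field) mpoly) \<Rightarrow> ('k, ('n, 'k) local_poly set) module" where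
  "local_algebra f = (let Q = class_ring Quot local_ideal f in
     \<lparr>carrier = carrier Q, mult = mult Q, one = one Q, zero = zero Q, add = add Q,
      smult = (\<lambda>c x. residue f (Const c) \<otimes>\<^bsub>Q\<^esub> x)\<rparr>)"

definition local_degree :: "('n::finite \<Rightarrow> ('n, 'k::field) mpoly) \<Rightarrow> nat" where
  "local_degree f = vectorspace.dim class_ring (local_algebra f)"

text \<open>Meaningful if \<open>f 0 = 0\<close> and the origin is isolated in its fibre. In that case \<open>A\<close> and \<open>\<phi>\<close>
  exist, the form is nondegenerate, and its class does not depend on them.\<close>

definition ekl_degree :: "('n::finite \<Rightarrow> ('n, 'k::field) mpoly) \<Rightarrow> 'k gw" where
  "ekl_degree f = (THE d. \<exists>(A :: ('n, 'k) mpoly ^ 'n ^ 'n) \<phi>.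
     (\<forall>i. f i = (\<Sum>j\<in>UNIV. vec_nth (vec_nth A i) j * Var j)) \<and>
     linear_map class_ring (local_algebra f) self_module \<phi> \<and>
     \<phi> (residue f (Determinants.det A)) = 1 \<and>
     d = gw_class (local_algebra f) (\<lambda>a b. \<phi> (a \<otimes>\<^bsub>local_algebra f\<^esub> b)))"

section \<open>Invariant polynomials of linear group actions\<close>

definition vs_basis :: "('k::field \<Rightarrow> 'v::ab_group_add \<Rightarrow> 'v) \<Rightarrow> ('n::finite \<Rightarrow> 'v) \<Rightarrow> bool" where
  "vs_basis smul b \<longleftrightarrow> inj b \<and> \<not> Modules.module.dependent smul (range b) \<and> Modules.module.span smul (range b) = UNIV"

definition linear_action ::
  "('k::field \<Rightarrow> 'v::ab_group_add \<Rightarrow> 'v) \<Rightarrow> ('g, 'z) monoid_scheme \<Rightarrow> ('g \<Rightarrow> 'v \<Rightarrow> 'v) \<Rightarrow> bool" where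
  "linear_action smul G \<rho> \<longleftrightarrow>
     group_action G UNIV \<rho> \<and> (\<forall>g\<in>carrier G. Vector_Spaces.linear smul smul (\<rho> g))"

definition coord :: "('k::field \<Rightarrow> 'v::ab_group_add \<Rightarrow> 'v) \<Rightarrow> ('n::finite \<Rightarrow> 'v) \<Rightarrow> 'v \<Rightarrow> 'n \<Rightarrow> 'k" where
  "coord smul b v i = Modules.module.representation smul (range b) v (b i)"

text \<open>With the coordinates \<open>x\<^sub>i\<close> dual to the basis \<open>b\<close>, the pullback of \<open>x\<^sub>i\<close> along a linear map \<open>T\<close> is
  the linear form whose value at \<open>b j\<close> is the \<open>i\<close>-th coordinate of \<open>T (b j)\<close>.\<close>

definition pullback ::
  "('k::field \<Rightarrow> 'v::ab_group_add \<Rightarrow> 'v) \<Rightarrow> ('n::finite \<Rightarrow> 'v) \<Rightarrow> ('v \<Rightarrow> 'v) \<Rightarrow> ('n, 'k) mpoly \<Rightarrow> ('n, 'k) mpoly" where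
  "pullback smul b T = mpoly_subst (\<lambda>i. \<Sum>j\<in>UNIV. Const (coord smul b (T (b j)) i) * Var j)"

text \<open>The group acts on polynomials by \<open>p \<mapsto> p \<circ> \<rho> g\<^sup>-\<^sup>1\<close>; the inverse does not affect invariance
  under the whole group.\<close>

definition invariant_polys ::
  "('k::field \<Rightarrow> 'v::ab_group_add \<Rightarrow> 'v) \<Rightarrow> ('n::finite \<Rightarrow> 'v) \<Rightarrow> ('g, 'z) monoid_scheme \<Rightarrow>
    ('g \<Rightarrow> 'v \<Rightarrow> 'v) \<Rightarrow> ('n, 'k) mpoly set" where
  "invariant_polys smul b G \<rho> = {p. \<forall>g\<in>carrier G. pullback smul b (\<rho> g) p = p}"

text \<open>The \<open>K\<close>-algebra homomorphism sending the \<open>i\<close>-th indeterminate to \<open>f i\<close> is an isomorphism of a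
  polynomial ring onto \<open>R\<close>.\<close>

definition polynomial_generators ::
  "('m::finite \<Rightarrow> ('n, 'k::field) mpoly) \<Rightarrow> ('n, 'k) mpoly set \<Rightarrow> bool" where
  "polynomial_generators f R \<longleftrightarrow> bij_betw (mpoly_subst f) UNIV R"

definition simple_reflection :: "('k::field \<Rightarrow> 'v::ab_group_add \<Rightarrow> 'v) \<Rightarrow> ('v \<Rightarrow> 'v) \<Rightarrow> bool" where
  "simple_reflection smul T \<longleftrightarrow> (\<exists>H v. Modules.module.subspace smul H \<and> v \<noteq> 0 \<and>
     H \<inter> Modules.module.span smul {v} = {0} \<and> Modules.module.span smul (insert v H) = UNIV \<and>
     (\<forall>x\<in>H. T x = x) \<and> T v = - v)"

end

theory Submission
  imports Defs
begin

text \<open>Write \<open>R = K[x\<^sub>1, ..., x\<^sub>n]\<close> and \<open>I\<close> for the ideal of \<open>R\<close> generated by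
  \<open>f\<^sub>1, ..., f\<^sub>n\<close>. Since the \<open>f\<^sub>i\<close> generate the ring of invariants and vanish
  at the origin, \<open>I\<close> contains every invariant without constant term. Each coordinate \<open>x\<^sub>j\<close>
  is a root of the monic polynomial with roots \<open>g x\<^sub>j\<close>, and the lower coefficients of that
  polynomial are such invariants. So \<open>x\<^sub>j ^ N \<in> I\<close> with \<open>N = |G|\<close>
  (\<open>Var_power_in_invariant_ideal\<close>), the ring \<open>R / I\<close> is finite-dimensional and local, and the
  localisation in the definition of \<open>Q(f)\<close> changes nothing: \<open>Q(f) = R / I\<close>.

  A simple reflection \<open>s\<close> fixes all \<open>f\<^sub>i\<close> and therefore acts on \<open>Q(f)\<close>. It sends the
  socle element \<open>E = det A\<close>, where \<open>f = A x\<close>, to \<open>- E\<close>: applying \<open>s\<close> to \<open>f = A x\<close> gives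
  \<open>f = s(A) M x\<close>, where \<open>M\<close> is the matrix of the reflection and \<open>det M = - 1\<close>, and modulo
  \<open>I\<close> the determinant does not depend on the matrix that expresses \<open>f\<close> through \<open>x\<close>
  (\<open>reflection_pullback\<close>). Given a functional \<open>l\<close> with \<open>l E = 1\<close>, the functional \<open>m = (l - l
  \<circ> s) / 2\<close> also satisfies \<open>m E = 1\<close>, and \<open>m \<circ> s = - m\<close>. So \<open>s\<close> is an involution
  of \<open>Q(f)\<close> that turns the form \<open>m (a b)\<close> into its negative. If \<open>m (x x) = c \<noteq> 0\<close>, then
  \<open>x\<close> and \<open>s x\<close> are orthogonal of lengths \<open>c\<close> and \<open>- c\<close>, and they span a hyperbolic plane.
  Splitting off such planes exhausts \<open>Q(f)\<close>, because the form is nondegenerate and \<open>2\<close> is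
  invertible (\<open>hyperbolic_basis_of_involution\<close>). To return to \<open>l\<close>, write \<open>l a = m (u a)\<close>; then
  \<open>u\<close> has constant term \<open>1\<close>, hence is a square modulo \<open>I\<close>, and multiplication by its root is
  an isometry between the two forms (\<open>hyperbolic_basis_twist\<close>).

  Two classical facts on \<open>E\<close> enter. The form of a functional \<open>l\<close> on \<open>Q(f)\<close> with \<open>l E = 1\<close> is
  nondegenerate (\<open>functional_form_radical\<close>): the Bezoutian is an element of \<open>Q(f) \<otimes>
  Q(f)\<close> on which the two actions of \<open>Q(f)\<close> agree. Contracting it with \<open>l\<close> gives an element of
  \<open>Q(f)\<close> whose constant term is \<open>l E = 1\<close>, a unit \<open>u\<close>, and if \<open>l (p q) = 0\<close> for all \<open>q\<close>,
  then contracting \<open>p\<close> times the Bezoutian gives both \<open>0\<close> and \<open>p u\<close>. Secondly, such an \<open>l\<close>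
  exists, that is, \<open>E \<notin> I\<close> (\<open>dual_functional_exists\<close>): write \<open>x\<^sub>j ^ N = (W
  f)\<^sub>j\<close>. Then \<open>W A\<close> and the diagonal matrix with entries \<open>x\<^sub>j ^ (N - 1)\<close> both
  express the powers \<open>x\<^sub>j ^ N\<close> through \<open>x\<close>, so \<open>det W * E\<close> is congruent to the product
  of the \<open>x\<^sub>j ^ (N - 1)\<close> modulo the \<open>x\<^sub>j ^ N\<close>, and the coefficient of that monomial
  in \<open>det W * p\<close> is a functional of \<open>p\<close> which kills \<open>I\<close> and has value \<open>1\<close> at \<open>E\<close>.

  Everything rests on the independence of \<open>det A\<close> from \<open>A\<close> modulo \<open>I\<close> (\<open>det_independent\<close>),
  which follows from the exactness of the Koszul complex of the variables in degree one.\<close>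

section \<open>Ideals and determinants over a commutative ring\<close>

lemmas vec_ext = Finite_Cartesian_Product.vec_eq_iff

definition ideal_of :: "('i::finite \<Rightarrow> 'r::comm_ring_1) \<Rightarrow> 'r set" where
  "ideal_of f = range (\<lambda>c. \<Sum>i\<in>UNIV. c i * f i)"

lemma ideal_ofI: "p = (\<Sum>i\<in>UNIV. c i * f i) \<Longrightarrow> p \<in> ideal_of f"
  by (auto simp: ideal_of_def)

lemma ideal_ofE:
  assumes "p \<in> ideal_of f"
  obtains c where "p = (\<Sum>i\<in>UNIV. c i * f i)"
  using assms by (auto simp: ideal_of_def)

lemma ideal_of_zero [simp]: "0 \<in> ideal_of f"
  by (rule ideal_ofI[of _ "\<lambda>_. 0"]) simp

lemma ideal_of_add: "p \<in> ideal_of f \<Longrightarrow> q \<in> ideal_of f \<Longrightarrow> p + q \<in> ideal_of f"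
proof (elim ideal_ofE)
  fix c d assume "p = (\<Sum>i\<in>UNIV. c i * f i)" "q = (\<Sum>i\<in>UNIV. d i * f i)"
  thus ?thesis by (intro ideal_ofI[of _ "\<lambda>i. c i + d i"]) (simp add: algebra_simps sum.distrib)
qed

lemma ideal_of_mult: "p \<in> ideal_of f \<Longrightarrow> r * p \<in> ideal_of f"
proof (elim ideal_ofE)
  fix c assume "p = (\<Sum>i\<in>UNIV. c i * f i)"
  thus ?thesis by (intro ideal_ofI[of _ "\<lambda>i. r * c i"]) (simp add: algebra_simps sum_distrib_left)
qed

lemma ideal_of_mult': "p \<in> ideal_of f \<Longrightarrow> p * r \<in> ideal_of f"
  using ideal_of_mult[of p f r] by (simp add: mult.commute)

lemma ideal_of_uminus: "p \<in> ideal_of f \<Longrightarrow> - p \<in> ideal_of f"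
  using ideal_of_mult[of p f "- 1"] by simp

lemma ideal_of_diff: "p \<in> ideal_of f \<Longrightarrow> q \<in> ideal_of f \<Longrightarrow> p - q \<in> ideal_of f"
  using ideal_of_add[of p f "- q"] ideal_of_uminus[of q f] by simp

lemma ideal_of_sum: "(\<And>i. i \<in> A \<Longrightarrow> p i \<in> ideal_of f) \<Longrightarrow> sum p A \<in> ideal_of f"
  by (induction A rule: infinite_finite_induct) (auto intro: ideal_of_add)

lemma ideal_of_gen: "f i \<in> ideal_of f"
  by (rule ideal_ofI[of _ "\<lambda>j. if j = i then 1 else 0"])
    (simp add: if_distrib[of "\<lambda>x. x * _"] cong: if_cong)

lemma ideal_of_subset: "(\<And>i. f i \<in> ideal_of g) \<Longrightarrow> p \<in> ideal_of f \<Longrightarrow> p \<in> ideal_of g"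
  by (elim ideal_ofE) (auto intro!: ideal_of_sum ideal_of_mult)

lemma ideal_of_cong_mult:
  assumes "a - b \<in> ideal_of f" "c - d \<in> ideal_of f"
  shows "a * c - b * d \<in> ideal_of f"
proof -
  have "a * c - b * d = (a - b) * c + b * (c - d)" by (simp add: algebra_simps)
  thus ?thesis using assms by (auto intro: ideal_of_add ideal_of_mult ideal_of_mult')
qed

lemma ideal_of_trans:
  assumes "a - b \<in> ideal_of f" "b - c \<in> ideal_of f"
  shows "a - c \<in> ideal_of f"
  using ideal_of_add[OF assms] by simp

abbreviation apply_mat :: "'r::comm_ring_1 ^ 'n ^ 'm \<Rightarrow> ('n \<Rightarrow> 'r) \<Rightarrow> 'm \<Rightarrow> 'r" where
  "apply_mat A x i \<equiv> (\<Sum>j\<in>UNIV. vec_nth (vec_nth A i) j * x j)"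

abbreviation det_row :: "'r::comm_ring_1 ^ 'n ^ 'n \<Rightarrow> 'n \<Rightarrow> 'r ^ 'n \<Rightarrow> 'r" where
  "det_row A i v \<equiv> det (\<chi> k. if k = i then v else vec_nth A k)"

lemma det_row_linear:
  "det_row A i (\<Sum>j\<in>S. c j *s v j) = (\<Sum>j\<in>S. c j * det_row A i (v j))" if "finite S"
  using Determinants.det_linear_row_sum[OF that, of i "\<lambda>_ j. c j *s v j" "vec_nth A"]
    Determinants.det_row_mul[of i _ "\<lambda>_. _" "vec_nth A"] by simp

lemma det_row_minus: "det_row A i (v - w) = det_row A i v - det_row A i w"
proof -
  have "v - w + w = v" by (simp add: vec_ext)
  thus ?thesis
    using Determinants.det_row_add[of i "\<lambda>_. v - w" "\<lambda>_. w" "vec_nth A"]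
    by (simp add: eq_diff_eq cong: if_cong)
qed

lemma det_row_scale: "det_row A i (c *s v) = c * det_row A i v"
  using Determinants.det_row_mul[of i c "\<lambda>_. v" "vec_nth A"] by simp

lemma det_row_expand: "det_row A i v = (\<Sum>j\<in>UNIV. vec_nth v j * det_row A i (axis j 1))"
proof -
  have "v = (\<Sum>j\<in>UNIV. vec_nth v j *s axis j 1)"
    by (simp add: vec_ext axis_def if_distrib[of "\<lambda>x. _ * x"] if_distribR cong: if_cong)
  thus ?thesis using det_row_linear[where S = UNIV and A = A and i = i and c = "vec_nth v" and v = "\<lambda>j. axis j 1"] by (metis finite)
qed

lemma det_row_same: "det_row A i (vec_nth A i) = det A"
  by (rule arg_cong[of _ _ det]) (auto simp: vec_ext)

lemma det_row_other:
  assumes "k \<noteq> i"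
  shows "det_row A i (vec_nth A k) = 0"
  by (rule Determinants.det_identical_rows[of i k]) (use assms in \<open>auto simp: Finite_Cartesian_Product.row_def vec_ext\<close>)

text \<open>Cramer's rule without division: all summands but the \<open>i\<close>-th put a second copy of a row of \<open>A\<close> in
  row \<open>i\<close>.\<close>

lemma cramer_rows:
  "det_row A i (\<Sum>k\<in>UNIV. c k *s vec_nth A k) = c i * det A"
proof -
  have "det_row A i (\<Sum>k\<in>UNIV. c k *s vec_nth A k) = (\<Sum>k\<in>UNIV. c k * det_row A i (vec_nth A k))"
    by (rule det_row_linear) simp
  also have "\<dots> = (\<Sum>k\<in>UNIV. if k = i then c i * det A else 0)"
    by (rule sum.cong) (auto simp: det_row_same det_row_other)
  finally show ?thesis by simp
qed

definition det_col :: "'r::comm_ring_1 ^ 'n ^ 'n \<Rightarrow> 'n \<Rightarrow> ('n \<Rightarrow> 'r) \<Rightarrow> 'r" where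
  "det_col A j v = det (\<chi> i k. if k = j then v i else vec_nth (vec_nth A i) k)"

lemma det_col_eq: "det_col A j v = det_row (Finite_Cartesian_Product.transpose A) j (vec_lambda v)"
proof -
  have "(\<chi> i k. if k = j then v i else vec_nth (vec_nth A i) k) = 
    Finite_Cartesian_Product.transpose (\<chi> k. if k = j then vec_lambda v else vec_nth (Finite_Cartesian_Product.transpose A) k)"
    by (simp add: vec_ext Finite_Cartesian_Product.transpose_def)
  thus ?thesis unfolding det_col_def by simp
qed

lemma cramer_cols: "det_col A j (apply_mat A x) = x j * det A"
proof -
  have "vec_lambda (apply_mat A x) =
      (\<Sum>k\<in>UNIV. x k *s vec_nth (Finite_Cartesian_Product.transpose A) k)"
    by (simp add: vec_ext Finite_Cartesian_Product.transpose_def mult.commute)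
  thus ?thesis unfolding det_col_eq by (simp only: cramer_rows Determinants.det_transpose)
qed

lemma det_col_in_ideal: "det_col A j v \<in> ideal_of v"
  unfolding det_col_eq
  by (subst det_row_expand) (auto intro!: ideal_of_sum ideal_of_mult' ideal_of_gen)

text \<open>The adjugate matrix expresses \<open>det A * x\<^sub>j\<close> through the entries of \<open>A x\<close>. For \<open>A x = f\<close>
  this says that \<open>det A\<close> is annihilated by the variables modulo \<open>f\<close>; for \<open>W f = (x\<^sub>j ^
  N)\<close> it says that multiplication by \<open>det W\<close> maps the ideal of \<open>f\<close> into that of the powers.\<close>

lemma det_mult_in_ideal: "det A * x j \<in> ideal_of (apply_mat A x)"
  using det_col_in_ideal[of A j "apply_mat A x"] by (simp only: cramer_cols mult.commute[of "x j"])

lemma det_mult_ideal: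
  assumes "q \<in> ideal_of x"
  shows "det A * q \<in> ideal_of (apply_mat A x)"
proof -
  obtain c where q: "q = (\<Sum>j\<in>UNIV. c j * x j)" using assms by (rule ideal_ofE)
  have "det A * q = (\<Sum>j\<in>UNIV. c j * (det A * x j))"
    by (simp add: q sum_distrib_left algebra_simps)
  thus ?thesis by (auto intro!: ideal_of_sum ideal_of_mult det_mult_in_ideal)
qed

text \<open>All relations between the \<open>x\<^sub>j\<close> are combinations of the obvious ones \<open>x\<^sub>k x\<^sub>j -
  x\<^sub>j x\<^sub>k = 0\<close>: this is exactness of the Koszul complex at the first syzygies.
  Antisymmetry makes the diagonal of \<open>t\<close> \<open>2\<close>-torsion, and hence zero where \<open>2\<close> is invertible.\<close>

definition koszul_exact :: "('n::finite \<Rightarrow> 'r::comm_ring_1) \<Rightarrow> bool" where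
  "koszul_exact x \<longleftrightarrow> (\<forall>b. (\<Sum>j\<in>UNIV. b j * x j) = 0 \<longrightarrow>
     (\<exists>t. (\<forall>j k. t j k = - t k j) \<and> (\<forall>j. b j = (\<Sum>k\<in>UNIV. t j k * x k))))"

text \<open>The Koszul relation in row \<open>i\<close> makes the \<open>i\<close>-th entry of the product with \<open>x\<close> vanish. Cramer's
  rule for column \<open>j\<close> therefore computes \<open>x\<^sub>j\<close> times the determinant as one with column
  \<open>j\<close> in the ideal, and there row \<open>i\<close> has the single entry \<open>- x\<^sub>j\<close>, in column \<open>k\<close>.
  Cancelling \<open>x\<^sub>j\<close> leaves a determinant that still has a column with entries in the ideal.\<close>

lemma det_koszul_row:
  fixes A :: "'r::comm_ring_1 ^ 'n ^ 'n"
  assumes cancel: "\<And>a b. x j * a = x j * b \<Longrightarrow> a = b"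
  shows "det_row A i (x k *s axis j 1 - x j *s axis k 1) \<in> ideal_of (apply_mat A x)"
proof (cases "j = k")
  case True
  have "x k *s axis j 1 - x j *s axis k 1 = (0::'r) *s 0" using True by simp
  thus ?thesis by (simp only: det_row_scale) simp
next
  case False
  define M where "M = (\<chi> l. if l = i then x k *s axis j 1 - x j *s axis k 1 else vec_nth A l)"
  \<comment> \<open>The product of \<open>M\<close> with \<open>x\<close>; \<open>N\<close> is \<open>M\<close> with column \<open>j\<close> replaced by it and row \<open>i\<close> by a
    unit vector.\<close>
  define g where "g l = (if l = i then 0 else apply_mat A x l)" for l
  define N where "N = (\<chi> l m. if m = j then g l else if l = i then vec_nth (axis k 1) m else vec_nth (vec_nth A l) m)"
  have "apply_mat M x l = g l" for l
  proof (cases "l = i")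
    case True
    have "(\<Sum>m\<in>UNIV. vec_nth (x k *s axis j 1 - x j *s axis k 1) m * x m) =
      (\<Sum>m\<in>UNIV. (if m = j then x k * x j else 0) - (if m = k then x j * x k else 0))"
      by (rule sum.cong) (auto simp: axis_def)
    also have "\<dots> = 0" by (simp add: sum_subtractf mult.commute)
    finally show ?thesis using True by (simp add: M_def g_def)
  qed (simp add: M_def g_def)
  hence "x j * det M = det_col M j g" using cramer_cols[of M j x] by presburger
  also have "det_col M j g = det_row N i ((- x j) *s axis k 1)"
    unfolding det_col_def using False
    by (intro arg_cong[of _ _ det]) (auto simp: vec_ext M_def N_def g_def axis_def)
  also have "\<dots> = - x j * det_row N i (axis k 1)" by (rule det_row_scale)
  also have "det_row N i (axis k 1) = det_col N j g"
    unfolding det_col_def using False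
    by (intro arg_cong[of _ _ det]) (auto simp: vec_ext N_def g_def axis_def)
  finally have "x j * det M = x j * (- det_col N j g)" by simp
  hence "det M = - det_col N j g" by (rule cancel)
  moreover have "det_col N j g \<in> ideal_of (apply_mat A x)"
    by (rule ideal_of_subset[OF _ det_col_in_ideal]) (auto simp: g_def intro: ideal_of_gen)
  ultimately show ?thesis unfolding M_def by (auto intro: ideal_of_uminus)
qed

text \<open>Expanding along row \<open>i\<close> and pairing the terms of \<open>(j, k)\<close> and \<open>(k, j)\<close> reduces an arbitrary
  relation to Koszul relations, up to a factor \<open>2\<close>.\<close>

lemma det_row_relation:
  fixes A :: "'r::comm_ring_1 ^ 'n ^ 'n"
  assumes cancel: "\<And>j a b. x j * a = x j * b \<Longrightarrow> a = b"
    and half: "h + h = (1::'r)" and ex: "koszul_exact x"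
    and rel: "(\<Sum>j\<in>UNIV. vec_nth b j * x j) = 0"
  shows "det_row A i b \<in> ideal_of (apply_mat A x)"
proof -
  obtain t where t: "\<And>j k. t j k = - t k j" and b: "\<And>j. vec_nth b j = (\<Sum>k\<in>UNIV. t j k * x k)"
    using ex rel unfolding koszul_exact_def by metis
  let ?C = "\<lambda>j. det_row A i (axis j 1)"
  have D: "det_row A i b = (\<Sum>j\<in>UNIV. \<Sum>k\<in>UNIV. t j k * x k * ?C j)"
    by (subst det_row_expand) (simp add: b sum_distrib_right)
  have D': "det_row A i b = (\<Sum>j\<in>UNIV. \<Sum>k\<in>UNIV. - (t j k * x j * ?C k))"
    unfolding D by (subst sum.swap, intro sum.cong refl, subst t) simp
  \<comment> \<open>The two expansions are those of the index pairs \<open>(j, k)\<close> and \<open>(k, j)\<close>.\<close>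
  have "det_row A i b + det_row A i b = (\<Sum>j\<in>UNIV. \<Sum>k\<in>UNIV. t j k * (x k * ?C j - x j * ?C k))"
    by (subst D, subst D') (simp add: sum.distrib[symmetric] algebra_simps sum_subtractf)
  also have "\<dots> = (\<Sum>j\<in>UNIV. \<Sum>k\<in>UNIV. t j k * det_row A i (x k *s axis j 1 - x j *s axis k 1))"
    by (simp add: det_row_minus det_row_scale)
  also have "\<dots> \<in> ideal_of (apply_mat A x)"
    by (intro ideal_of_sum ideal_of_mult det_koszul_row) (rule cancel)
  finally have "h * (det_row A i b + det_row A i b) \<in> ideal_of (apply_mat A x)"
    by (rule ideal_of_mult)
  moreover have "h * (det_row A i b + det_row A i b) = (h + h) * det_row A i b"
    by (simp add: algebra_simps)
  ultimately show ?thesis using half by simp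
qed

text \<open>Replace the rows of \<open>A\<close> by those of \<open>A'\<close> one at a time: each replacement changes the determinant
  by one whose new row is a relation between the \<open>x\<^sub>j\<close>.\<close>

lemma det_independent:
  fixes A A' :: "'r::comm_ring_1 ^ 'n ^ 'n"
  assumes cancel: "\<And>j a b. x j * a = x j * b \<Longrightarrow> a = b"
    and half: "h + h = (1::'r)" and ex: "koszul_exact x"
    and A: "\<And>i. apply_mat A x i = f i" and A': "\<And>i. apply_mat A' x i = f i"
  shows "det A' - det A \<in> ideal_of f"
proof -
  define M where "M I = (\<chi> i. if i \<in> I then vec_nth A' i else vec_nth A i)" for I
  have "det (M I) - det A \<in> ideal_of f" for I
  proof (induction I rule: infinite_finite_induct)
    case (insert i I)
    have Mf: "apply_mat (M I) x = f" by (rule ext) (auto simp: M_def A A')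
    have "M (insert i I) = (\<chi> k. if k = i then vec_nth A' i else vec_nth (M I) k)"
      by (auto simp: M_def vec_ext)
    moreover have Mi: "vec_nth (M I) i = vec_nth A i" using insert(2) by (simp add: M_def)
    ultimately have "det (M (insert i I)) - det (M I) = det_row (M I) i (vec_nth A' i) - det_row (M I) i (vec_nth (M I) i)"
      using det_row_same[where A = "M I" and i = i] by metis
    also have "\<dots> = det_row (M I) i (vec_nth A' i - vec_nth A i)"
      by (simp only: det_row_minus Mi)
    also have "\<dots> \<in> ideal_of (apply_mat (M I) x)"
      by (rule det_row_relation[OF cancel half ex]) (auto simp: left_diff_distrib sum_subtractf A A')
    finally have "det (M (insert i I)) - det (M I) \<in> ideal_of f" unfolding Mf .
    from ideal_of_trans[OF this insert.IH] show ?case .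
  qed (auto simp: M_def)
  moreover have "M UNIV = A'" by (simp add: M_def vec_ext)
  ultimately show ?thesis by metis
qed

lemma det_hom:
  fixes B :: "'r::comm_ring_1 ^ 'n::finite ^ 'n"
  assumes "comm_ring_hom h"
  shows "det (\<chi> i j. h (vec_nth (vec_nth B i) j)) = h (det B)"
proof -
  interpret comm_ring_hom h by (rule assms)
  have s: "h (of_int (sign p)) = of_int (sign p)" for p :: "'n \<Rightarrow> 'n"
    by (simp add: sign_def hom_uminus)
  show ?thesis unfolding Determinants.det_def
    by (simp add: hom_sum hom_mult hom_prod s)
qed

section \<open>Polynomials\<close>

lemma sum_monomials: "p = (\<Sum>m\<in>Poly_Mapping.keys p. Poly_Mapping.single m (Poly_Mapping.lookup p m))"
proof (rule poly_mapping_eqI)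
  fix k
  show "Poly_Mapping.lookup p k =
    Poly_Mapping.lookup (\<Sum>m\<in>Poly_Mapping.keys p. Poly_Mapping.single m (Poly_Mapping.lookup p m)) k"
    by (simp add: lookup_sum lookup_single when_def in_keys_iff)
qed

lemma monomial_induct [case_names single add]:
  fixes p :: "'a \<Rightarrow>\<^sub>0 'r::comm_ring_1"
  assumes "\<And>m c. P (Poly_Mapping.single m c)" "\<And>p q. P p \<Longrightarrow> P q \<Longrightarrow> P (p + q)"
  shows "P p"
proof -
  have "P (\<Sum>m\<in>M. Poly_Mapping.single m (Poly_Mapping.lookup p m))" for M
    by (induction M rule: infinite_finite_induct) (use assms assms(1)[of _ 0] in auto)
  thus ?thesis using sum_monomials[of p] by metis
qed

lemma lookup_single_mult_add:
  fixes p :: "'a::cancel_comm_monoid_add \<Rightarrow>\<^sub>0 'r::comm_ring_1"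
  shows "Poly_Mapping.lookup (Poly_Mapping.single k c * p) (k + m) = c * Poly_Mapping.lookup p m"
  by (induction p rule: monomial_induct)
    (auto simp: mult_single lookup_single when_def lookup_add distrib_left add.commute[of _ k])

lemma lookup_single_mult_other:
  fixes p :: "'a::cancel_comm_monoid_add \<Rightarrow>\<^sub>0 'r::comm_ring_1"
  assumes "\<And>q. m \<noteq> k + q"
  shows "Poly_Mapping.lookup (Poly_Mapping.single k c * p) m = 0"
  by (induction p rule: monomial_induct)
    (use assms in \<open>auto simp: mult_single lookup_single when_def lookup_add distrib_left\<close>)

lemma exponent_split:
  fixes m :: "'n \<Rightarrow>\<^sub>0 nat"
  assumes "N \<le> Poly_Mapping.lookup m j"
  shows "m = Poly_Mapping.single j N + (m - Poly_Mapping.single j N)"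
  by (rule poly_mapping_eqI) (use assms in \<open>auto simp: lookup_add lookup_minus lookup_single when_def\<close>)

lemma single_eq_prod:
  "(\<Prod>i\<in>I. Poly_Mapping.single (Poly_Mapping.single i 1) 1 ^ Poly_Mapping.lookup m i) =
   Poly_Mapping.single (\<Sum>i\<in>I. Poly_Mapping.single i (Poly_Mapping.lookup m i)) (1::'r::comm_ring_1)"
proof -
  have "Poly_Mapping.single (Poly_Mapping.single i 1) (1::'r) ^ e = Poly_Mapping.single (Poly_Mapping.single i e) 1"
    for i :: 'a and e
    by (induction e) (simp_all add: mult_single single_add[symmetric])
  thus ?thesis
    by (induction I rule: infinite_finite_induct) (simp_all add: mult_single)
qed

lemma sum_single_lookup: "(\<Sum>i\<in>UNIV. Poly_Mapping.single i (Poly_Mapping.lookup m i)) = m" for m :: "'n::finite \<Rightarrow>\<^sub>0 nat"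
  by (rule poly_mapping_eqI) (simp add: lookup_sum lookup_single when_def)

lemma polynomial_induct [case_names const var add mult]:
  fixes p :: "('n::finite \<Rightarrow>\<^sub>0 nat) \<Rightarrow>\<^sub>0 'r::comm_ring_1"
  assumes c: "\<And>c. P (Poly_Mapping.single 0 c)" and v: "\<And>i. P (Poly_Mapping.single (Poly_Mapping.single i 1) 1)"
    and add: "\<And>p q. P p \<Longrightarrow> P q \<Longrightarrow> P (p + q)" and mult: "\<And>p q. P p \<Longrightarrow> P q \<Longrightarrow> P (p * q)"
  shows "P p"
proof (induction p rule: monomial_induct)
  case (single m a)
  have one: "P 1" using c[of 1] by simp
  have pow: "P (q ^ e)" if "P q" for q e using that by (induction e) (auto intro: one mult)
  have "P (\<Prod>i\<in>I. Poly_Mapping.single (Poly_Mapping.single i 1) 1 ^ Poly_Mapping.lookup m i)" for I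
    by (induction I rule: infinite_finite_induct) (auto intro: one mult pow v simp del: One_nat_def)
  from mult[OF c[of a] this[of UNIV]] show ?case
    unfolding single_eq_prod sum_single_lookup by (simp add: mult_single)
qed (rule add)

text \<open>Evaluation at a point of an arbitrary commutative ring. Besides substitution, it provides the
  embedding of \<open>K[y]\<close> into \<open>K[x][y]\<close> and the specialisation \<open>y = 0\<close>.\<close>

definition peval :: "('k::comm_ring_1 \<Rightarrow> 'r::comm_ring_1) \<Rightarrow> ('n::finite \<Rightarrow> 'r) \<Rightarrow>
    (('n \<Rightarrow>\<^sub>0 nat) \<Rightarrow>\<^sub>0 'k) \<Rightarrow> 'r" where
  "peval h v p = (\<Sum>m\<in>Poly_Mapping.keys p. h (Poly_Mapping.lookup p m) * (\<Prod>i\<in>UNIV. v i ^ Poly_Mapping.lookup m i))"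

context
  fixes h :: "'k::comm_ring_1 \<Rightarrow> 'r::comm_ring_1"
  assumes h: "comm_ring_hom h"
begin

interpretation comm_ring_hom h by (rule h)

lemma peval_single: "peval h v (Poly_Mapping.single m c) = h c * (\<Prod>i\<in>UNIV. v i ^ Poly_Mapping.lookup m i)"
  by (simp add: peval_def)

lemma peval_add: "peval h v (p + q) = peval h v p + peval h v q"
  unfolding peval_def by (rule setsum_keys_plus_distrib) (simp_all add: hom_add algebra_simps)

lemma peval_mult: "peval h v (p * q) = peval h v p * peval h v q"
proof (induction p rule: monomial_induct)
  case (single m c)
  show ?case
    by (induction q rule: monomial_induct)
      (simp_all add: mult_single peval_single peval_add hom_mult lookup_add power_add
        prod.distrib algebra_simps)
qed (simp add: peval_add algebra_simps)

lemma peval_const: "peval h v (Poly_Mapping.single 0 c) = h c"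
  by (simp add: peval_single)

lemma peval_var: "peval h v (Poly_Mapping.single (Poly_Mapping.single i 1) 1) = v i"
proof -
  have "(\<Prod>j\<in>UNIV. v j ^ Poly_Mapping.lookup (Poly_Mapping.single i 1) j) = (\<Prod>j\<in>UNIV. if j = i then v i else 1)"
    by (rule prod.cong) (auto simp: lookup_single when_def)
  thus ?thesis by (simp add: peval_single)
qed

lemma peval_hom: "comm_ring_hom (peval h v)"
proof -
  have "peval h v 1 = 1" "peval h v 0 = 0"
    using peval_const[of v 1] peval_const[of v 0] by simp_all
  thus ?thesis by unfold_locales (simp_all add: peval_add peval_mult)
qed

end

lemma comm_ring_hom_poly_eqI:
  fixes g h :: "(('n::finite \<Rightarrow>\<^sub>0 nat) \<Rightarrow>\<^sub>0 'k::comm_ring_1) \<Rightarrow> 'r::comm_ring_1"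
  assumes g: "comm_ring_hom g" and h: "comm_ring_hom h"
    and "\<And>c. g (Poly_Mapping.single 0 c) = h (Poly_Mapping.single 0 c)"
    and "\<And>i. g (Poly_Mapping.single (Poly_Mapping.single i 1) 1) = h (Poly_Mapping.single (Poly_Mapping.single i 1) 1)"
  shows "g p = h p"
proof -
  interpret g: comm_ring_hom g by (rule g)
  interpret h: comm_ring_hom h by (rule h)
  show ?thesis
    by (induction p rule: polynomial_induct) (simp_all add: assms g.hom_add h.hom_add g.hom_mult h.hom_mult del: One_nat_def)
qed

lemma single_zero_hom: "comm_ring_hom (Poly_Mapping.single (0::'a::comm_monoid_add) :: 'r::comm_ring_1 \<Rightarrow> _)"
  by unfold_locales (simp_all add: single_add mult_single)

lemma Const_hom: "comm_ring_hom (Const :: 'k::field \<Rightarrow> ('n, 'k) mpoly)"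
  unfolding Const_def[abs_def] by (rule single_zero_hom)

interpretation Const: comm_ring_hom "Const :: 'k::field \<Rightarrow> ('n, 'k) mpoly"
  by (rule Const_hom)

lemma mpoly_subst_eq: "mpoly_subst q = peval Const q"
  by (rule ext) (simp add: mpoly_subst_def peval_def)

interpretation mpoly_subst: comm_ring_hom "mpoly_subst q"
  unfolding mpoly_subst_eq by (rule peval_hom) (rule Const_hom)

lemma mpoly_subst_Const [simp]: "mpoly_subst q (Const c) = Const c"
  unfolding mpoly_subst_eq Const_def[of c] by (subst peval_const[OF Const_hom]) (simp add: Const_def)

lemma mpoly_subst_Var [simp]: "mpoly_subst q (Var i) = q i"
  unfolding mpoly_subst_eq Var_def by (rule peval_var[OF Const_hom])

interpretation eval0: comm_ring_hom "eval0 :: ('n, 'k::field) mpoly \<Rightarrow> 'k"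
  by unfold_locales (simp_all add: eval0_mult eval0_one, simp_all add: eval0_def lookup_add)

lemma eval0_Const [simp]: "eval0 (Const c) = c"
  by (simp add: eval0_def Const_def)

lemma eval0_Var [simp]: "eval0 (Var i) = 0"
proof -
  have "Poly_Mapping.single i (1::nat) \<noteq> 0"
    by (metis lookup_single_eq lookup_zero zero_neq_one)
  thus ?thesis by (simp add: eval0_def Var_def lookup_single when_def)
qed

lemma Const_mult_lookup: "Poly_Mapping.lookup (Const c * p) m = c * Poly_Mapping.lookup p m"
  using lookup_single_mult_add[of 0 c p m] by (simp add: Const_def)

lemma Var_power: "Var i ^ e = Poly_Mapping.single (Poly_Mapping.single i e) 1"
  by (induction e) (simp_all add: Var_def mult_single single_add[symmetric])

lemma Var_mult_cancel:
  assumes "Var j * a = Var j * b"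
  shows "a = b"
proof (rule poly_mapping_eqI)
  fix m
  have "Poly_Mapping.lookup (Var j * a) (Poly_Mapping.single j 1 + m) =
    Poly_Mapping.lookup (Var j * b) (Poly_Mapping.single j 1 + m)" using assms by simp
  thus "Poly_Mapping.lookup a m = Poly_Mapping.lookup b m"
    by (simp add: Var_def lookup_single_mult_add)
qed

text \<open>The indices outside \<open>J\<close> carry the generator \<open>0\<close>, so that the same index type serves all ideals
  generated by a subset of the variables.\<close>

lemma in_ideal_of_Vars:
  fixes p :: "('n::finite, 'k::field) mpoly"
  assumes "\<And>m. m \<in> Poly_Mapping.keys p \<Longrightarrow> \<exists>j\<in>J. Poly_Mapping.lookup m j > 0"
  shows "p \<in> ideal_of (\<lambda>j. if j \<in> J then Var j else 0)"
proof -
  have "(\<Sum>m\<in>Poly_Mapping.keys p. Poly_Mapping.single m (Poly_Mapping.lookup p m))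
      \<in> ideal_of (\<lambda>j. if j \<in> J then Var j else 0)"
  proof (rule ideal_of_sum)
    fix m assume "m \<in> Poly_Mapping.keys p"
    then obtain j where j: "j \<in> J" "Poly_Mapping.lookup m j > 0" using assms by blast
    have "m - Poly_Mapping.single j 1 + Poly_Mapping.single j 1 = m"
      by (subst add.commute) (rule exponent_split[symmetric], use j(2) in simp)
    hence "Poly_Mapping.single m (Poly_Mapping.lookup p m) =
      Poly_Mapping.single (m - Poly_Mapping.single j 1) (Poly_Mapping.lookup p m) * (if j \<in> J then Var j else 0)"
      using j(1) by (simp add: Var_def mult_single)
    thus "Poly_Mapping.single m (Poly_Mapping.lookup p m) \<in> ideal_of (\<lambda>j. if j \<in> J then Var j else 0)"
      by (rule ssubst) (rule ideal_of_mult[OF ideal_of_gen[of "\<lambda>j. if j \<in> J then Var j else 0"]])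
  qed
  thus ?thesis using sum_monomials[of p] by simp
qed

lemma eval0_zero_in_ideal:
  assumes "eval0 p = 0"
  shows "p \<in> ideal_of Var"
proof -
  have "\<exists>j\<in>UNIV. Poly_Mapping.lookup m j > 0" if "m \<in> Poly_Mapping.keys p" for m
  proof (rule ccontr)
    assume "\<not> ?thesis"
    hence "m = 0" by (intro poly_mapping_eqI) auto
    thus False using that assms by (simp add: eval0_def in_keys_iff)
  qed
  from in_ideal_of_Vars[of p UNIV, OF this] show ?thesis by simp
qed

text \<open>By induction on the set of variables. In a relation between \<open>x\<^sub>i\<close> and the \<open>x\<^sub>j\<close> with
  \<open>j \<in> J\<close>, the coefficient \<open>b\<^sub>i\<close> lies in the ideal of the \<open>x\<^sub>j\<close>, because no
  monomial of \<open>b\<^sub>i x\<^sub>i\<close> that avoids them can cancel. Subtracting the corresponding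
  Koszul relations removes \<open>x\<^sub>i\<close>.\<close>

lemma koszul_exact_Var_aux:
  fixes b :: "'n::finite \<Rightarrow> ('n, 'k::field) mpoly"
  assumes "(\<Sum>j\<in>J. b j * Var j) = 0"
  shows "\<exists>t. (\<forall>j k. t j k = - t k j) \<and> (\<forall>j\<in>J. b j = (\<Sum>k\<in>J. t j k * Var k))"
  using finite[of J] assms
proof (induction J arbitrary: b rule: finite_induct)
  case empty
  show ?case by (rule exI[of _ "\<lambda>_ _. 0"]) simp
next
  case (insert i J)
  have "b i \<in> ideal_of (\<lambda>j. if j \<in> J then Var j else 0)"
  proof (rule in_ideal_of_Vars, rule ccontr)
    fix m assume m: "m \<in> Poly_Mapping.keys (b i)" "\<not> (\<exists>j\<in>J. Poly_Mapping.lookup m j > 0)"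
    \<comment> \<open>The monomial \<open>x\<^sub>i m\<close> of \<open>b\<^sub>i x\<^sub>i\<close> involves no \<open>x\<^sub>j\<close> with \<open>j \<in>
      J\<close>, so no other summand contains it.\<close>
    let ?m = "Poly_Mapping.single i 1 + m"
    have "Poly_Mapping.lookup (b j * Var j) ?m = 0" if j: "j \<in> J" for j
    proof -
      have "?m \<noteq> Poly_Mapping.single j 1 + q" for q
      proof
        assume "?m = Poly_Mapping.single j 1 + q"
        hence "Poly_Mapping.lookup ?m j = Poly_Mapping.lookup (Poly_Mapping.single j 1 + q) j" by simp
        thus False using insert(2) j m(2) by (auto simp: lookup_add lookup_single when_def split: if_splits)
      qed
      thus ?thesis unfolding mult.commute[of "b j"] Var_def by (rule lookup_single_mult_other)
    qed
    hence "Poly_Mapping.lookup (\<Sum>j\<in>insert i J. b j * Var j) ?m = Poly_Mapping.lookup (b i * Var i) ?m"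
      using insert(1,2) by (simp add: lookup_sum lookup_add)
    also have "\<dots> = Poly_Mapping.lookup (b i) m"
      unfolding mult.commute[of "b i"] Var_def by (simp add: lookup_single_mult_add)
    finally show False using insert.prems m(1) by (simp add: in_keys_iff)
  qed
  then obtain c where "b i = (\<Sum>j\<in>UNIV. c j * (if j \<in> J then Var j else 0))" by (rule ideal_ofE)
  also have "\<dots> = (\<Sum>j\<in>J. c j * Var j)"
    by (rule sum.mono_neutral_cong_right) auto
  finally have bi: "b i = (\<Sum>j\<in>J. c j * Var j)" .
  have "(\<Sum>j\<in>J. (b j + c j * Var i) * Var j) = (\<Sum>j\<in>insert i J. b j * Var j)"
    using insert(1,2) by (simp add: bi algebra_simps sum.distrib sum_distrib_left)
  with insert.prems have "(\<Sum>j\<in>J. (b j + c j * Var i) * Var j) = 0" by simp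
  from insert.IH[OF this] obtain t where t: "\<And>j k. t j k = - t k j"
    "\<And>j. j \<in> J \<Longrightarrow> b j + c j * Var i = (\<Sum>k\<in>J. t j k * Var k)" by blast
  define t' where "t' j k = (if j = i \<and> k \<in> J then c k else if k = i \<and> j \<in> J then - c j
     else if j \<in> J \<and> k \<in> J then t j k else 0)" for j k
  have "b j = (\<Sum>k\<in>insert i J. t' j k * Var k)" if "j \<in> insert i J" for j
  proof (cases "j = i")
    case True
    thus ?thesis using insert(1,2) by (simp add: bi t'_def cong: sum.cong)
  next
    case False
    with that have j: "j \<in> J" by simp
    have "(\<Sum>k\<in>J. t' j k * Var k) = (\<Sum>k\<in>J. t j k * Var k)"
      using insert(2) j False by (intro sum.cong) (auto simp: t'_def)
    moreover have "t' j i = - c j" using insert(2) j False by (simp add: t'_def)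
    ultimately show ?thesis using insert(1,2) t(2)[OF j] by (simp add: algebra_simps)
  qed
  moreover have "t' j k = - t' k j" for j k using insert(2) t(1)[of j k] by (simp add: t'_def)
  ultimately show ?case by blast
qed

lemma koszul_exact_Var: "koszul_exact (Var :: 'n::finite \<Rightarrow> ('n, 'k::field) mpoly)"
  unfolding koszul_exact_def by (intro allI impI) (drule koszul_exact_Var_aux, simp)

lemma two_neq_zero:
  assumes "CHAR('k::field) \<noteq> 2"
  shows "(2::'k) \<noteq> 0"
proof
  assume "(2::'k) = 0"
  hence "of_nat 2 = (0::'k)" by simp
  hence dvd: "CHAR('k) dvd 2" by (simp only: of_nat_eq_0_iff_char_dvd)
  hence "CHAR('k) \<le> 2" by (rule dvd_imp_le) simp
  moreover have "CHAR('k) \<noteq> 0" using dvd by (metis dvd_0_left_iff zero_neq_numeral)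
  moreover have "CHAR('k) \<noteq> 1" using of_nat_CHAR[where 'a = 'k] by (intro notI) simp
  ultimately show False using assms by linarith
qed

lemma det_independent_Var:
  fixes A A' :: "('n::finite, 'k::field) mpoly ^ 'n ^ 'n"
  assumes "CHAR('k) \<noteq> 2"
    and "\<And>i. apply_mat A Var i = f i" and "\<And>i. apply_mat A' Var i = f i"
  shows "det A' - det A \<in> ideal_of f"
proof -
  have "(2::'k) \<noteq> 0" by (rule two_neq_zero[OF assms(1)])
  hence "Const (1/2) + Const (1/2) = (1 :: ('n, 'k) mpoly)"
    by (simp flip: Const.hom_add)
  from det_independent[OF Var_mult_cancel this koszul_exact_Var assms(2,3)] show ?thesis .
qed

section \<open>Ideals supported at the origin\<close>

text \<open>Localising \<open>K[x] / (f)\<close> at the origin then changes nothing.\<close>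

definition nil_mod :: "('n::finite \<Rightarrow> ('n, 'k::field) mpoly) \<Rightarrow> bool" where
  "nil_mod f \<longleftrightarrow> (\<forall>p. eval0 p = 0 \<longrightarrow> (\<exists>M. p ^ M \<in> ideal_of f))"

lemma power_in_ideal_mono:
  assumes "p ^ M \<in> ideal_of f" "M \<le> M'"
  shows "p ^ M' \<in> ideal_of f"
proof -
  have "p ^ M' = p ^ (M' - M) * p ^ M" using assms(2) by (simp flip: power_add)
  thus ?thesis using ideal_of_mult[OF assms(1)] by simp
qed

lemma nilpotent_add:
  assumes "p ^ M \<in> ideal_of f" "q ^ N \<in> ideal_of f"
  shows "(p + q) ^ (M + N) \<in> ideal_of f"
proof -
  have "of_nat (M + N choose k) * p ^ k * q ^ (M + N - k) \<in> ideal_of f" for k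
  proof (cases "M \<le> k")
    case True
    from power_in_ideal_mono[OF assms(1) this] show ?thesis
      by (intro ideal_of_mult' ideal_of_mult)
  next
    case False
    hence "N \<le> M + N - k" by simp
    from power_in_ideal_mono[OF assms(2) this] show ?thesis by (rule ideal_of_mult)
  qed
  thus ?thesis unfolding binomial_ring by (intro ideal_of_sum)
qed

lemma nil_modI:
  assumes "\<And>j. Var j ^ N \<in> ideal_of f"
  shows "nil_mod f"
  unfolding nil_mod_def
proof (intro allI impI)
  fix p :: "('a, 'b) mpoly" assume "eval0 p = 0"
  then obtain c where p: "p = (\<Sum>j\<in>UNIV. c j * Var j)"
    using eval0_zero_in_ideal by (blast elim: ideal_ofE)
  have "\<exists>M. (\<Sum>j\<in>J. c j * Var j) ^ M \<in> ideal_of f" for J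
  proof (induction J rule: infinite_finite_induct)
    case (insert j J)
    then obtain M where M: "(\<Sum>j\<in>J. c j * Var j) ^ M \<in> ideal_of f" by blast
    have "(c j * Var j) ^ N \<in> ideal_of f"
      unfolding power_mult_distrib by (intro ideal_of_mult assms)
    from nilpotent_add[OF this M] show ?case using insert(1,2) by auto
  qed (auto intro: exI[of _ 1])
  thus "\<exists>M. p ^ M \<in> ideal_of f" unfolding p .
qed

lemma unit_mod:
  assumes "nil_mod f" "eval0 u \<noteq> 0"
  obtains w where "u * w - 1 \<in> ideal_of f"
proof -
  define v where "v = Const (1 / eval0 u) * u"
  have "eval0 (1 - v) = 0" using assms(2) by (simp add: v_def eval0.hom_minus eval0.hom_mult)
  then obtain M where M: "(1 - v) ^ M \<in> ideal_of f" using assms(1) unfolding nil_mod_def by blast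
  \<comment> \<open>The geometric series inverts \<open>v\<close>, because \<open>1 - v\<close> is nilpotent modulo the ideal.\<close>
  define s where "s = (\<Sum>i<M. (1 - v) ^ i)"
  have "1 - (1 - v) ^ M = v * s" unfolding s_def using one_diff_power_eq[of "1 - v" M] by simp
  hence "u * (Const (1 / eval0 u) * s) - 1 = - ((1 - v) ^ M)"
    by (simp add: v_def algebra_simps)
  thus ?thesis using that ideal_of_uminus[OF M] by metis
qed

section \<open>The Bezoutian\<close>

text \<open>Polynomials in two sets of variables as polynomials in \<open>y\<close> with coefficients in \<open>K[x]\<close>. This
  makes contraction with a functional on \<open>K[x]\<close> a map on coefficients.\<close>

type_synonym ('n, 'k) mpoly2 = "('n \<Rightarrow>\<^sub>0 nat) \<Rightarrow>\<^sub>0 ('n, 'k) mpoly"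

definition in_x :: "('n, 'k::field) mpoly \<Rightarrow> ('n, 'k) mpoly2" where
  "in_x p = Poly_Mapping.single 0 p"

definition in_y :: "('n::finite, 'k::field) mpoly \<Rightarrow> ('n, 'k) mpoly2" where
  "in_y = peval (\<lambda>c. Poly_Mapping.single 0 (Const c)) (\<lambda>j. Poly_Mapping.single (Poly_Mapping.single j 1) 1)"

definition y_zero :: "('n::finite, 'k::field) mpoly2 \<Rightarrow> ('n, 'k) mpoly" where
  "y_zero = peval (\<lambda>c. c) (\<lambda>_. 0)"

interpretation in_x: comm_ring_hom "in_x :: ('n, 'k::field) mpoly \<Rightarrow> _"
  unfolding in_x_def[abs_def] by (rule single_zero_hom)

lemma single_Const_hom: "comm_ring_hom (\<lambda>c. Poly_Mapping.single 0 (Const c))"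
  by unfold_locales (simp_all add: single_add mult_single Const.hom_add Const.hom_mult)

interpretation in_y: comm_ring_hom in_y
  unfolding in_y_def by (rule peval_hom) (rule single_Const_hom)

lemma id_hom: "comm_ring_hom (\<lambda>c::'r::comm_ring_1. c)"
  by unfold_locales simp_all

interpretation y_zero: comm_ring_hom y_zero
  unfolding y_zero_def by (rule peval_hom) (rule id_hom)

lemma in_y_Const: "in_y (Const c) = in_x (Const c)"
  unfolding in_y_def Const_def[of c] in_x_def
  by (subst peval_const[OF single_Const_hom]) (simp add: Const_def)

lemma in_y_Var: "in_y (Var j) = Poly_Mapping.single (Poly_Mapping.single j 1) 1"
  unfolding in_y_def Var_def by (rule peval_var[OF single_Const_hom])

lemma y_zero_lookup: "y_zero p = Poly_Mapping.lookup p 0"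
proof (induction p rule: monomial_induct)
  case (single m c)
  show ?case
  proof (cases "m = 0")
    case False
    then obtain i where "Poly_Mapping.lookup m i \<noteq> 0" by (metis lookup_zero poly_mapping_eqI)
    hence "(\<Prod>i\<in>UNIV. (0::('a, 'b) mpoly) ^ Poly_Mapping.lookup m i) = 0"
      by (intro prod_zero bexI[of _ i]) (simp_all add: zero_power)
    thus ?thesis using False unfolding y_zero_def peval_single[OF id_hom]
      by (simp add: lookup_single when_def)
  qed (simp add: y_zero_def peval_single[OF id_hom])
qed (simp add: y_zero.hom_add lookup_add)

lemma y_zero_in_x: "y_zero (in_x p) = p"
  by (simp add: y_zero_lookup in_x_def)

lemma y_zero_in_y:
  fixes p :: "('n::finite, 'k::field) mpoly"
  shows "y_zero (in_y p) = Const (eval0 p)"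
proof (rule comm_ring_hom_poly_eqI[of "\<lambda>p. y_zero (in_y p)" "\<lambda>p. Const (eval0 p)"])
  show "comm_ring_hom (\<lambda>p :: ('n, 'k) mpoly. y_zero (in_y p))"
    "comm_ring_hom (\<lambda>p :: ('n, 'k) mpoly. Const (eval0 p) :: ('n, 'k) mpoly)"
    by (unfold_locales, simp_all add: in_y.hom_add in_y.hom_mult y_zero.hom_add y_zero.hom_mult
        eval0.hom_add eval0.hom_mult Const.hom_add Const.hom_mult)
  show "y_zero (in_y (Poly_Mapping.single 0 c :: ('n, 'k) mpoly)) = Const (eval0 (Poly_Mapping.single 0 c :: ('n, 'k) mpoly))" for c
    by (simp add: in_y_Const y_zero_in_x flip: Const_def)
  show "y_zero (in_y (Poly_Mapping.single (Poly_Mapping.single i 1) 1)) =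
      Const (eval0 (Poly_Mapping.single (Poly_Mapping.single i 1) 1 :: ('n, 'k) mpoly))" for i
  proof -
    have "Poly_Mapping.single i 1 \<noteq> (0 :: 'n \<Rightarrow>\<^sub>0 nat)"
      by (metis lookup_single_eq lookup_zero zero_neq_one)
    hence "y_zero (in_y (Var i)) = Const (eval0 (Var i))"
      by (simp add: in_y_Var y_zero_lookup lookup_single)
    thus ?thesis by (simp add: Var_def)
  qed
qed

lemma in_x_minus_in_y: "in_x p - in_y p \<in> ideal_of (\<lambda>j. in_x (Var j) - in_y (Var j))"
proof (induction p rule: polynomial_induct)
  case (const c)
  show ?case by (simp add: in_y_Const flip: Const_def)
next
  case (var i)
  have "in_x (Var i) - in_y (Var i) \<in> ideal_of (\<lambda>j. in_x (Var j) - in_y (Var j))"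
    by (rule ideal_of_gen)
  thus ?case by (simp add: Var_def)
next
  case (add p q)
  from ideal_of_add[OF add.IH] show ?case by (simp add: in_x.hom_add in_y.hom_add algebra_simps)
next
  case (mult p q)
  from ideal_of_cong_mult[OF mult.IH] show ?case by (simp add: in_x.hom_mult in_y.hom_mult)
qed

definition functional :: "(('n, 'k::field) mpoly \<Rightarrow> 'k) \<Rightarrow> bool" where
  "functional l \<longleftrightarrow> (\<forall>p q. l (p + q) = l p + l q) \<and> (\<forall>c p. l (Const c * p) = c * l p)"

lemma functional_add: "functional l \<Longrightarrow> l (p + q) = l p + l q"
  by (simp add: functional_def)

lemma functional_scale: "functional l \<Longrightarrow> l (Const c * p) = c * l p"
  by (simp add: functional_def)

lemma functional_zero: "functional l \<Longrightarrow> l 0 = 0"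
  using functional_scale[of l 0 0] by simp

lemma functional_uminus: "functional l \<Longrightarrow> l (- p) = - l p"
  using functional_add[of l p "- p"] functional_zero[of l] by (simp add: add_eq_0_iff)

lemma functional_diff: "functional l \<Longrightarrow> l (p - q) = l p - l q"
  using functional_add[of l p "- q"] functional_uminus[of l q] by simp

lemma functional_sum: "functional l \<Longrightarrow> l (sum p A) = (\<Sum>i\<in>A. l (p i))"
  by (induction A rule: infinite_finite_induct) (simp_all add: functional_add functional_zero)

definition map_coeffs :: "(('n, 'k::field) mpoly \<Rightarrow> 'k) \<Rightarrow> ('n, 'k) mpoly2 \<Rightarrow> ('n, 'k) mpoly" where
  "map_coeffs l = Poly_Mapping.map l"

context
  fixes l :: "('n::finite, 'k::field) mpoly \<Rightarrow> 'k"
  assumes l: "functional l"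
begin

lemma lookup_map_coeffs: "Poly_Mapping.lookup (map_coeffs l D) m = l (Poly_Mapping.lookup D m)"
  unfolding map_coeffs_def by (simp add: Poly_Mapping.map.rep_eq when_def functional_zero[OF l])

lemma map_coeffs_add: "map_coeffs l (D + E) = map_coeffs l D + map_coeffs l E"
  by (rule poly_mapping_eqI) (simp add: lookup_map_coeffs lookup_add functional_add[OF l])

lemma map_coeffs_diff: "map_coeffs l (D - E) = map_coeffs l D - map_coeffs l E"
  by (rule poly_mapping_eqI) (simp add: lookup_map_coeffs lookup_minus functional_diff[OF l])

lemma map_coeffs_sum: "map_coeffs l (sum D A) = (\<Sum>i\<in>A. map_coeffs l (D i))"
  by (rule poly_mapping_eqI) (simp add: lookup_map_coeffs lookup_sum functional_sum[OF l])

lemma map_coeffs_in_x_zero: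
  assumes "\<And>q. l (p * q) = 0"
  shows "map_coeffs l (in_x p * D) = 0"
proof (rule poly_mapping_eqI)
  fix m
  show "Poly_Mapping.lookup (map_coeffs l (in_x p * D)) m = Poly_Mapping.lookup 0 m"
    using lookup_single_mult_add[of 0 p D m] assms by (simp add: lookup_map_coeffs in_x_def)
qed

lemma map_coeffs_in_y: "map_coeffs l (in_y q * D) = q * map_coeffs l D"
proof (induction q arbitrary: D rule: polynomial_induct)
  case (const c)
  have "map_coeffs l (in_y (Const c) * D) = Const c * map_coeffs l D"
  proof (rule poly_mapping_eqI)
    fix m
    show "Poly_Mapping.lookup (map_coeffs l (in_y (Const c) * D)) m = Poly_Mapping.lookup (Const c * map_coeffs l D) m"
      using lookup_single_mult_add[of 0 "Const c" D m]
      by (simp add: lookup_map_coeffs in_y_Const in_x_def Const_mult_lookup functional_scale[OF l])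
  qed
  thus ?case by (simp add: Const_def)
next
  case (var i)
  have "map_coeffs l (in_y (Var i) * D) = Var i * map_coeffs l D"
  proof (rule poly_mapping_eqI)
    fix m :: "'n \<Rightarrow>\<^sub>0 nat"
    show "Poly_Mapping.lookup (map_coeffs l (in_y (Var i) * D)) m = Poly_Mapping.lookup (Var i * map_coeffs l D) m"
    proof (cases "\<exists>q. m = Poly_Mapping.single i 1 + q")
      case True
      then obtain q where "m = Poly_Mapping.single i 1 + q" by blast
      thus ?thesis unfolding in_y_Var lookup_map_coeffs
        by (simp only: lookup_single_mult_add Var_def lookup_map_coeffs mult_1)
    next
      case False
      thus ?thesis unfolding in_y_Var lookup_map_coeffs unfolding Var_def
        by (subst (1 2) lookup_single_mult_other) (auto simp: functional_zero[OF l])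
    qed
  qed
  thus ?case by (simp add: Var_def)
next
  case (add p q)
  thus ?case by (simp add: in_y.hom_add map_coeffs_add distrib_right)
next
  case (mult p q)
  thus ?case by (simp add: in_y.hom_mult mult.assoc)
qed

end

text \<open>The determinant \<open>\<Delta>\<close> of a matrix that expresses \<open>f(x) - f(y)\<close> through \<open>x - y\<close> is the
  Bezoutian. Modulo \<open>f(x)\<close> and \<open>f(y)\<close> it does not distinguish multiplication by \<open>p(x)\<close> from
  multiplication by \<open>p(y)\<close>, and for \<open>y = 0\<close> it is a determinant of the kind defining the socle
  element. Contraction with \<open>l\<close> therefore gives a unit \<open>u\<close>, and \<open>p u\<close> is congruent to the
  contraction of \<open>p(x) \<Delta>\<close>, which is \<open>0\<close>.\<close>

lemma functional_form_radical:
  fixes f :: "'n::finite \<Rightarrow> ('n, 'k::field) mpoly"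
  assumes char: "CHAR('k) \<noteq> 2" and nil: "nil_mod f"
    and A: "\<And>i. apply_mat A Var i = f i"
    and l: "functional l" and l0: "\<And>p. p \<in> ideal_of f \<Longrightarrow> l p = 0" and l1: "l (det A) = 1"
    and p: "\<And>q. l (p * q) = 0"
  shows "p \<in> ideal_of f"
proof -
  let ?D = "\<lambda>j. in_x (Var j) - in_y (Var j) :: ('n, 'k) mpoly2"
  have "\<forall>i. \<exists>c. in_x (f i) - in_y (f i) = (\<Sum>j\<in>UNIV. c j * ?D j)"
  proof
    fix i
    obtain c where "in_x (f i) - in_y (f i) = (\<Sum>j\<in>UNIV. c j * ?D j)"
      by (rule ideal_ofE[OF in_x_minus_in_y[of "f i"]])
    thus "\<exists>c. in_x (f i) - in_y (f i) = (\<Sum>j\<in>UNIV. c j * ?D j)" by blast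
  qed
  from choice[OF this] obtain c where
    "\<forall>i. in_x (f i) - in_y (f i) = (\<Sum>j\<in>UNIV. c i j * ?D j)" by (rule exE)
  hence c: "in_x (f i) - in_y (f i) = (\<Sum>j\<in>UNIV. c i j * ?D j)" for i by (rule spec)
  define B where "B = (\<chi> i j. c i j)"
  have B: "apply_mat B ?D = (\<lambda>i. in_x (f i) - in_y (f i))" by (rule ext) (simp add: B_def c)
  \<comment> \<open>The Bezoutian matrix at \<open>y = 0\<close> again expresses \<open>f\<close> through \<open>x\<close>.\<close>
  define E where "E = (\<chi> i j. y_zero (vec_nth (vec_nth B i) j))"
  have "apply_mat E Var i = f i" for i
  proof -
    have "eval0 (f i) = 0" unfolding A[symmetric] by (simp add: eval0.hom_sum eval0.hom_mult)
    hence "f i = y_zero (in_x (f i) - in_y (f i))"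
      by (simp add: y_zero.hom_minus y_zero_in_x y_zero_in_y)
    also have "\<dots> = apply_mat E Var i"
      by (simp add: c E_def B_def y_zero.hom_sum y_zero.hom_mult y_zero.hom_minus y_zero_in_x y_zero_in_y)
    finally show ?thesis by simp
  qed
  from det_independent_Var[OF char A this] have "l (det E - det A) = 0" by (rule l0)
  hence lE: "l (det E) = 1" using l1 functional_diff[OF l] by simp
  define u where "u = map_coeffs l (det B)"
  have "det E = Poly_Mapping.lookup (det B) 0"
    unfolding E_def det_hom[OF y_zero.comm_ring_hom_axioms] by (rule y_zero_lookup)
  hence "eval0 u = 1" using lE by (simp add: u_def eval0_def lookup_map_coeffs[OF l])
  then obtain w where w: "u * w - 1 \<in> ideal_of f" using unit_mod[OF nil, of u] by auto
  have "det B * (in_x p - in_y p) \<in> ideal_of (\<lambda>i. in_x (f i) - in_y (f i))"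
    using det_mult_ideal[OF in_x_minus_in_y, of B p] unfolding B .
  then obtain d where d: "det B * (in_x p - in_y p) = (\<Sum>i\<in>UNIV. d i * (in_x (f i) - in_y (f i)))"
    by (rule ideal_ofE)
  have lf: "l (f i * q) = 0" for i q by (intro l0 ideal_of_mult' ideal_of_gen)
  have "p * u = map_coeffs l (in_y p * det B)" unfolding u_def by (simp add: map_coeffs_in_y[OF l])
  also have "in_y p * det B = in_x p * det B - det B * (in_x p - in_y p)" by (simp add: algebra_simps)
  also have "det B * (in_x p - in_y p) = (\<Sum>i\<in>UNIV. in_x (f i) * d i - in_y (f i) * d i)"
    unfolding d by (simp add: algebra_simps)
  also have "map_coeffs l (in_x p * det B - \<dots>) = (\<Sum>i\<in>UNIV. f i * map_coeffs l (d i))"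
    by (simp add: map_coeffs_diff[OF l] map_coeffs_sum[OF l] map_coeffs_in_y[OF l]
        map_coeffs_in_x_zero[OF l p] map_coeffs_in_x_zero[OF l lf] sum_negf)
  also have "\<dots> \<in> ideal_of f" by (intro ideal_of_sum ideal_of_mult' ideal_of_gen)
  finally have "p * u * w - p * (u * w - 1) \<in> ideal_of f"
    by (rule ideal_of_diff[OF ideal_of_mult' ideal_of_mult[OF w]])
  thus ?thesis by (simp add: algebra_simps)
qed

section \<open>A functional that does not vanish on the socle element\<close>

lemma functional_times: "functional l \<Longrightarrow> functional (\<lambda>p. l (a * p))"
proof -
  assume l: "functional l"
  have "a * (Const c * p) = Const c * (a * p)" for c p by (rule mult.left_commute)
  hence "l (a * (Const c * p)) = c * l (a * p)" for c p by (simp only: functional_scale[OF l])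
  thus ?thesis unfolding functional_def
    by (simp add: distrib_left functional_add[OF l])
qed

lemma functional_lookup: "functional (\<lambda>p. Poly_Mapping.lookup p m)"
  by (simp add: functional_def lookup_add Const_mult_lookup)

lemma lookup_Var_power_ideal:
  assumes "p \<in> ideal_of (\<lambda>j. Var j ^ N)" "\<And>j. Poly_Mapping.lookup m j < N"
  shows "Poly_Mapping.lookup p m = 0"
proof -
  obtain c where p: "p = (\<Sum>j\<in>UNIV. c j * Var j ^ N)" using assms(1) by (rule ideal_ofE)
  have "Poly_Mapping.lookup (c j * Var j ^ N) m = 0" for j
  proof -
    have "m \<noteq> Poly_Mapping.single j N + q" for q
    proof
      assume "m = Poly_Mapping.single j N + q"
      hence "Poly_Mapping.lookup m j = N + Poly_Mapping.lookup q j" by (simp add: lookup_add)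
      thus False using assms(2)[of j] by simp
    qed
    thus ?thesis unfolding Var_power mult.commute[of "c j"] by (rule lookup_single_mult_other)
  qed
  thus ?thesis by (simp add: p lookup_sum)
qed

text \<open>If \<open>x ^ N = W f\<close>, then \<open>W A\<close> and the diagonal matrix of the \<open>x\<^sub>j ^ (N - 1)\<close> agree on
  \<open>x\<close>, hence their determinants are congruent modulo the \<open>x\<^sub>j ^ N\<close>. The functional is the
  coefficient of the product of the \<open>x\<^sub>j ^ (N - 1)\<close>, which occurs in no element of that
  ideal, after multiplication by \<open>det W\<close>.\<close>

lemma dual_functional_exists:
  fixes f :: "'n::finite \<Rightarrow> ('n, 'k::field) mpoly"
  assumes char: "CHAR('k) \<noteq> 2" and N: "N > 0" and pow: "\<And>j. Var j ^ N \<in> ideal_of f"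
    and A: "\<And>i. apply_mat A Var i = f i"
  obtains l where "functional l" "\<And>p. p \<in> ideal_of f \<Longrightarrow> l p = 0" "l (det A) = 1"
proof -
  have "\<forall>j. \<exists>c. Var j ^ N = (\<Sum>i\<in>UNIV. c i * f i)"
  proof
    fix j
    obtain c where "Var j ^ N = (\<Sum>i\<in>UNIV. c i * f i)" by (rule ideal_ofE[OF pow])
    thus "\<exists>c. Var j ^ N = (\<Sum>i\<in>UNIV. c i * f i)" by blast
  qed
  from choice[OF this] obtain c where "\<forall>j. Var j ^ N = (\<Sum>i\<in>UNIV. c j i * f i)" by (rule exE)
  hence c: "Var j ^ N = (\<Sum>i\<in>UNIV. c j i * f i)" for j by (rule spec)
  define W where "W = (\<chi> j i. c j i)"
  have W: "apply_mat W f = (\<lambda>j. Var j ^ N)" by (rule ext) (simp add: W_def c)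
  define m :: "'n \<Rightarrow>\<^sub>0 nat" where "m = (\<Sum>i\<in>UNIV. Poly_Mapping.single i (N - 1))"
  have m: "Poly_Mapping.lookup m i = N - 1" for i
    by (simp add: m_def lookup_sum lookup_single when_def)
  define D :: "('n, 'k) mpoly ^ 'n ^ 'n" where "D = (\<chi> i j. if i = j then Var i ^ (N - 1) else 0)"
  have DN: "apply_mat D Var i = Var i ^ N" for i
  proof -
    have "apply_mat D Var i = (\<Sum>j\<in>UNIV. if i = j then Var i ^ (N - 1) * Var i else 0)"
      unfolding D_def by (intro sum.cong) auto
    also have "\<dots> = Var i ^ N" using N by (simp flip: power_Suc2)
    finally show ?thesis .
  qed
  have "det D = (\<Prod>i\<in>UNIV. Var i ^ (N - 1))" by (subst det_diagonal) (auto simp: D_def)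
  also have "\<dots> = (\<Prod>i\<in>UNIV. Poly_Mapping.single (Poly_Mapping.single i 1) 1 ^ Poly_Mapping.lookup m i)"
    by (simp add: m Var_def)
  also have "\<dots> = Poly_Mapping.single m 1" by (simp only: single_eq_prod sum_single_lookup)
  finally have D: "Poly_Mapping.lookup (det D) m = 1" by simp
  define l where "l p = Poly_Mapping.lookup (det W * p) m" for p
  have "functional l" unfolding l_def by (rule functional_times[OF functional_lookup])
  moreover have "l p = 0" if "p \<in> ideal_of f" for p
    unfolding l_def using det_mult_ideal[OF that, of W] N
    by (intro lookup_Var_power_ideal[of _ N]) (simp_all add: W m)
  moreover have "l (det A) = 1"
  proof -
    have "apply_mat (W ** A) Var j = Var j ^ N" for j
    proof -
      have "apply_mat (W ** A) Var j = (\<Sum>k\<in>UNIV. \<Sum>i\<in>UNIV. c j i * (vec_nth (vec_nth A i) k * Var k))"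
        by (simp add: matrix_matrix_mult_def W_def sum_distrib_right mult.assoc)
      also have "\<dots> = (\<Sum>i\<in>UNIV. c j i * apply_mat A Var i)"
        by (subst sum.swap) (simp add: sum_distrib_left)
      finally show ?thesis by (simp add: A c)
    qed
    from det_independent_Var[OF char DN this]
    have "det W * det A - det D \<in> ideal_of (\<lambda>j. Var j ^ N)" by (simp add: det_mul)
    hence "Poly_Mapping.lookup (det W * det A - det D) m = 0"
      by (rule lookup_Var_power_ideal) (use N in \<open>simp add: m\<close>)
    thus ?thesis using D by (simp add: l_def lookup_minus)
  qed
  ultimately show ?thesis by (rule that)
qed

section \<open>Hyperbolic bases\<close>

lemma functional_mod:
  assumes "functional l" "\<And>p. p \<in> ideal_of f \<Longrightarrow> l p = 0" "p - q \<in> ideal_of f"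
  shows "l p = l q"
  using assms(2)[OF assms(3)] functional_diff[OF assms(1)] by simp

text \<open>The monomials with all exponents below \<open>N\<close> span \<open>R / I\<close>. In their coordinates the identity
  matrix of size \<open>k\<close> factors through that many dimensions.\<close>

lemma biorthogonal_bound:
  fixes f :: "'n::finite \<Rightarrow> ('n, 'k::field) mpoly"
  assumes l: "functional l" and l0: "\<And>p. p \<in> ideal_of f \<Longrightarrow> l p = 0"
    and pow: "\<And>j. Var j ^ N \<in> ideal_of f"
    and p: "\<And>i j. i < k \<Longrightarrow> j < k \<Longrightarrow> l (p i * p j) = (if i = j then 1 else 0)"
  shows "k \<le> card {m :: 'n \<Rightarrow>\<^sub>0 nat. \<forall>i. Poly_Mapping.lookup m i < N}"
proof -
  define S where "S = {m :: 'n \<Rightarrow>\<^sub>0 nat. \<forall>i. Poly_Mapping.lookup m i < N}"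
  have "Poly_Mapping.lookup ` S \<subseteq> (\<Pi>\<^sub>E i\<in>UNIV. {..<N})" by (auto simp: S_def)
  hence "finite (Poly_Mapping.lookup ` S)" by (rule finite_subset) (simp add: finite_PiE)
  hence fin: "finite S" by (rule finite_imageD) (auto intro!: inj_onI poly_mapping_eqI)
  obtain e where e: "bij_betw e {0..<card S} S" using ex_bij_betw_nat_finite[OF fin] by blast
  have red: "l (r * q) = (\<Sum>m\<in>S. Poly_Mapping.lookup r m * l (Poly_Mapping.single m 1 * q))" for r q
  proof -
    have mono: "l (Poly_Mapping.single m c * q) = (if m \<in> S then c * l (Poly_Mapping.single m 1 * q) else 0)" for m c
    proof (cases "m \<in> S")
      case True
      have "Poly_Mapping.single m c * q = Const c * (Poly_Mapping.single m 1 * q)"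
        by (simp add: Const_def mult_single flip: mult.assoc)
      thus ?thesis using True functional_scale[OF l] by simp
    next
      case False
      then obtain j where "N \<le> Poly_Mapping.lookup m j" by (auto simp: S_def not_less)
      note m = exponent_split[OF this, symmetric]
      have "Poly_Mapping.single m c = Var j ^ N * Poly_Mapping.single (m - Poly_Mapping.single j N) c"
        by (simp add: Var_power mult_single m)
      hence "Poly_Mapping.single m c \<in> ideal_of f" using ideal_of_mult'[OF pow] by simp
      thus ?thesis using False l0[OF ideal_of_mult'] by simp
    qed
    have "l (r * q) = l (\<Sum>m\<in>Poly_Mapping.keys r. Poly_Mapping.single m (Poly_Mapping.lookup r m) * q)"
      by (subst sum_monomials[of r]) (simp only: sum_distrib_right)
    also have "\<dots> = (\<Sum>m\<in>Poly_Mapping.keys r. if m \<in> S then Poly_Mapping.lookup r m * l (Poly_Mapping.single m 1 * q) else 0)"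
      unfolding functional_sum[OF l] by (rule sum.cong[OF refl mono])
    also have "\<dots> = (\<Sum>m\<in>S. Poly_Mapping.lookup r m * l (Poly_Mapping.single m 1 * q))"
      using fin by (intro sum.mono_neutral_cong) (auto simp: in_keys_iff)
    finally show ?thesis .
  qed
  define C where "C = mat k (card S) (\<lambda>(i, t). Poly_Mapping.lookup (p i) (e t))"
  define D where "D = mat (card S) k (\<lambda>(t, j). l (Poly_Mapping.single (e t) 1 * p j))"
  have "C * D = 1\<^sub>m k"
  proof (rule eq_matI)
    fix i j assume "i < dim_row (1\<^sub>m k :: 'k mat)" "j < dim_col (1\<^sub>m k :: 'k mat)"
    hence ij: "i < k" "j < k" by auto
    have "(C * D) $$ (i, j) =
        (\<Sum>t\<in>{0..<card S}. Poly_Mapping.lookup (p i) (e t) * l (Poly_Mapping.single (e t) 1 * p j))"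
      using ij by (simp add: C_def D_def scalar_prod_def)
    also have "\<dots> = l (p i * p j)"
      by (rule trans[OF sum.reindex_bij_betw[OF e] red[symmetric]])
    finally show "(C * D) $$ (i, j) = 1\<^sub>m k $$ (i, j)" using p ij by simp
  qed (simp_all add: C_def D_def)
  hence "k \<le> card S" by (intro right_inverse_dim_le[of C _ _ D]) (simp_all add: C_def D_def)
  thus ?thesis by (simp add: S_def)
qed

text \<open>A basis of \<open>R / I\<close>, orthogonal for the form \<open>l (a b)\<close>, of \<open>k\<close> vectors of length \<open>1\<close> and
  \<open>k\<close> of length \<open>- 1\<close>. The second clause is the orthogonal expansion; together with the first it
  makes the \<open>2 k\<close> residue classes a basis as soon as \<open>l\<close> kills \<open>I\<close>. Working with
  representatives in \<open>R\<close> avoids the quotient.\<close>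

definition hyperbolic_basis :: "('n::finite \<Rightarrow> ('n, 'k::field) mpoly) \<Rightarrow> (('n, 'k) mpoly \<Rightarrow> 'k) \<Rightarrow> nat \<Rightarrow>
    (nat \<Rightarrow> ('n, 'k) mpoly) \<Rightarrow> (nat \<Rightarrow> ('n, 'k) mpoly) \<Rightarrow> bool" where
  "hyperbolic_basis f l k p q \<longleftrightarrow>
     (\<forall>i<k. \<forall>j<k. l (p i * p j) = (if i = j then 1 else 0) \<and>
        l (q i * q j) = (if i = j then - 1 else 0) \<and> l (p i * q j) = 0) \<and>
     (\<forall>r. r - (\<Sum>i<k. Const (l (r * p i)) * p i - Const (l (r * q i)) * q i) \<in> ideal_of f)"

text \<open>Take a longest orthonormal system \<open>p\<close> that is also orthogonal to its image under \<open>s\<close>. The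
  orthogonal complement \<open>W\<close> of both is stable under \<open>s\<close>. A vector of \<open>W\<close> outside the radical
  would yield, by polarisation within \<open>W\<close>, an \<open>x \<in> W\<close> of length \<open>c \<noteq> 0\<close>, and the
  plane of \<open>x\<close> and \<open>s x\<close> contains a vector of length \<open>1\<close> orthogonal to its image, which would
  extend the system.\<close>

lemma hyperbolic_basis_of_involution:
  fixes f :: "'n::finite \<Rightarrow> ('n, 'k::field) mpoly"
  assumes two: "(2::'k) \<noteq> 0" and l: "functional l" and l0: "\<And>p. p \<in> ideal_of f \<Longrightarrow> l p = 0"
    and rad: "\<And>p. (\<And>q. l (p * q) = 0) \<Longrightarrow> p \<in> ideal_of f"
    and pow: "\<And>j. Var j ^ N \<in> ideal_of f"
    and s: "comm_ring_hom s" and ss: "\<And>p. s (s p) = p" and ls: "\<And>p. l (s p) = - l p"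
    and sC: "\<And>c. s (Const c) = Const c"
  obtains k p where "hyperbolic_basis f l k p (\<lambda>i. s (p i))"
proof -
  interpret s: comm_ring_hom s by (rule s)
  define ok where "ok k p \<longleftrightarrow> (\<forall>i<k. \<forall>j<k. l (p i * p j) = (if i = j then 1 else 0) \<and> l (p i * s (p j)) = 0)"
    for k and p :: "nat \<Rightarrow> ('n, 'k) mpoly"
  have "\<exists>k p. ok k p" by (rule exI[of _ 0]) (simp add: ok_def)
  have bound: "\<forall>k. (\<exists>p. ok k p) \<longrightarrow> k \<le> card {m :: 'n \<Rightarrow>\<^sub>0 nat. \<forall>i. Poly_Mapping.lookup m i < N}"
  proof (intro allI impI)
    fix k assume "\<exists>p. ok k p"
    then obtain p where "ok k p" by (rule exE)
    thus "k \<le> card {m :: 'n \<Rightarrow>\<^sub>0 nat. \<forall>i. Poly_Mapping.lookup m i < N}"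
      by (intro biorthogonal_bound[OF l l0 pow, of k p]) (simp_all add: ok_def)
  qed
  define k where "k = (GREATEST k. \<exists>p. ok k p)"
  have k: "\<exists>p. ok k p" unfolding k_def
    by (rule GreatestI_ex_nat[OF \<open>\<exists>k p. ok k p\<close> bound[rule_format]])
  have max: "k' \<le> k" if "\<exists>p. ok k' p" for k'
    unfolding k_def by (rule Greatest_le_nat[where P = "\<lambda>k. \<exists>p. ok k p", OF that bound[rule_format]])
  obtain p where p: "ok k p" using k by (rule exE)
  have pp: "l (p i * p j) = (if i = j then 1 else 0)" and ps: "l (p i * s (p j)) = 0" if "i < k" "j < k" for i j
    using p that by (simp_all add: ok_def)
  have sw: "l (s x * y) = - l (x * s y)" for x y
    using ls[of "x * s y"] by (simp add: s.hom_mult ss)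
  have sp: "l (s (p i) * p j) = 0" and s2: "l (s (p i) * s (p j)) = (if i = j then - 1 else 0)"
    if "i < k" "j < k" for i j
    using that by (simp_all add: sw ss pp ps)
  define W where "W = {v. \<forall>j<k. l (v * p j) = 0 \<and> l (v * s (p j)) = 0}"
  define \<pi> where "\<pi> r = r - (\<Sum>i<k. Const (l (r * p i)) * p i - Const (l (r * s (p i))) * s (p i))" for r
  have lpi: "l (\<pi> r * y) = l (r * y) - (\<Sum>i<k. l (r * p i) * l (p i * y) - l (r * s (p i)) * l (s (p i) * y))" for r y
    unfolding \<pi>_def
    by (simp add: left_diff_distrib sum_distrib_right functional_diff[OF l] functional_sum[OF l]
        mult.assoc functional_scale[OF l])
  have piW: "\<pi> r \<in> W" for r
  proof -
    have "l (\<pi> r * p j) = 0" if "j < k" for j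
    proof -
      have "(\<Sum>i<k. l (r * p i) * l (p i * p j) - l (r * s (p i)) * l (s (p i) * p j)) =
          (\<Sum>i<k. if i = j then l (r * p j) else 0)"
        using that by (intro sum.cong refl) (simp add: pp sp)
      thus ?thesis using that by (simp add: lpi)
    qed
    moreover have "l (\<pi> r * s (p j)) = 0" if "j < k" for j
    proof -
      have "(\<Sum>i<k. l (r * p i) * l (p i * s (p j)) - l (r * s (p i)) * l (s (p i) * s (p j))) =
          (\<Sum>i<k. if i = j then l (r * s (p j)) else 0)"
        using that by (intro sum.cong refl) (simp add: ps s2)
      thus ?thesis using that by (simp add: lpi)
    qed
    ultimately show ?thesis by (simp add: W_def)
  qed
  have orth: "l (w * \<pi> z) = l (w * z)" if "w \<in> W" for w z
    using that lpi[of z w] by (simp add: W_def mult.commute[of w])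
  have "w \<in> ideal_of f" if w: "w \<in> W" for w
  proof (rule rad, rule ccontr)
    fix z assume "l (w * z) \<noteq> 0"
    hence wz: "l (w * \<pi> z) \<noteq> 0" by (simp add: orth[OF w])
    have "\<exists>x\<in>W. l (x * x) \<noteq> 0"
    proof (rule ccontr)
      assume "\<not> ?thesis"
      hence iso: "l (x * x) = 0" if "x \<in> W" for x using that by blast
      have "w + \<pi> z \<in> W" using w piW[of z]
        by (simp add: W_def distrib_right functional_add[OF l])
      from iso[OF this] have "l ((w + \<pi> z) * (w + \<pi> z)) = 0" .
      also have "(w + \<pi> z) * (w + \<pi> z) = w * w + (w * \<pi> z + w * \<pi> z) + \<pi> z * \<pi> z"
        by (simp add: algebra_simps)
      finally have "l (w * \<pi> z) + l (w * \<pi> z) = 0"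
        by (simp only: functional_add[OF l] iso[OF w] iso[OF piW[of z]] add_0_left add_0_right)
      hence "2 * l (w * \<pi> z) = 0" by simp
      thus False using two wz by simp
    qed
    then obtain x where x: "x \<in> W" and xx: "l (x * x) \<noteq> 0" by (rule bexE)
    define c where "c = l (x * x)"
    have xs: "l (x * s x) = 0"
    proof -
      have "l (x * s x) = - l (x * s x)" using sw[of x x] by (simp add: mult.commute)
      hence "2 * l (x * s x) = 0" by (simp add: eq_neg_iff_add_eq_0)
      thus ?thesis using two by simp
    qed
    have ssx: "l (s x * s x) = - c" by (simp add: sw ss c_def)
    \<comment> \<open>Chosen with \<open>\<alpha> + \<beta> = 1 / c\<close> and \<open>\<alpha> - \<beta> = 1\<close>, so that \<open>\<alpha> x +
      \<beta> s x\<close> has length \<open>1\<close>.\<close>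
    define \<alpha> where "\<alpha> = (1 / c + 1) / 2"
    define \<beta> where "\<beta> = (1 / c - 1) / 2"
    have ab: "c * (\<alpha> * \<alpha> - \<beta> * \<beta>) = 1"
    proof -
      have "\<alpha> + \<beta> = 1 / c" "\<alpha> - \<beta> = 1"
        using two by (simp_all add: \<alpha>_def \<beta>_def flip: add_divide_distrib diff_divide_distrib)
      moreover have "\<alpha> * \<alpha> - \<beta> * \<beta> = (\<alpha> + \<beta>) * (\<alpha> - \<beta>)" by (simp add: algebra_simps)
      ultimately show ?thesis using xx by (simp add: c_def)
    qed
    define y where "y = Const \<alpha> * x + Const \<beta> * s x"
    have sy: "s y = Const \<alpha> * s x + Const \<beta> * x"
      by (simp add: y_def s.hom_add s.hom_mult sC ss)
    have ly: "l (y * r) = \<alpha> * l (x * r) + \<beta> * l (s x * r)" for r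
      by (simp add: y_def distrib_right functional_add[OF l] mult.assoc functional_scale[OF l])
    have lr: "l (r * y) = \<alpha> * l (r * x) + \<beta> * l (r * s x)" for r
      using ly[of r] by (simp add: mult.commute)
    have lsr: "l (r * s y) = \<alpha> * l (r * s x) + \<beta> * l (r * x)" for r
      unfolding sy by (simp add: distrib_left functional_add[OF l] mult.left_commute[of r] functional_scale[OF l])
    have yy: "l (y * y) = 1"
      using ab by (simp add: ly lr xs ssx sw[of x x] c_def[symmetric] algebra_simps)
    have ysy: "l (y * s y) = 0"
      by (simp add: ly lsr xs ssx sw[of x x] c_def[symmetric])
    have yp: "l (y * p j) = 0" "l (y * s (p j)) = 0" if "j < k" for j
      using x that by (simp_all add: ly sw ss W_def)
    have py: "l (p j * y) = 0" "l (p j * s y) = 0" if "j < k" for j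
    proof -
      show "l (p j * y) = 0" using yp(1)[OF that] by (simp add: mult.commute)
      have "l (s y * p j) = 0" using yp(2)[OF that] sw[of y "p j"] by simp
      thus "l (p j * s y) = 0" by (simp add: mult.commute)
    qed
    have "ok (Suc k) (\<lambda>i. if i = k then y else p i)"
      unfolding ok_def using pp ps yy ysy yp py by (auto simp: less_Suc_eq)
    hence "Suc k \<le> k" by (intro max exI)
    thus False by simp
  qed
  hence "\<pi> r \<in> ideal_of f" for r using piW by blast
  hence "hyperbolic_basis f l k p (\<lambda>i. s (p i))"
    unfolding hyperbolic_basis_def \<pi>_def using pp ps s2 by simp
  thus ?thesis by (rule that)
qed

text \<open>Successive approximation: the error is divisible by ever higher powers of the nilpotent element \<open>n
  = u - 1\<close>. The clause \<open>w = 1 + n * t\<close> is what makes the next error divisible by one more power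
  of \<open>n\<close>.\<close>

lemma sqrt_mod:
  fixes f :: "'n::finite \<Rightarrow> ('n, 'k::field) mpoly"
  assumes nil: "nil_mod f" and u: "eval0 u = 1" and two: "(2::'k) \<noteq> 0"
  obtains w where "w * w - u \<in> ideal_of f" "eval0 w = 1"
proof -
  define n where "n = u - 1"
  have n0: "eval0 n = 0" using u by (simp add: n_def eval0.hom_minus)
  obtain M where M: "n ^ M \<in> ideal_of f" using nil n0 unfolding nil_mod_def by blast
  define h where "h = (Const (1/2) :: ('n, 'k) mpoly)"
  have h: "h + h = 1" using two by (simp add: h_def flip: Const.hom_add)
  have "\<exists>w r t. w * w = u + n ^ Suc k * r \<and> w = 1 + n * t" for k
  proof (induction k)
    case 0
    show ?case by (rule exI[of _ 1], rule exI[of _ "- 1"], rule exI[of _ 0]) (simp add: n_def)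
  next
    case (Suc k)
    then obtain w r t where w: "w * w = u + n ^ Suc k * r" "w = 1 + n * t" by blast
    define w' where "w' = w - h * n ^ Suc k * r"
    define r' where "r' = - (r * t) + h * h * n ^ k * (r * r)"
    have "w' * w' = w * w - (h + h) * n ^ Suc k * r * w + h * h * n ^ Suc k * n ^ Suc k * (r * r)"
      unfolding w'_def by (simp add: algebra_simps)
    also have "\<dots> = u + n ^ Suc k * r * (1 - w) + h * h * n ^ Suc k * n ^ Suc k * (r * r)"
      unfolding h w(1) by (simp add: algebra_simps)
    also have "1 - w = - (n * t)" unfolding w(2) by simp
    also have "u + n ^ Suc k * r * (- (n * t)) + h * h * n ^ Suc k * n ^ Suc k * (r * r) = u + n ^ Suc (Suc k) * r'"
      unfolding r'_def by (simp add: algebra_simps)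
    finally have "w' * w' = u + n ^ Suc (Suc k) * r'" .
    moreover have "w' = 1 + n * (t - h * n ^ k * r)"
      unfolding w'_def w(2) by (simp add: algebra_simps)
    ultimately show ?case by blast
  qed
  then obtain w r t where w: "w * w = u + n ^ Suc M * r" "w = 1 + n * t" by blast
  have "w * w - u = n * r * n ^ M" unfolding w(1) by (simp add: algebra_simps)
  hence "w * w - u \<in> ideal_of f" using ideal_of_mult[OF M] by simp
  moreover have "eval0 w = 1" unfolding w(2) by (simp add: eval0.hom_add eval0.hom_mult n0)
  ultimately show ?thesis by (rule that)
qed

text \<open>By nondegeneracy \<open>l a = m (u a)\<close>, where \<open>u\<close> is read off from the basis. As \<open>E\<close> is annihilated
  by the variables, \<open>1 = l E = u(0) * m E = u(0)\<close>. If \<open>w\<close> is a square root of \<open>u\<close> with inverse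
  \<open>v\<close>, multiplication by \<open>v\<close> carries the form of \<open>m\<close> to that of \<open>l\<close>.\<close>

lemma hyperbolic_basis_twist:
  fixes f :: "'n::finite \<Rightarrow> ('n, 'k::field) mpoly"
  assumes two: "(2::'k) \<noteq> 0" and nil: "nil_mod f" and A: "apply_mat A Var = f"
    and l: "functional l" "\<And>p. p \<in> ideal_of f \<Longrightarrow> l p = 0" "l (det A) = 1"
    and m: "functional m" "\<And>p. p \<in> ideal_of f \<Longrightarrow> m p = 0" "m (det A) = 1"
    and basis: "hyperbolic_basis f m k a b"
  obtains p q where "hyperbolic_basis f l k p q"
proof -
  \<comment> \<open>The element representing \<open>l\<close> with respect to the form of \<open>m\<close>.\<close>
  define u where "u = (\<Sum>i<k. Const (l (a i)) * a i - Const (l (b i)) * b i)"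
  have exp: "r - (\<Sum>i<k. Const (m (r * a i)) * a i - Const (m (r * b i)) * b i) \<in> ideal_of f" for r
    using basis by (simp add: hyperbolic_basis_def)
  have lm: "l r = m (u * r)" for r
  proof -
    have "l r = l (\<Sum>i<k. Const (m (r * a i)) * a i - Const (m (r * b i)) * b i)"
      by (rule functional_mod[OF l(1,2) exp])
    also have "\<dots> = (\<Sum>i<k. m (r * a i) * l (a i) - m (r * b i) * l (b i))"
      by (simp add: functional_sum[OF l(1)] functional_diff[OF l(1)] functional_scale[OF l(1)])
    also have "\<dots> = (\<Sum>i<k. l (a i) * m (a i * r) - l (b i) * m (b i * r))"
      by (simp add: mult.commute)
    also have "\<dots> = m (u * r)"
      unfolding u_def by (simp add: sum_distrib_right left_diff_distrib functional_sum[OF m(1)]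
        functional_diff[OF m(1)] mult.assoc functional_scale[OF m(1)])
    finally show ?thesis .
  qed
  have "eval0 u = 1"
  proof -
    have "u - Const (eval0 u) \<in> ideal_of Var"
      by (rule eval0_zero_in_ideal) (simp add: eval0.hom_minus)
    from det_mult_ideal[OF this, of A] have I: "det A * (u - Const (eval0 u)) \<in> ideal_of f"
      unfolding A .
    have "u * det A - Const (eval0 u) * det A \<in> ideal_of f"
      using I by (simp add: algebra_simps)
    from functional_mod[OF m(1,2) this] have "l (det A) = eval0 u * m (det A)"
      by (simp add: lm functional_scale[OF m(1)])
    thus ?thesis using l(3) m(3) by simp
  qed
  then obtain w where w: "w * w - u \<in> ideal_of f" and w1: "eval0 w = 1"
    by (rule sqrt_mod[OF nil _ two])
  obtain v where v: "w * v - 1 \<in> ideal_of f" using unit_mod[OF nil, of w] w1 by auto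
  have uv: "u * v - w \<in> ideal_of f"
  proof -
    have "u * v - w = w * (w * v - 1) - v * (w * w - u)" by (simp add: algebra_simps)
    thus ?thesis by (simp add: ideal_of_diff ideal_of_mult v w)
  qed
  have uvv: "u * v * v - 1 \<in> ideal_of f"
  proof -
    have *: "u * v * v - 1 = v * (u * v - w) + (w * v - 1)" by (simp add: algebra_simps)
    show ?thesis unfolding * by (rule ideal_of_add[OF ideal_of_mult[OF uv] v])
  qed
  have lv: "l (v * x * (v * y)) = m (x * y)" for x y
  proof -
    have "u * (v * x * (v * y)) - x * y = (u * v * v - 1) * (x * y)" by (simp add: algebra_simps)
    hence "u * (v * x * (v * y)) - x * y \<in> ideal_of f" using ideal_of_mult'[OF uvv] by simp
    from functional_mod[OF m(1,2) this] show ?thesis by (simp add: lm)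
  qed
  have lr: "l (r * (v * x)) = m (w * r * x)" for r x
  proof -
    have "u * (r * (v * x)) - w * r * x = (u * v - w) * (r * x)" by (simp add: algebra_simps)
    hence "u * (r * (v * x)) - w * r * x \<in> ideal_of f" using ideal_of_mult'[OF uv] by simp
    from functional_mod[OF m(1,2) this] show ?thesis by (simp add: lm)
  qed
  have "r - (\<Sum>i<k. Const (l (r * (v * a i))) * (v * a i) - Const (l (r * (v * b i))) * (v * b i)) \<in> ideal_of f" for r
  proof -
    have "r - (\<Sum>i<k. Const (l (r * (v * a i))) * (v * a i) - Const (l (r * (v * b i))) * (v * b i)) =
      v * (w * r - (\<Sum>i<k. Const (m (w * r * a i)) * a i - Const (m (w * r * b i)) * b i)) - r * (w * v - 1)"
      unfolding lr by (simp add: algebra_simps sum_distrib_left)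
    thus ?thesis by (simp add: ideal_of_diff ideal_of_mult exp v)
  qed
  hence "hyperbolic_basis f l k (\<lambda>i. v * a i) (\<lambda>i. v * b i)"
    using basis unfolding hyperbolic_basis_def by (simp add: lv)
  thus ?thesis by (rule that)
qed

text \<open>The functional \<open>(l - l \<circ> s) / 2\<close> is reversed by \<open>s\<close> and, because \<open>s\<close> sends \<open>E\<close> to \<open>-
  E\<close>, has value \<open>1\<close> at \<open>E\<close>.\<close>

lemma hyperbolic_basis_exists:
  fixes f :: "'n::finite \<Rightarrow> ('n, 'k::field) mpoly"
  assumes char: "CHAR('k) \<noteq> 2" and pow: "\<And>j. Var j ^ N \<in> ideal_of f"
    and A: "\<And>i. apply_mat A Var i = f i"
    and s: "comm_ring_hom s" and ss: "\<And>p. s (s p) = p" and sC: "\<And>c. s (Const c) = Const c"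
    and sf: "\<And>i. s (f i) = f i" and sA: "s (det A) + det A \<in> ideal_of f"
    and l: "functional l" "\<And>p. p \<in> ideal_of f \<Longrightarrow> l p = 0" "l (det A) = 1"
  obtains k p q where "hyperbolic_basis f l k p q"
proof -
  interpret s: comm_ring_hom s by (rule s)
  have two: "(2::'k) \<noteq> 0" by (rule two_neq_zero[OF char])
  have nil: "nil_mod f" by (rule nil_modI[OF pow])
  have sI: "s p \<in> ideal_of f" if pI: "p \<in> ideal_of f" for p
  proof -
    obtain c where "p = (\<Sum>i\<in>UNIV. c i * f i)" by (rule ideal_ofE[OF pI])
    hence "s p = (\<Sum>i\<in>UNIV. s (c i) * f i)" by (simp add: s.hom_sum s.hom_mult sf)
    thus ?thesis by (rule ideal_ofI)
  qed
  define m where "m p = (l p - l (s p)) / 2" for p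
  have m: "functional m"
    unfolding functional_def
  proof (intro conjI allI)
    fix p q and c :: 'k
    show "m (p + q) = m p + m q"
      by (simp add: m_def s.hom_add functional_add[OF l(1)] flip: add_divide_distrib)
    show "m (Const c * p) = c * m p"
      by (simp add: m_def s.hom_mult sC functional_scale[OF l(1)] flip: right_diff_distrib)
  qed
  have m0: "m p = 0" if "p \<in> ideal_of f" for p
    using l(2)[OF that] l(2)[OF sI[OF that]] by (simp add: m_def)
  have "l (s (det A)) = - 1"
    using l(2)[OF sA] l(3) functional_add[OF l(1), of "s (det A)" "det A"]
    by (simp add: eq_neg_iff_add_eq_0)
  hence m1: "m (det A) = 1" using two by (simp add: m_def l(3))
  have ms: "m (s p) = - m p" for p by (simp add: m_def ss minus_divide_left)
  obtain k a where ab: "hyperbolic_basis f m k a (\<lambda>i. s (a i))"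
  proof (rule hyperbolic_basis_of_involution[OF two m m0 _ pow s ss ms sC])
    fix p assume p: "m (p * q) = 0" for q
    show "p \<in> ideal_of f"
      by (rule functional_form_radical[where l = m, OF char nil A m m0 m1 p])
  qed
  have Af: "apply_mat A Var = f" using A by (rule ext)
  obtain p q where "hyperbolic_basis f l k p q"
    by (rule hyperbolic_basis_twist[OF two nil Af l m m0 m1 ab])
  thus ?thesis by (rule that)
qed

section \<open>Invariants of a finite group\<close>

lemma prod_add_expand_by_card:
  fixes a :: "'g \<Rightarrow> 'r::comm_ring_1"
  assumes "finite S"
  shows "(\<Prod>g\<in>S. a g + x) = (\<Sum>k\<le>card S. (\<Sum>X\<in>{X. X \<subseteq> S \<and> card X = k}. \<Prod>g\<in>X. a g) * x ^ (card S - k))"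
proof -
  have "(\<Prod>g\<in>S. a g + x) = (\<Sum>X\<in>Pow S. (\<Prod>g\<in>X. a g) * x ^ (card S - card X))"
    using assms by (simp add: prod_add) (intro sum.cong refl, simp add: card_Diff_subset finite_subset)
  also have "\<dots> = (\<Sum>k\<le>card S. \<Sum>X\<in>{X \<in> Pow S. card X = k}. (\<Prod>g\<in>X. a g) * x ^ (card S - card X))"
    using assms by (intro sum.group[symmetric]) (auto simp: card_mono)
  also have "\<dots> = (\<Sum>k\<le>card S. (\<Sum>X\<in>{X. X \<subseteq> S \<and> card X = k}. \<Prod>g\<in>X. a g) * x ^ (card S - k))"
    by (simp add: sum_distrib_right)
  finally show ?thesis .
qed

text \<open>Expand the vanishing product of the \<open>x - g x\<close> over a finite group by powers of \<open>x\<close>. The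
  coefficients are elementary symmetric functions of the orbit, hence fixed, and all but the leading
  one vanish under \<open>\<epsilon>\<close>. The map \<open>t g\<close> describes how the group element \<open>g\<close> permutes
  the orbit.\<close>

lemma power_in_invariant_ideal:
  fixes x :: "'r::comm_ring_1" and h :: "'g \<Rightarrow> 'r \<Rightarrow> 'r"
  assumes fin: "finite S" and hom: "\<And>g. g \<in> S \<Longrightarrow> comm_ring_hom (h g)"
    and perm: "\<And>g. g \<in> S \<Longrightarrow> bij_betw (t g) S S"
    and ht: "\<And>g g'. g \<in> S \<Longrightarrow> g' \<in> S \<Longrightarrow> h g (h g' x) = h (t g g') x"
    and one: "e \<in> S" "h e x = x"
    and eps: "comm_ring_hom \<epsilon>" "\<And>g. g \<in> S \<Longrightarrow> \<epsilon> (h g x) = (0::'s::comm_ring_1)"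
    and I: "\<And>p. (\<And>g. g \<in> S \<Longrightarrow> h g p = p) \<Longrightarrow> \<epsilon> p = 0 \<Longrightarrow> p \<in> ideal_of f"
  shows "x ^ card S \<in> ideal_of f"
proof -
  interpret \<epsilon>: comm_ring_hom \<epsilon> by (rule eps)
  define E where "E k = (\<Sum>X\<in>{X. X \<subseteq> S \<and> card X = k}. \<Prod>g\<in>X. - h g x)" for k
  have finS: "finite {X. X \<subseteq> S \<and> card X = k}" for k
    by (rule finite_subset[of _ "Pow S"]) (use fin in auto)
  have E: "E k \<in> ideal_of f" if k: "k > 0" for k
  proof (rule I)
    fix g assume g: "g \<in> S"
    interpret h: comm_ring_hom "h g" by (rule hom[OF g])
    have inj: "inj_on (t g) S" and img: "t g ` S = S" using perm[OF g] by (auto simp: bij_betw_def)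
    have "h g (E k) = (\<Sum>X\<in>{X. X \<subseteq> S \<and> card X = k}. \<Prod>g'\<in>X. - h (t g g') x)"
      unfolding E_def h.hom_sum h.hom_prod h.hom_uminus
      by (intro sum.cong prod.cong refl) (use ht[OF g] in auto)
    also have "\<dots> = (\<Sum>X\<in>{X. X \<subseteq> S \<and> card X = k}. \<Prod>g'\<in>t g ` X. - h g' x)"
    proof (intro sum.cong refl)
      fix X assume "X \<in> {X. X \<subseteq> S \<and> card X = k}"
      hence "inj_on (t g) X" using inj by (auto intro: inj_on_subset)
      thus "(\<Prod>g'\<in>X. - h (t g g') x) = (\<Prod>g'\<in>t g ` X. - h g' x)"
        by (simp add: prod.reindex)
    qed
    also have "\<dots> = (\<Sum>Y\<in>(`) (t g) ` {X. X \<subseteq> S \<and> card X = k}. \<Prod>g'\<in>Y. - h g' x)"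
    proof (rule sum.reindex[symmetric, unfolded o_def])
      show "inj_on ((`) (t g)) {X. X \<subseteq> S \<and> card X = k}"
        by (rule inj_on_subset[OF inj_on_image_Pow[OF inj]]) auto
    qed
    also have "(`) (t g) ` {X. X \<subseteq> S \<and> card X = k} = {X. X \<subseteq> S \<and> card X = k}"
    proof (rule endo_inj_surj[OF finS])
      show "(`) (t g) ` {X. X \<subseteq> S \<and> card X = k} \<subseteq> {X. X \<subseteq> S \<and> card X = k}"
        using inj img by (auto simp: card_image[OF inj_on_subset])
      show "inj_on ((`) (t g)) {X. X \<subseteq> S \<and> card X = k}"
        by (rule inj_on_subset[OF inj_on_image_Pow[OF inj]]) auto
    qed
    finally show "h g (E k) = E k" by (simp add: E_def)
  next
    have "(\<Prod>g\<in>X. - \<epsilon> (h g x)) = 0" if X: "X \<subseteq> S" "card X = k" for X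
    proof -
      have "X \<noteq> {}" using X(2) k by auto
      then obtain g where "g \<in> X" by blast
      thus ?thesis using X(1) fin eps(2) by (intro prod_zero) (auto intro: finite_subset)
    qed
    thus "\<epsilon> (E k) = 0"
      unfolding E_def by (simp add: \<epsilon>.hom_sum \<epsilon>.hom_prod \<epsilon>.hom_uminus)
  qed
  have "{X. X \<subseteq> S \<and> card X = 0} = {{}}" using fin by (auto dest: finite_subset)
  hence E0: "E 0 = 1" by (simp add: E_def)
  have "(\<Prod>g\<in>S. - h g x + x) = 0"
    using fin one by (intro prod_zero bexI[of _ e]) auto
  hence "0 = (\<Sum>k\<le>card S. E k * x ^ (card S - k))"
    unfolding prod_add_expand_by_card[OF fin] E_def by simp
  also have "\<dots> = x ^ card S + (\<Sum>k\<in>{1..card S}. E k * x ^ (card S - k))"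
    by (simp add: sum.atLeast0_atMost_Suc_shift atMost_atLeast0 sum.atLeast_Suc_atMost E0)
  finally have "x ^ card S = - (\<Sum>k\<in>{1..card S}. E k * x ^ (card S - k))"
    by (simp add: eq_neg_iff_add_eq_0)
  moreover have "(\<Sum>k\<in>{1..card S}. E k * x ^ (card S - k)) \<in> ideal_of f"
    by (intro ideal_of_sum ideal_of_mult' E) auto
  ultimately show ?thesis by (simp add: ideal_of_uminus)
qed

text \<open>An element of \<open>R\<close> without constant term is a polynomial without constant term in the generators.\<close>

lemma invariant_in_ideal:
  fixes f :: "'m::finite \<Rightarrow> ('n, 'k::field) mpoly"
  assumes gen: "polynomial_generators f R" and f0: "\<And>i. eval0 (f i) = 0"
    and p: "p \<in> R" "eval0 p = 0"
  shows "p \<in> ideal_of f"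
proof -
  obtain q where q: "p = mpoly_subst f q"
    using gen p(1) unfolding polynomial_generators_def bij_betw_def by auto
  have "eval0 (mpoly_subst f q) = eval0 q"
  proof (rule comm_ring_hom_poly_eqI[of "\<lambda>q. eval0 (mpoly_subst f q)" eval0])
    show "comm_ring_hom (\<lambda>q. eval0 (mpoly_subst f q))"
      by unfold_locales (simp_all add: mpoly_subst.hom_add mpoly_subst.hom_mult eval0.hom_add eval0.hom_mult)
    show "comm_ring_hom (eval0 :: ('m, 'k) mpoly \<Rightarrow> 'k)" by (rule eval0.comm_ring_hom_axioms)
    show "eval0 (mpoly_subst f (Poly_Mapping.single 0 c)) = eval0 (Poly_Mapping.single 0 c :: ('m, 'k) mpoly)" for c
      by (simp flip: Const_def)
    show "eval0 (mpoly_subst f (Poly_Mapping.single (Poly_Mapping.single i 1) 1)) =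
        eval0 (Poly_Mapping.single (Poly_Mapping.single i 1) 1 :: ('m, 'k) mpoly)" for i
      using f0[of i] by (simp flip: Var_def del: One_nat_def)
  qed
  hence "eval0 q = 0" using p(2) q by simp
  then obtain c where "q = (\<Sum>i\<in>UNIV. c i * Var i)"
    using ideal_ofE[OF eval0_zero_in_ideal] by blast
  hence "p = (\<Sum>i\<in>UNIV. mpoly_subst f (c i) * f i)"
    by (simp add: q mpoly_subst.hom_sum mpoly_subst.hom_mult)
  thus ?thesis by (rule ideal_ofI)
qed

lemma generator_invariant:
  assumes "polynomial_generators f R"
  shows "f i \<in> R"
proof -
  have "mpoly_subst f (Var i) \<in> R"
    using assms unfolding polynomial_generators_def bij_betw_def by blast
  thus ?thesis by simp
qed

section \<open>Linear substitutions and reflections\<close>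

text \<open>The matrix is \<open>x \<mapsto> x - 2 a(x) c\<close> with \<open>a(c) = 1\<close>. Take the linear form \<open>a\<close> as
  coordinate \<open>i0\<close> instead of the given one; in the new coordinates only column \<open>i0\<close> differs from
  the identity, and its diagonal entry is \<open>- 1\<close>.\<close>

lemma det_rank_one_reflection:
  fixes a c :: "'n::finite \<Rightarrow> 'k::field"
  assumes ac: "(\<Sum>m\<in>UNIV. a m * c m) = 1"
  shows "det (\<chi> i m. (if i = m then 1 else 0) - 2 * c i * a m) = - 1"
proof -
  have "\<exists>i. a i \<noteq> 0"
  proof (rule ccontr)
    assume "\<not> ?thesis"
    thus False using ac by simp
  qed
  then obtain i0 where i0: "a i0 \<noteq> 0" by (rule exE)
  define M where "M = (\<chi> i m. (if i = m then 1 else 0) - 2 * c i * a m)"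
  \<comment> \<open>The matrix \<open>P\<close> changes coordinates so that \<open>a\<close> becomes the coordinate \<open>i0\<close>.\<close>
  define P :: "'k ^ 'n ^ 'n" where "P = (\<chi> k. if k = i0 then vec_lambda a else vec_nth (Finite_Cartesian_Product.mat 1) k)"
  define d where "d i = (if i = i0 then - 1 else - 2 * c i)" for i
  define D :: "'k ^ 'n ^ 'n" where "D = (\<chi> i k. if k = i0 then d i else vec_nth (vec_nth (Finite_Cartesian_Product.mat 1) i) k)"
  have "vec_lambda a = (\<Sum>k\<in>UNIV. a k *s vec_nth (Finite_Cartesian_Product.mat 1) k)"
    by (simp add: vec_ext Finite_Cartesian_Product.mat_def if_distrib[of "\<lambda>x. _ * x"] cong: if_cong)
  hence P: "det P = a i0" unfolding P_def using cramer_rows[of i0 a "Finite_Cartesian_Product.mat 1"] by (simp only: det_I mult_1_right)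
  have "apply_mat (Finite_Cartesian_Product.mat 1) d = d"
    by (rule ext) (simp add: Finite_Cartesian_Product.mat_def if_distrib[of "\<lambda>x. x * _"] cong: if_cong)
  hence "det D = - 1" unfolding D_def using cramer_cols[of "Finite_Cartesian_Product.mat 1" i0 d] by (simp add: det_col_def d_def)
  moreover have "P ** M = D ** P"
  proof -
    have prod: "vec_nth (vec_nth (X ** Y) i) m = (\<Sum>k\<in>UNIV. vec_nth (vec_nth X i) k * vec_nth (vec_nth Y k) m)"
      for X Y :: "'k ^ 'n ^ 'n" and i m by (simp add: matrix_matrix_mult_def)
    have "vec_nth (vec_nth (P ** M) i) m = vec_nth (vec_nth (D ** P) i) m" for i m
    proof (cases "i = i0")
      case True
      have "vec_nth (vec_nth (P ** M) i) m = (\<Sum>k\<in>UNIV. a k * ((if k = m then 1 else 0) - 2 * c k * a m))"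
        using True by (simp add: matrix_matrix_mult_def P_def M_def)
      also have "\<dots> = a m - 2 * (\<Sum>k\<in>UNIV. a k * c k) * a m"
        by (simp add: right_diff_distrib sum_subtractf sum_distrib_left sum_distrib_right
            if_distrib[of "\<lambda>x. _ * x"] ac_simps cong: if_cong)
      also have "\<dots> = - a m" using ac by simp
      also have "\<dots> = (\<Sum>k\<in>UNIV. if k = i0 then - a m else 0)" by simp
      also have "\<dots> = vec_nth (vec_nth (D ** P) i) m"
        unfolding prod using True
        by (intro sum.cong refl) (auto simp: P_def D_def d_def Finite_Cartesian_Product.mat_def)
      finally show ?thesis .
    next
      case False
      have "vec_nth (vec_nth (P ** M) i) m = (\<Sum>k\<in>UNIV. if k = i then vec_nth (vec_nth M i) m else 0)"
        unfolding prod using False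
        by (intro sum.cong refl) (auto simp: P_def Finite_Cartesian_Product.mat_def)
      also have "\<dots> = (if i = m then 1 else 0) - 2 * c i * a m" by (simp add: M_def)
      also have "\<dots> = (\<Sum>k\<in>UNIV. (if k = i then (if i = m then 1 else 0) else 0) + (if k = i0 then - (2 * c i * a m) else 0))"
        by (simp add: sum.distrib)
      also have "\<dots> = vec_nth (vec_nth (D ** P) i) m"
        unfolding prod using False
        by (intro sum.cong refl) (auto simp: P_def D_def d_def Finite_Cartesian_Product.mat_def)
      finally show ?thesis .
    qed
    thus ?thesis by (simp add: vec_ext)
  qed
  hence "det P * det M = det D * det P" by (metis det_mul)
  ultimately have "a i0 * det M = a i0 * (- 1)" by (simp add: P)
  hence "det M = - 1" using i0 by (simp only: mult_cancel_left) simp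
  thus ?thesis by (simp add: M_def)
qed

lemma pullback_Var: "pullback smul b T (Var i) = (\<Sum>j\<in>UNIV. Const (coord smul b (T (b j)) i) * Var j)"
  by (simp add: pullback_def)

lemma pullback_hom: "comm_ring_hom (pullback smul b T)"
  unfolding pullback_def by (rule mpoly_subst.comm_ring_hom_axioms)

lemma pullback_Const [simp]: "pullback smul b T (Const c) = Const c"
  by (simp add: pullback_def)

lemma eval0_pullback_Var: "eval0 (pullback smul b T (Var i)) = 0"
  unfolding pullback_Var by (simp add: eval0.hom_sum eval0.hom_mult)

context
  fixes smul :: "'k::field \<Rightarrow> 'v::ab_group_add \<Rightarrow> 'v" and b :: "'n::finite \<Rightarrow> 'v"
  assumes vs: "vector_space smul" and basis: "vs_basis smul b"
begin

interpretation vector_space smul by (rule vs)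

lemma basis_inj: "inj b" and basis_indep: "\<not> dependent (range b)" and basis_span: "span (range b) = UNIV"
  using basis by (simp_all add: vs_basis_def)

lemma coord_add: "coord smul b (v + w) i = coord smul b v i + coord smul b w i"
  unfolding coord_def using representation_add[OF basis_indep, of w v] by (simp add: basis_span)

lemma coord_scale: "coord smul b (smul c v) i = c * coord smul b v i"
  unfolding coord_def using representation_scale[OF basis_indep, of v c] by (simp add: basis_span)

lemma coord_zero: "coord smul b 0 i = 0"
  using coord_scale[of 0 0 i] by simp

lemma coord_sum: "coord smul b (sum v A) i = (\<Sum>j\<in>A. coord smul b (v j) i)"
  by (induction A rule: infinite_finite_induct) (simp_all add: coord_add coord_zero)

lemma coord_basis: "coord smul b (b j) i = (if i = j then 1 else 0)"
  unfolding coord_def using representation_basis[OF basis_indep, of "b j"] basis_inj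
  by (auto simp: inj_eq)

lemma coord_expand: "v = (\<Sum>i\<in>UNIV. smul (coord smul b v i) (b i))"
proof -
  have "v = (\<Sum>x\<in>range b. smul (representation (range b) v x) x)"
    using sum_representation_eq[OF basis_indep, of v "range b"] by (simp add: basis_span)
  thus ?thesis unfolding coord_def using basis_inj by (simp add: sum.reindex)
qed

lemma coord_linear:
  assumes "Vector_Spaces.linear smul smul T"
  shows "coord smul b (T v) i = (\<Sum>j\<in>UNIV. coord smul b v j * coord smul b (T (b j)) i)"
proof -
  interpret T: Vector_Spaces.linear smul smul T by (rule assms)
  have "T v = (\<Sum>j\<in>UNIV. smul (coord smul b v j) (T (b j)))"
    by (subst coord_expand[of v]) (simp only: T.sum T.scale)
  thus ?thesis by (simp add: coord_sum coord_scale)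
qed

lemma pullback_pullback_Var:
  assumes T: "Vector_Spaces.linear smul smul T"
  shows "pullback smul b S (pullback smul b T (Var i)) = pullback smul b (T \<circ> S) (Var i)"
proof -
  interpret S: comm_ring_hom "pullback smul b S" by (rule pullback_hom)
  have "pullback smul b S (pullback smul b T (Var i)) =
      (\<Sum>j\<in>UNIV. \<Sum>m\<in>UNIV. Const (coord smul b (T (b j)) i * coord smul b (S (b m)) j) * Var m)"
    unfolding pullback_Var S.hom_sum S.hom_mult pullback_Const
    by (simp add: sum_distrib_left Const.hom_mult mult.assoc)
  also have "\<dots> = (\<Sum>m\<in>UNIV. Const (\<Sum>j\<in>UNIV. coord smul b (T (b j)) i * coord smul b (S (b m)) j) * Var m)"
    by (subst sum.swap) (simp add: Const.hom_sum sum_distrib_right)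
  also have "\<dots> = pullback smul b (T \<circ> S) (Var i)"
    unfolding pullback_Var o_def coord_linear[OF T, of "S _"] by (simp add: mult.commute)
  finally show ?thesis .
qed

lemma pullback_id_Var:
  assumes "\<And>v. T v = v"
  shows "pullback smul b T (Var i) = Var i"
proof -
  have "(\<Sum>j\<in>UNIV. Const (coord smul b (T (b j)) i) * Var j) = (\<Sum>j\<in>UNIV. if i = j then Var j else 0)"
    by (intro sum.cong) (simp_all add: assms coord_basis)
  thus ?thesis by (simp add: pullback_Var)
qed

text \<open>The vector \<open>v\<close> spans the line on which \<open>T\<close> is \<open>- 1\<close>, and \<open>l x\<close> is the coefficient of \<open>v\<close>
  in \<open>x\<close> along the fixed hyperplane.\<close>

lemma reflection_decompose:
  assumes T: "Vector_Spaces.linear smul smul T" and refl: "simple_reflection smul T"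
  obtains v l where "v \<noteq> 0" "T v = - v" "\<And>x. T x = x - smul (2 * l x) v" "\<And>x. T (T x) = x"
proof -
  interpret T: Vector_Spaces.linear smul smul T by (rule T)
  obtain H v where H: "subspace H" and v: "v \<noteq> 0" and sp: "span (insert v H) = UNIV"
    and TH: "\<forall>x\<in>H. T x = x" and Tv: "T v = - v"
    using refl unfolding simple_reflection_def by (elim exE conjE)
  have spH: "span H = H" using H span_eq_iff by blast
  have "\<forall>x. \<exists>c. x - smul c v \<in> H"
  proof
    fix x
    have "x \<in> span (insert v H)" using sp by simp
    thus "\<exists>c. x - smul c v \<in> H" by (simp add: span_insert spH)
  qed
  from choice[OF this] obtain l where "\<forall>x. x - smul (l x) v \<in> H" by (rule exE)
  hence l: "x - smul (l x) v \<in> H" for x by (rule spec)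
  have Tx: "T x = x - smul (2 * l x) v" for x
  proof -
    have "T x = T (x - smul (l x) v) + smul (l x) (T v)" by (simp add: T.diff T.scale)
    also have "\<dots> = x - smul (l x) v - smul (l x) v" using TH l by (simp add: Tv)
    also have "\<dots> = x - smul (2 * l x) v"
      by (simp only: mult_2 scale_left_distrib diff_diff_eq)
    finally show ?thesis .
  qed
  have "T (T x) = x" for x
    by (subst Tx[of x]) (simp add: T.diff T.scale Tv Tx[of x])
  from that[OF v Tv Tx this] show ?thesis .
qed

lemma det_reflection:
  assumes T: "Vector_Spaces.linear smul smul T" and refl: "simple_reflection smul T" and two: "(2::'k) \<noteq> 0"
  shows "det (\<chi> i m. coord smul b (T (b m)) i) = - 1"
proof -
  obtain v l where v: "v \<noteq> 0" and Tv: "T v = - v" and Tx: "\<And>x. T x = x - smul (2 * l x) v"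
    and "\<And>x. T (T x) = x"
    by (rule reflection_decompose[OF T refl], rule that) assumption+
  define c where "c i = coord smul b v i" for i
  define a where "a m = l (b m)" for m
  have neg: "coord smul b (- x) i = - coord smul b x i" for x i
    using coord_scale[of "- 1" x i] by simp
  have M: "coord smul b (T (b m)) i = (if i = m then 1 else 0) - 2 * c i * a m" for i m
    unfolding Tx diff_conv_add_uminus coord_add neg coord_scale coord_basis by (simp add: c_def a_def)
  obtain i where i: "c i \<noteq> 0"
  proof (rule ccontr)
    assume "\<not> thesis"
    hence "c i = 0" for i using that by blast
    hence "v = 0" using coord_expand[of v] by (simp add: c_def)
    thus False using v by simp
  qed
  have "- c i = (\<Sum>m\<in>UNIV. c m * ((if i = m then 1 else 0) - 2 * c i * a m))"
    using coord_linear[OF T, of v i] unfolding Tv M neg by (simp add: c_def)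
  also have "\<dots> = c i - 2 * c i * (\<Sum>m\<in>UNIV. a m * c m)"
    by (simp add: right_diff_distrib sum_subtractf sum_distrib_left if_distrib[of "\<lambda>x. _ * x"] ac_simps cong: if_cong)
  finally have "2 * c i * (1 - (\<Sum>m\<in>UNIV. a m * c m)) = 0" by (simp add: algebra_simps)
  hence "(\<Sum>m\<in>UNIV. a m * c m) = 1" using i two by simp
  thus ?thesis unfolding M by (rule det_rank_one_reflection)
qed

text \<open>Pullbacks compose contravariantly, so \<open>g\<close> acts on the orbit of a coordinate by right translation
  of the group.\<close>

lemma Var_power_in_invariant_ideal:
  fixes f :: "'m::finite \<Rightarrow> ('n, 'k) mpoly" and G :: "('g, 'z) monoid_scheme"
  assumes grp: "group G" and fin: "finite (carrier G)" and act: "linear_action smul G \<rho>"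
    and gen: "polynomial_generators f (invariant_polys smul b G \<rho>)" and f0: "\<And>i. eval0 (f i) = 0"
  shows "Var j ^ card (carrier G) \<in> ideal_of f"
proof -
  interpret G: group G by (rule grp)
  interpret group_action G UNIV \<rho> using act by (simp add: linear_action_def)
  have lin: "Vector_Spaces.linear smul smul (\<rho> g)" if "g \<in> carrier G" for g
    using act that by (simp add: linear_action_def)
  show ?thesis
  proof (rule power_in_invariant_ideal[where h = "\<lambda>g. pullback smul b (\<rho> g)" and
        t = "\<lambda>g g'. g' \<otimes>\<^bsub>G\<^esub> g" and e = "\<one>\<^bsub>G\<^esub>" and \<epsilon> = eval0, OF fin])
    show "comm_ring_hom (pullback smul b (\<rho> g))" for g by (rule pullback_hom)
    show "bij_betw (\<lambda>g'. g' \<otimes>\<^bsub>G\<^esub> g) (carrier G) (carrier G)" if "g \<in> carrier G" for g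
      by (rule bij_betw_byWitness[where f' = "\<lambda>g'. g' \<otimes>\<^bsub>G\<^esub> inv\<^bsub>G\<^esub> g"])
        (use that in \<open>auto simp: G.m_assoc\<close>)
    show "pullback smul b (\<rho> g) (pullback smul b (\<rho> g') (Var j)) =
        pullback smul b (\<rho> (g' \<otimes>\<^bsub>G\<^esub> g)) (Var j)" if g: "g \<in> carrier G" "g' \<in> carrier G" for g g'
    proof -
      have "\<rho> g' \<circ> \<rho> g = \<rho> (g' \<otimes>\<^bsub>G\<^esub> g)"
        by (rule ext) (simp add: composition_rule[OF UNIV_I g(2,1)])
      thus ?thesis by (simp add: pullback_pullback_Var[OF lin[OF g(2)]])
    qed
    have "\<rho> \<one>\<^bsub>G\<^esub> v = v" for v
      using id_eq_one by (metis UNIV_I restrict_apply')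
    thus "pullback smul b (\<rho> \<one>\<^bsub>G\<^esub>) (Var j) = Var j" by (rule pullback_id_Var)
    show "eval0 (pullback smul b (\<rho> g) (Var j)) = 0" for g by (rule eval0_pullback_Var)
    show "p \<in> ideal_of f" if "\<And>g. g \<in> carrier G \<Longrightarrow> pullback smul b (\<rho> g) p = p" "eval0 p = 0" for p
      using that by (intro invariant_in_ideal[OF gen f0]) (simp_all add: invariant_polys_def)
  qed (auto intro: eval0.comm_ring_hom_axioms)
qed

text \<open>Applying the pullback to \<open>f = A x\<close> gives \<open>f = s(A) M x\<close>, where the matrix \<open>M\<close> of the
  reflection has determinant \<open>- 1\<close>. Independence of the determinant from the matrix finishes the
  argument.\<close>

lemma reflection_pullback:
  fixes f :: "'n \<Rightarrow> ('n, 'k) mpoly"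
  assumes char: "CHAR('k) \<noteq> 2"
    and T: "Vector_Spaces.linear smul smul T" and refl: "simple_reflection smul T"
    and Tf: "\<And>i. pullback smul b T (f i) = f i" and A: "\<And>i. apply_mat A Var i = f i"
  shows "pullback smul b T (pullback smul b T p) = p"
    and "pullback smul b T (det A) + det A \<in> ideal_of f"
proof -
  let ?s = "pullback smul b T"
  interpret s: comm_ring_hom ?s by (rule pullback_hom)
  obtain v l where "v \<noteq> 0" "T v = - v" "\<And>x. T x = x - smul (2 * l x) v" and TT: "\<And>x. T (T x) = x"
    by (rule reflection_decompose[OF T refl], rule that) assumption+
  show "?s (?s p) = p"
  proof (rule comm_ring_hom_poly_eqI[of "\<lambda>p. ?s (?s p)" "\<lambda>p. p"])
    show "comm_ring_hom (\<lambda>p. ?s (?s p))"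
      by unfold_locales (simp_all add: s.hom_add s.hom_mult)
    show "?s (?s (Poly_Mapping.single 0 c)) = Poly_Mapping.single 0 c" for c
      by (simp flip: Const_def)
    have "?s (?s (Var i)) = Var i" for i
      unfolding pullback_pullback_Var[OF T] by (rule pullback_id_Var) (simp add: TT)
    thus "?s (?s (Poly_Mapping.single (Poly_Mapping.single i 1) 1)) = Poly_Mapping.single (Poly_Mapping.single i 1) 1" for i
      by (simp add: Var_def)
  qed (rule id_hom)
  define M where "M = (\<chi> i m. coord smul b (T (b m)) i)"
  define MC :: "('n, 'k) mpoly ^ 'n ^ 'n" where "MC = (\<chi> i m. Const (vec_nth (vec_nth M i) m))"
  have "det MC = Const (- 1)"
    unfolding MC_def det_hom[OF Const_hom] M_def
    by (simp only: det_reflection[OF T refl two_neq_zero[OF char]])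
  hence dMC: "det MC = - 1" by (simp add: Const.hom_uminus)
  define sA where "sA = (\<chi> i j. ?s (vec_nth (vec_nth A i) j))"
  have "apply_mat (sA ** MC) Var i = f i" for i
  proof -
    have "apply_mat (sA ** MC) Var i =
        (\<Sum>m\<in>UNIV. \<Sum>j\<in>UNIV. ?s (vec_nth (vec_nth A i) j) * (vec_nth (vec_nth MC j) m * Var m))"
      by (simp add: matrix_matrix_mult_def sA_def sum_distrib_right mult.assoc)
    also have "\<dots> = (\<Sum>j\<in>UNIV. ?s (vec_nth (vec_nth A i) j) * ?s (Var j))"
      by (subst sum.swap) (simp add: sum_distrib_left pullback_Var MC_def M_def)
    also have "\<dots> = ?s (apply_mat A Var i)" by (simp add: s.hom_sum s.hom_mult)
    finally show ?thesis by (simp add: A Tf)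
  qed
  from det_independent_Var[OF char A this]
  have "- ?s (det A) - det A \<in> ideal_of f"
    by (simp add: det_mul dMC sA_def det_hom[OF pullback_hom])
  from ideal_of_uminus[OF this] show "?s (det A) + det A \<in> ideal_of f" by (simp add: add.commute)
qed

end

section \<open>The local algebra\<close>

lemma genideal_class_ring:
  fixes g :: "'i::finite \<Rightarrow> 'r::comm_ring_1"
  shows "Idl\<^bsub>class_ring\<^esub> (range g) = ideal_of g"
proof
  have R: "ring (class_ring :: 'r ring)" by (rule cring.axioms(1)[OF class_cring.is_cring])
  have "ideal (ideal_of g) (class_ring :: 'r ring)"
  proof (rule idealI[OF R])
    show "subgroup (ideal_of g) (add_monoid (class_ring :: 'r ring))"
    proof (rule group.subgroupI)
      show "Group.group (add_monoid (class_ring :: 'r ring))"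
        by (rule abelian_group.a_group[OF ring.is_abelian_group[OF R]])
      show "ideal_of g \<noteq> {}" using ideal_of_zero[of g] by blast
      fix a assume a: "a \<in> ideal_of g"
      have "inv\<^bsub>add_monoid (class_ring :: 'r ring)\<^esub> a = - a"
        using abelian_group.minus_equality[OF ring.is_abelian_group[OF R], of "- a" a] unfolding a_inv_def by (simp add: class_ring_simps)
      thus "inv\<^bsub>add_monoid (class_ring :: 'r ring)\<^esub> a \<in> ideal_of g" using ideal_of_uminus[OF a] by simp
    qed (simp_all add: ideal_of_add)
  qed (simp_all add: ideal_of_mult ideal_of_mult')
  thus "Idl\<^bsub>class_ring\<^esub> (range g) \<subseteq> ideal_of g"
    by (intro ring.genideal_minimal[OF R]) (auto intro: ideal_of_gen)
  interpret I: ideal "Idl\<^bsub>class_ring\<^esub> (range g)" "class_ring :: 'r ring"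
    by (rule ring.genideal_ideal[OF R]) simp
  have gen: "g i \<in> Idl\<^bsub>class_ring\<^esub> (range g)" for i
    using ring.genideal_self[OF R, of "range g"] by auto
  have "(\<Sum>i\<in>A. c i * g i) \<in> Idl\<^bsub>class_ring\<^esub> (range g)" for c A
  proof (induction A rule: infinite_finite_induct)
    case (insert i A)
    have "c i * g i \<in> Idl\<^bsub>class_ring\<^esub> (range g)" using I.I_l_closed[OF gen, of "c i" i] by simp
    from I.a_closed[OF this insert.IH] show ?case using insert(1,2) by simp
  qed (use I.zero_closed in simp_all)
  thus "ideal_of g \<subseteq> Idl\<^bsub>class_ring\<^esub> (range g)" unfolding ideal_of_def by blast
qed

lemma to_local_add: "to_local (p + q) = to_local p + to_local q"
  unfolding to_local_def
  by (subst plus_local_poly.abs_eq) (auto intro!: local_rel_eqI simp: eval0_one)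

lemma to_local_mult: "to_local (p * q) = to_local p * to_local q"
  unfolding to_local_def
  by (subst times_local_poly.abs_eq) (auto intro!: local_rel_eqI simp: eval0_one)

lemma to_local_hom: "comm_ring_hom (to_local :: ('n, 'k::field) mpoly \<Rightarrow> _)"
proof unfold_locales
  show "to_local (0 :: ('n, 'k) mpoly) = 0" by (simp add: to_local_def zero_local_poly_def)
  show "to_local (1 :: ('n, 'k) mpoly) = 1" by (simp add: to_local_def one_local_poly_def)
qed (rule to_local_add to_local_mult)+

interpretation to_local: comm_ring_hom to_local
  by (rule to_local_hom)

lemma to_local_eq_iff: "to_local p = to_local q \<longleftrightarrow> (\<exists>u. eval0 u \<noteq> 0 \<and> u * (p - q) = 0)"
proof -
  have r: "local_rel (x, 1) (x, 1)" for x :: "('a, 'b) mpoly"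
    by (rule local_rel_eqI) (simp_all add: eval0_one)
  have "to_local p = to_local q \<longleftrightarrow> local_rel (p, 1) (q, 1)"
    unfolding to_local_def using Quotient_rel[OF Quotient_local_poly, of "(p, 1)" "(q, 1)"] r by simp
  thus ?thesis by (simp add: local_rel_def eval0_one)
qed

lemma local_fraction:
  obtains p s where "eval0 s \<noteq> 0" "to_local s * x = to_local p"
proof -
  obtain p s where ps: "rep_local_poly x = (p, s)" by (cases "rep_local_poly x")
  have x: "local_rel (p, s) (p, s)" "x = abs_local_poly (p, s)"
    using Quotient_rep_reflp[OF Quotient_local_poly, of x] Quotient_abs_rep[OF Quotient_local_poly, of x]
    by (simp_all add: ps)
  hence s: "eval0 s \<noteq> 0" by (simp add: local_rel_def)
  have "to_local s * x = abs_local_poly (s * p, 1 * s)"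
    unfolding x(2) to_local_def using x(1)
    by (subst times_local_poly.abs_eq) (auto intro!: local_rel_eqI simp: eval0_one)
  also have "\<dots> = to_local p"
    unfolding to_local_def
    by (rule Quotient_rel_abs[OF Quotient_local_poly])
      (rule local_rel_eqI, use s in \<open>simp_all add: eval0_one eval0_mult mult.commute\<close>)
  finally show ?thesis using s that by blast
qed

lemma to_local_unit:
  assumes "eval0 s \<noteq> 0"
  obtains y where "y * to_local s = 1"
proof -
  have "abs_local_poly (1, s) * to_local s = abs_local_poly (1 * s, s * 1)"
    unfolding to_local_def using assms
    by (subst times_local_poly.abs_eq) (auto intro!: local_rel_eqI simp: eval0_one)
  also have "\<dots> = 1"
    unfolding one_local_poly_def
    by (simp, rule Quotient_rel_abs[OF Quotient_local_poly])
      (rule local_rel_eqI, use assms in \<open>simp_all add: eval0_one\<close>)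
  finally show ?thesis by (rule that)
qed

lemma local_ideal_eq: "local_ideal f = ideal_of (\<lambda>i. to_local (f i))"
  unfolding local_ideal_def by (rule genideal_class_ring)

lemma to_local_in_ideal: "p \<in> ideal_of f \<Longrightarrow> to_local p \<in> local_ideal f"
  unfolding local_ideal_eq
  by (elim ideal_ofE) (auto simp: to_local.hom_sum to_local.hom_mult intro!: ideal_of_sum ideal_of_mult ideal_of_gen)

lemma ideal_local_ideal: "ideal (local_ideal f) class_ring"
  unfolding local_ideal_def by (rule ring.genideal_ideal[OF cring.axioms(1)[OF class_cring.is_cring]]) simp

lemma coset_eq: "local_ideal f +>\<^bsub>class_ring\<^esub> x = (\<lambda>h. h + x) ` local_ideal f"
  by (auto simp: a_r_coset_def' )

lemma coset_eq_iff: "local_ideal f +>\<^bsub>class_ring\<^esub> x = local_ideal f +>\<^bsub>class_ring\<^esub> y \<longleftrightarrow> x - y \<in> local_ideal f"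
proof
  assume "local_ideal f +>\<^bsub>class_ring\<^esub> x = local_ideal f +>\<^bsub>class_ring\<^esub> y"
  moreover have "x \<in> local_ideal f +>\<^bsub>class_ring\<^esub> x"
    unfolding coset_eq by (rule image_eqI[of _ _ 0]) (simp_all add: local_ideal_eq)
  ultimately show "x - y \<in> local_ideal f" by (auto simp: coset_eq)
next
  assume xy: "x - y \<in> local_ideal f"
  have "h + x \<in> local_ideal f +>\<^bsub>class_ring\<^esub> y" if "h \<in> local_ideal f" for h
    unfolding coset_eq
    by (rule image_eqI[of _ _ "h + (x - y)"]) (use xy that in \<open>simp_all add: local_ideal_eq ideal_of_add\<close>)
  moreover have "h + y \<in> local_ideal f +>\<^bsub>class_ring\<^esub> x" if "h \<in> local_ideal f" for h
    unfolding coset_eq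
    by (rule image_eqI[of _ _ "h - (x - y)"]) (use xy that in \<open>simp_all add: local_ideal_eq ideal_of_diff\<close>)
  ultimately show "local_ideal f +>\<^bsub>class_ring\<^esub> x = local_ideal f +>\<^bsub>class_ring\<^esub> y"
    by (auto simp: coset_eq)
qed

lemma residue_hom: "(\<lambda>x. local_ideal f +>\<^bsub>class_ring\<^esub> x) \<in> Ring.ring_hom class_ring (class_ring Quot local_ideal f)"
  by (rule ideal.rcos_ring_hom[OF ideal_local_ideal])

lemma local_algebra_add: "residue f p \<oplus>\<^bsub>local_algebra f\<^esub> residue f q = residue f (p + q)"
  using ring_hom_add[OF residue_hom, of "to_local p" "to_local q"]
  by (simp add: residue_def local_algebra_def Let_def to_local_add)

lemma local_algebra_mult: "residue f p \<otimes>\<^bsub>local_algebra f\<^esub> residue f q = residue f (p * q)"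
  using ring_hom_mult[OF residue_hom, of "to_local p" "to_local q"]
  by (simp add: residue_def local_algebra_def Let_def to_local_mult)

lemma local_algebra_smult: "c \<odot>\<^bsub>local_algebra f\<^esub> residue f p = residue f (Const c * p)"
  using ring_hom_mult[OF residue_hom, of "to_local (Const c)" "to_local p"]
  by (simp add: residue_def local_algebra_def Let_def to_local_mult)

lemma local_algebra_zero: "\<zero>\<^bsub>local_algebra f\<^esub> = residue f 0"
proof -
  have "residue f 0 = local_ideal f" by (simp add: residue_def coset_eq to_local.hom_zero)
  thus ?thesis by (simp add: local_algebra_def Let_def FactRing_def)
qed

context
  fixes f :: "'n::finite \<Rightarrow> ('n, 'k::field) mpoly"
  assumes nil: "nil_mod f"
begin

lemma unit_cancel:
  assumes "eval0 u \<noteq> 0" "u * p \<in> ideal_of f"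
  shows "p \<in> ideal_of f"
proof -
  obtain w where w: "u * w - 1 \<in> ideal_of f" using unit_mod[OF nil assms(1)] by blast
  have "p = w * (u * p) - p * (u * w - 1)" by (simp add: algebra_simps)
  thus ?thesis using ideal_of_diff[OF ideal_of_mult[OF assms(2)] ideal_of_mult[OF w]] by metis
qed

text \<open>Clearing denominators in the local ring gives \<open>u p \<in> I\<close> with \<open>u\<close> a unit at the origin, and
  such a \<open>u\<close> is already a unit modulo \<open>I\<close>.\<close>

lemma to_local_in_ideal_iff: "to_local p \<in> local_ideal f \<longleftrightarrow> p \<in> ideal_of f"
proof
  assume "to_local p \<in> local_ideal f"
  then obtain c where c: "to_local p = (\<Sum>i\<in>UNIV. c i * to_local (f i))"
    unfolding local_ideal_eq by (rule ideal_ofE)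
  have "\<exists>u q. eval0 u \<noteq> 0 \<and> q \<in> ideal_of f \<and> to_local u * (\<Sum>i\<in>A. c i * to_local (f i)) = to_local q" for A
  proof (induction A rule: infinite_finite_induct)
    case (insert i A)
    then obtain u q where u: "eval0 u \<noteq> 0" "q \<in> ideal_of f"
      "to_local u * (\<Sum>i\<in>A. c i * to_local (f i)) = to_local q" by (elim exE conjE)
    obtain r s where s: "eval0 s \<noteq> 0" "to_local s * c i = to_local r" by (rule local_fraction)
    have "to_local (s * u) * (\<Sum>i\<in>insert i A. c i * to_local (f i)) =
        to_local u * (to_local s * c i) * to_local (f i) + to_local s * (to_local u * (\<Sum>i\<in>A. c i * to_local (f i)))"
      using insert(1,2) by (simp add: to_local.hom_mult algebra_simps)
    also have "\<dots> = to_local (u * r * f i + s * q)"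
      unfolding s(2) u(3) by (simp add: to_local.hom_mult to_local.hom_add)
    finally have "to_local (s * u) * (\<Sum>i\<in>insert i A. c i * to_local (f i)) = to_local (u * r * f i + s * q)" .
    moreover have "u * r * f i + s * q \<in> ideal_of f"
      by (intro ideal_of_add ideal_of_mult u(2) ideal_of_gen)
    moreover have "eval0 (s * u) \<noteq> 0" using u(1) s(1) by (simp add: eval0_mult)
    ultimately show ?case by (intro exI conjI)
  qed (rule exI[of _ 1], rule exI[of _ 0], simp add: eval0_one)+
  then obtain u q where u: "eval0 u \<noteq> 0" "q \<in> ideal_of f" "to_local u * to_local p = to_local q"
    unfolding c by blast
  then obtain v where v: "eval0 v \<noteq> 0" "v * (u * p - q) = 0"
    using to_local_eq_iff[of "u * p" q] by (auto simp: to_local.hom_mult)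
  hence "v * u * p = v * q" by (simp add: algebra_simps)
  hence "v * u * p \<in> ideal_of f" using ideal_of_mult[OF u(2)] by simp
  thus "p \<in> ideal_of f" by (rule unit_cancel[rotated]) (use u v in \<open>simp add: eval0_mult\<close>)
qed (rule to_local_in_ideal)

lemma residue_eq_iff: "residue f p = residue f q \<longleftrightarrow> p - q \<in> ideal_of f"
  unfolding residue_def coset_eq_iff
  by (simp add: to_local_in_ideal_iff flip: to_local.hom_minus)

text \<open>A fraction \<open>p / s\<close> has the residue class of the polynomial \<open>p t\<close>, where \<open>t\<close> inverts \<open>s\<close>
  modulo \<open>I\<close>.\<close>

lemma local_algebra_carrier: "carrier (local_algebra f) = range (residue f)"
proof -
  have "carrier (local_algebra f) = range (\<lambda>x. local_ideal f +>\<^bsub>class_ring\<^esub> x)"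
    by (auto simp: local_algebra_def Let_def FactRing_def A_RCOSETS_def')
  moreover have ex: "\<exists>p. local_ideal f +>\<^bsub>class_ring\<^esub> x = residue f p" for x
  proof -
    obtain p s where s: "eval0 s \<noteq> 0" "to_local s * x = to_local p" by (rule local_fraction)
    obtain y where y: "y * to_local s = 1" using to_local_unit[OF s(1)] by blast
    obtain t where t: "s * t - 1 \<in> ideal_of f" using unit_mod[OF nil s(1)] by blast
    have "x - to_local (p * t) = y * (to_local s * x) - y * to_local s * to_local (p * t)"
      using y by (simp flip: mult.assoc)
    also have "\<dots> = y * to_local (- (p * (s * t - 1)))"
      unfolding s(2) by (simp add: to_local.hom_minus to_local.hom_uminus to_local.hom_mult algebra_simps)
    also have "\<dots> \<in> local_ideal f"
      unfolding local_ideal_eq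
      by (rule ideal_of_mult)
        (use to_local_in_ideal[OF ideal_of_uminus[OF ideal_of_mult[OF t, of p]]] in \<open>simp add: local_ideal_eq\<close>)
    finally show ?thesis unfolding residue_def coset_eq_iff by blast
  qed
  have "range (\<lambda>x. local_ideal f +>\<^bsub>class_ring\<^esub> x) = range (residue f)"
  proof (intro equalityI image_subsetI)
    show "local_ideal f +>\<^bsub>class_ring\<^esub> x \<in> range (residue f)" for x
      using ex[of x] by auto
    show "residue f p \<in> range (\<lambda>x. local_ideal f +>\<^bsub>class_ring\<^esub> x)" for p
      unfolding residue_def by (rule rangeI)
  qed
  ultimately show ?thesis by simp
qed

lemma local_algebra_vectorspace: "vectorspace class_ring (local_algebra f)"
proof -
  have ag: "abelian_group (local_algebra f)"
  proof (rule abelian_groupI)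
    fix x assume "x \<in> carrier (local_algebra f)"
    then obtain p where "x = residue f p" by (auto simp: local_algebra_carrier)
    thus "\<exists>y\<in>carrier (local_algebra f). y \<oplus>\<^bsub>local_algebra f\<^esub> x = \<zero>\<^bsub>local_algebra f\<^esub>"
      by (intro bexI[of _ "residue f (- p)"])
        (simp_all add: local_algebra_carrier local_algebra_add local_algebra_zero)
  qed (auto simp: local_algebra_carrier local_algebra_add local_algebra_zero ac_simps)
  have "Module.module class_ring (local_algebra f)"
    by (rule Module.module.intro[OF class_cring.is_cring ag])
      (unfold_locales, auto simp: local_algebra_carrier local_algebra_add local_algebra_smult
        Const.hom_add Const.hom_mult Const.hom_one algebra_simps)
  moreover have "field (class_ring :: 'k ring)" by (rule class_field.field_axioms)
  ultimately show ?thesis unfolding vectorspace_def by blast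
qed

end

section \<open>Classes in the Grothendieck--Witt ring\<close>

lemma linear_mapI:
  assumes "vectorspace class_ring V" "vectorspace class_ring W"
    and "\<And>x. x \<in> carrier V \<Longrightarrow> T x \<in> carrier W"
    and "\<And>x y. x \<in> carrier V \<Longrightarrow> y \<in> carrier V \<Longrightarrow> T (x \<oplus>\<^bsub>V\<^esub> y) = T x \<oplus>\<^bsub>W\<^esub> T y"
    and "\<And>c x. x \<in> carrier V \<Longrightarrow> T (c \<odot>\<^bsub>V\<^esub> x) = c \<odot>\<^bsub>W\<^esub> T x"
  shows "linear_map (class_ring :: 'k::field ring) V W T"
  using assms unfolding linear_map_def mod_hom_def mod_hom_axioms_def vectorspace_def
  by (auto simp: LinearCombinations.module_hom_def)

lemma linear_mapD:
  assumes "linear_map (class_ring :: 'k::field ring) V W T"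
  shows "vectorspace class_ring V" "vectorspace class_ring W"
    and "x \<in> carrier V \<Longrightarrow> T x \<in> carrier W"
    and "x \<in> carrier V \<Longrightarrow> y \<in> carrier V \<Longrightarrow> T (x \<oplus>\<^bsub>V\<^esub> y) = T x \<oplus>\<^bsub>W\<^esub> T y"
    and "x \<in> carrier V \<Longrightarrow> T (c \<odot>\<^bsub>V\<^esub> x) = c \<odot>\<^bsub>W\<^esub> T x"
  using assms unfolding linear_map_def mod_hom_def mod_hom_axioms_def
  by (auto simp: LinearCombinations.module_hom_def)

lemma vectorspace_add_closed:
  assumes "vectorspace (class_ring :: 'k::field ring) V" "x \<in> carrier V" "y \<in> carrier V"
  shows "x \<oplus>\<^bsub>V\<^esub> y \<in> carrier V"
proof -
  interpret vectorspace class_ring V by (rule assms(1))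
  show ?thesis using assms(2,3) by simp
qed

lemma vectorspace_smult_closed:
  assumes "vectorspace (class_ring :: 'k::field ring) V" "x \<in> carrier V"
  shows "c \<odot>\<^bsub>V\<^esub> x \<in> carrier V"
proof -
  interpret vectorspace class_ring V by (rule assms(1))
  show ?thesis using assms(2) by (intro smult_closed) simp_all
qed

lemma isometric_sym:
  assumes "isometric V \<beta> W \<gamma>"
  shows "isometric W \<gamma> V \<beta>"
proof -
  obtain T where T: "linear_map class_ring V W T" and bij: "bij_betw T (carrier V) (carrier W)"
    and iso: "\<forall>x\<in>carrier V. \<forall>y\<in>carrier V. \<gamma> (T x) (T y) = \<beta> x y"
    using assms unfolding isometric_def by (elim exE conjE)
  define S where "S = inv_into (carrier V) T"
  have S: "bij_betw S (carrier W) (carrier V)" unfolding S_def by (rule bij_betw_inv_into[OF bij])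
  have Sc: "S y \<in> carrier V" if "y \<in> carrier W" for y using S that by (auto simp: bij_betw_def)
  have TS: "T (S y) = y" if "y \<in> carrier W" for y
    unfolding S_def using bij that by (simp add: bij_betw_inv_into_right)
  have ST: "S (T x) = x" if "x \<in> carrier V" for x
    unfolding S_def using bij that by (simp add: bij_betw_inv_into_left)
  note TD = linear_mapD[OF T]
  have "linear_map class_ring W V S"
  proof (rule linear_mapI[OF TD(2,1) Sc])
    fix x y assume xy: "x \<in> carrier W" "y \<in> carrier W"
    have "S (T (S x \<oplus>\<^bsub>V\<^esub> S y)) = S x \<oplus>\<^bsub>V\<^esub> S y"
      by (intro ST vectorspace_add_closed[OF TD(1)] Sc xy)
    thus "S (x \<oplus>\<^bsub>W\<^esub> y) = S x \<oplus>\<^bsub>V\<^esub> S y"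
      using xy by (simp add: TD(4) Sc TS)
  next
    fix c x assume x: "x \<in> carrier W"
    have "S (T (c \<odot>\<^bsub>V\<^esub> S x)) = c \<odot>\<^bsub>V\<^esub> S x"
      by (intro ST vectorspace_smult_closed[OF TD(1)] Sc x)
    thus "S (c \<odot>\<^bsub>W\<^esub> x) = c \<odot>\<^bsub>V\<^esub> S x"
      using x by (simp add: TD(5) Sc TS)
  qed
  moreover have "\<forall>x\<in>carrier W. \<forall>y\<in>carrier W. \<beta> (S x) (S y) = \<gamma> x y"
  proof (intro ballI)
    fix x y assume "x \<in> carrier W" "y \<in> carrier W"
    thus "\<beta> (S x) (S y) = \<gamma> x y" using bspec[OF bspec[OF iso Sc] Sc, of x y] by (simp add: TS)
  qed
  ultimately show ?thesis unfolding isometric_def using S by blast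
qed

lemma isometric_trans:
  assumes "isometric V \<beta> W \<gamma>" "isometric W \<gamma> U \<delta>"
  shows "isometric V \<beta> U \<delta>"
proof -
  obtain T where T: "linear_map class_ring V W T" "bij_betw T (carrier V) (carrier W)"
    "\<forall>x\<in>carrier V. \<forall>y\<in>carrier V. \<gamma> (T x) (T y) = \<beta> x y"
    using assms(1) unfolding isometric_def by (elim exE conjE)
  obtain S where S: "linear_map class_ring W U S" "bij_betw S (carrier W) (carrier U)"
    "\<forall>x\<in>carrier W. \<forall>y\<in>carrier W. \<delta> (S x) (S y) = \<gamma> x y"
    using assms(2) unfolding isometric_def by (elim exE conjE)
  note TD = linear_mapD[OF T(1)] and SD = linear_mapD[OF S(1)]
  have "linear_map class_ring V U (S \<circ> T)"
    by (rule linear_mapI[OF TD(1) SD(2)]) (simp_all add: TD(3-5) SD(3-5))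
  moreover have "bij_betw (S \<circ> T) (carrier V) (carrier U)" by (rule bij_betw_trans[OF T(2) S(2)])
  moreover have "\<forall>x\<in>carrier V. \<forall>y\<in>carrier V. \<delta> ((S \<circ> T) x) ((S \<circ> T) y) = \<beta> x y"
    using T(3) S(3) TD(3) by simp
  ultimately show ?thesis unfolding isometric_def by blast
qed

text \<open>Two coordinate models of the same form are isometric to each other, so the description in the
  definition of the class picks out a single element.\<close>

lemma gw_class_eqI:
  assumes A: "gram_mat A" and iso: "isometric V \<beta> (coord_space (dim_row A)) (mat_form A)"
  shows "gw_class V \<beta> = gw_of (abs_form_class A)"
  unfolding gw_class_def
proof (rule the_equality)
  show "\<exists>A'. gram_mat A' \<and> isometric V \<beta> (coord_space (dim_row A')) (mat_form A') \<and>
      gw_of (abs_form_class A) = gw_of (abs_form_class A')" using A iso by blast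
  fix d assume "\<exists>A'. gram_mat A' \<and> isometric V \<beta> (coord_space (dim_row A')) (mat_form A') \<and>
      d = gw_of (abs_form_class A')"
  then obtain B where B: "gram_mat B" "isometric V \<beta> (coord_space (dim_row B)) (mat_form B)"
    "d = gw_of (abs_form_class B)" by (elim exE conjE)
  have "isometric (coord_space (dim_row B)) (mat_form B) (coord_space (dim_row A)) (mat_form A)"
    by (rule isometric_trans[OF isometric_sym[OF B(2)] iso])
  hence "iso_gram B A" using A B(1) by (simp add: iso_gram_def)
  hence "abs_form_class B = abs_form_class A" by (rule Quotient_rel_abs[OF Quotient_form_class])
  thus "d = gw_of (abs_form_class A)" using B(3) by simp
qed

text \<open>Alternating signs make one more hyperbolic plane correspond to two more rows, so the class is
  computed by induction.\<close>

definition alt_diag :: "nat \<Rightarrow> 'k::field mat" where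
  "alt_diag d = mat d d (\<lambda>(i, j). if i = j then (- 1) ^ i else 0)"

lemma alt_diag_carrier [simp]: "alt_diag d \<in> carrier_mat d d"
  by (simp add: alt_diag_def)

lemma alt_diag_dim [simp]: "dim_row (alt_diag d) = d" "dim_col (alt_diag d) = d"
  by (simp_all add: alt_diag_def)

lemma gram_mat_alt_diag: "gram_mat (alt_diag d :: 'k::field mat)"
proof -
  have "alt_diag d * alt_diag d = (1\<^sub>m d :: 'k mat)"
  proof (rule eq_matI)
    fix i j assume "i < dim_row (1\<^sub>m d :: 'k mat)" "j < dim_col (1\<^sub>m d :: 'k mat)"
    hence ij: "i < d" "j < d" by auto
    have "(alt_diag d * alt_diag d) $$ (i, j) =
        (\<Sum>k\<in>{0..<d}. (if i = k then (- 1) ^ i else 0) * (if k = j then (- 1) ^ k else (0::'k)))"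
      using ij by (simp add: alt_diag_def scalar_prod_def)
    also have "\<dots> = (\<Sum>k\<in>{0..<d}. if k = i then (if i = j then 1 else 0) else 0)"
      by (rule sum.cong) (auto simp flip: power_add mult_2)
    finally show "(alt_diag d * alt_diag d) $$ (i, j) = (1\<^sub>m d :: 'k mat) $$ (i, j)" using ij by simp
  qed simp_all
  moreover have "(alt_diag d)\<^sup>T = (alt_diag d :: 'k mat)"
    by (rule eq_matI) (auto simp: alt_diag_def)
  moreover have "square_mat (alt_diag d :: 'k mat)" "dim_row (alt_diag d :: 'k mat) = d"
    by (simp_all add: alt_diag_def)
  ultimately show ?thesis unfolding gram_mat_iff by (metis alt_diag_carrier)
qed

lemma mat_form_alt_diag:
  assumes "x \<in> carrier_vec d" "y \<in> carrier_vec d"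
  shows "mat_form (alt_diag d) x y = (\<Sum>i<d. (- 1) ^ i * (x $ i * y $ i))"
proof -
  have "(alt_diag d *\<^sub>v y) $ i = (- 1) ^ i * y $ i" if "i < d" for i
  proof -
    have "(alt_diag d *\<^sub>v y) $ i = (\<Sum>j\<in>{0..<d}. (if i = j then (- 1) ^ i else 0) * y $ j)"
      using that assms(2) by (simp add: alt_diag_def scalar_prod_def)
    also have "\<dots> = (\<Sum>j\<in>{0..<d}. if j = i then (- 1) ^ i * y $ i else 0)"
      by (rule sum.cong) auto
    finally show ?thesis using that by simp
  qed
  thus ?thesis using assms
    by (simp add: mat_form_def scalar_prod_def alt_diag_def lessThan_atLeast0 ac_simps)
qed

lemma gw_of_add: "gw_of (a + b) = gw_of a + gw_of b"
  unfolding gw_of_def by (simp add: plus_gw.abs_eq)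

lemma gw_of_zero: "gw_of 0 = 0"
  by (simp add: gw_of_def zero_gw_def)

lemma gram_mat_unit: "u \<noteq> 0 \<Longrightarrow> gram_mat (mat 1 1 (\<lambda>_. u))"
proof -
  assume u: "u \<noteq> 0"
  have "mat 1 1 (\<lambda>_. u) * mat 1 1 (\<lambda>_. 1 / u) = 1\<^sub>m 1"
    by (rule eq_matI) (use u in \<open>auto simp: scalar_prod_def\<close>)
  moreover have "(mat 1 1 (\<lambda>_. u))\<^sup>T = mat 1 1 (\<lambda>_. u)" by (rule eq_matI) auto
  ultimately show ?thesis unfolding gram_mat_iff by (auto intro!: bexI[of _ "mat 1 1 (\<lambda>_. 1 / u)"])
qed

lemma gw_unit_eq:
  assumes "u \<noteq> 0"
  shows "gw_unit u = gw_of (abs_form_class (mat 1 1 (\<lambda>_. u)))"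
  unfolding gw_unit_def
proof (rule gw_class_eqI[OF gram_mat_unit[OF assms]])
  let ?T = "\<lambda>x::'a. vec 1 (\<lambda>_. x)"
  have "linear_map class_ring self_module (coord_space 1) ?T"
    by (rule linear_mapI[OF self_vs vec_vs]) (auto simp: module_vec_simps intro!: eq_vecI)
  moreover have "bij_betw ?T UNIV (carrier_vec 1)"
    by (rule bij_betw_byWitness[where f' = "\<lambda>v. v $ 0"]) (auto intro!: eq_vecI)
  moreover have "mat_form (mat 1 1 (\<lambda>_. u)) (?T x) (?T y) = u * x * y" for x y
    by (simp add: mat_form_def scalar_prod_def)
  ultimately show "isometric self_module (\<lambda>x y. u * x * y)
      (coord_space (dim_row (mat 1 1 (\<lambda>_. u)))) (mat_form (mat 1 1 (\<lambda>_. u)))"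
    unfolding isometric_def by (intro exI[of _ ?T]) (simp add: module_vec_simps)
qed

lemma abs_form_class_dsum:
  assumes "gram_mat A" "gram_mat B"
  shows "abs_form_class (dsum_mat A B) = abs_form_class A + abs_form_class B"
  using plus_form_class.abs_eq[OF iso_gram_refl[OF assms(1)] iso_gram_refl[OF assms(2)]] by simp

lemma gw_of_alt_diag_Suc:
  "gw_of (abs_form_class (alt_diag (Suc d) :: 'k::field mat)) =
     gw_of (abs_form_class (alt_diag d)) + gw_unit ((- 1) ^ d)"
proof -
  have "alt_diag (Suc d) = (dsum_mat (alt_diag d) (mat 1 1 (\<lambda>_. (- 1) ^ d)) :: 'k mat)"
    by (rule eq_matI) (auto simp: alt_diag_def dsum_mat_def less_Suc_eq)
  thus ?thesis
    by (simp add: abs_form_class_dsum gram_mat_alt_diag gram_mat_unit gw_of_add gw_unit_eq del: One_nat_def)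
qed

lemma gw_of_alt_diag_even:
  "gw_of (abs_form_class (alt_diag (2 * k) :: 'k::field mat)) = of_nat k * (gw_unit 1 + gw_unit (- 1))"
proof (induction k)
  case 0
  have "alt_diag 0 = (0\<^sub>m 0 0 :: 'k mat)" by (rule eq_matI) (auto simp: alt_diag_def)
  thus ?case by (simp add: gw_of_zero flip: zero_form_class_def)
next
  case (Suc k)
  have "alt_diag (2 * Suc k) = (alt_diag (Suc (Suc (2 * k))) :: 'k mat)" by simp
  thus ?case using Suc.IH by (simp add: gw_of_alt_diag_Suc algebra_simps)
qed

section \<open>The EKL-degree\<close>

definition interleave :: "(nat \<Rightarrow> 'a) \<Rightarrow> (nat \<Rightarrow> 'a) \<Rightarrow> nat \<Rightarrow> 'a" where
  "interleave p q i = (if even i then p (i div 2) else q (i div 2))"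

lemma sum_pairs: "(\<Sum>i<2 * k. g i) = (\<Sum>i<k. g (2 * i) + g (2 * i + 1))" for g :: "nat \<Rightarrow> 'a::comm_monoid_add"
  by (induction k) (simp_all add: ac_simps)

lemma hyperbolic_basis_interleave:
  assumes "hyperbolic_basis f l k p q"
  defines "e \<equiv> interleave p q"
  shows "i < 2 * k \<Longrightarrow> j < 2 * k \<Longrightarrow> l (e i * e j) = (if i = j then (- 1) ^ i else 0)"
    and "r - (\<Sum>i<2 * k. Const ((- 1) ^ i * l (r * e i)) * e i) \<in> ideal_of f"
proof -
  have pp: "l (p i * p j) = (if i = j then 1 else 0)" and qq: "l (q i * q j) = (if i = j then - 1 else 0)"
    and pq: "l (p i * q j) = 0" if "i < k" "j < k" for i j
    using assms(1) that unfolding hyperbolic_basis_def by blast+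
  show "l (e i * e j) = (if i = j then (- 1) ^ i else 0)" if ij: "i < 2 * k" "j < 2 * k"
  proof -
    have d: "i div 2 < k" "j div 2 < k" using ij by auto
    have eq: "i = j \<longleftrightarrow> i div 2 = j div 2 \<and> (even i \<longleftrightarrow> even j)"
      by (metis even_two_times_div_two odd_two_times_div_two_succ)
    show ?thesis
      using pp[OF d] qq[OF d] pq[OF d] pq[OF d(2,1)] eq
      unfolding e_def interleave_def by (auto simp: mult.commute)
  qed
  have "(\<Sum>i<2 * k. Const ((- 1) ^ i * l (r * e i)) * e i) =
      (\<Sum>i<k. Const (l (r * p i)) * p i - Const (l (r * q i)) * q i)"
    unfolding sum_pairs by (simp add: e_def interleave_def Const.hom_uminus)
  thus "r - (\<Sum>i<2 * k. Const ((- 1) ^ i * l (r * e i)) * e i) \<in> ideal_of f"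
    using assms(1) unfolding hyperbolic_basis_def by simp
qed

text \<open>Interleaving the vectors of positive and negative length gives a coordinate isomorphism under which
  the form has matrix \<open>alt_diag (2 * k)\<close>.\<close>

lemma gw_class_of_hyperbolic_basis:
  fixes f :: "'n::finite \<Rightarrow> ('n, 'k::field) mpoly"
  assumes nil: "nil_mod f" and l: "functional l" "\<And>p. p \<in> ideal_of f \<Longrightarrow> l p = 0"
    and basis: "hyperbolic_basis f l k p q"
    and \<beta>: "\<And>p q. \<beta> (residue f p) (residue f q) = l (p * q)"
  shows "local_degree f = 2 * k"
    and "gw_class (local_algebra f) \<beta> = of_nat k * (gw_unit 1 + gw_unit (- 1))"
proof -
  define e where "e = interleave p q"
  define d where "d = 2 * k"
  note orth = hyperbolic_basis_interleave(1)[OF basis, folded e_def d_def]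
    and expand = hyperbolic_basis_interleave(2)[OF basis, folded e_def d_def]
  note laws = local_algebra_add local_algebra_smult
  have sg: "(- 1) ^ i * (- 1) ^ i = (1::'k)" for i by (simp flip: power_add mult_2)
  define S where "S y = residue f (\<Sum>i<d. Const (y $ i) * e i)" for y
  have coords: "l ((\<Sum>i<d. Const (y $ i) * e i) * e j) = (- 1) ^ j * y $ j" if "j < d" for y j
  proof -
    have "l ((\<Sum>i<d. Const (y $ i) * e i) * e j) = (\<Sum>i<d. y $ i * l (e i * e j))"
      by (simp add: sum_distrib_right functional_sum[OF l(1)] mult.assoc functional_scale[OF l(1)])
    also have "\<dots> = (\<Sum>i<d. if i = j then (- 1) ^ j * y $ j else 0)"
      by (rule sum.cong) (use that in \<open>auto simp: orth\<close>)
    finally show ?thesis using that by simp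
  qed
  have lin: "linear_map class_ring (coord_space d) (local_algebra f) S"
  proof (rule linear_mapI[OF vec_vs local_algebra_vectorspace[OF nil]])
    fix x y :: "'k vec" and c
    show "S x \<in> carrier (local_algebra f)" by (simp add: S_def local_algebra_carrier[OF nil])
    assume x: "x \<in> carrier (coord_space d)"
    show "S (c \<odot>\<^bsub>coord_space d\<^esub> x) = c \<odot>\<^bsub>local_algebra f\<^esub> S x"
      using x unfolding S_def laws sum_distrib_left
      by (intro arg_cong[of _ _ "residue f"] sum.cong)
        (simp_all add: module_vec_simps Const.hom_mult mult.assoc)
    assume y: "y \<in> carrier (coord_space d)"
    show "S (x \<oplus>\<^bsub>coord_space d\<^esub> y) = S x \<oplus>\<^bsub>local_algebra f\<^esub> S y"
      using x y unfolding S_def laws sum.distrib[symmetric]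
      by (intro arg_cong[of _ _ "residue f"] sum.cong)
        (simp_all add: module_vec_simps Const.hom_add distrib_right)
  qed
  have inj: "inj_on S (carrier_vec d)"
  proof (rule inj_onI)
    fix x y :: "'k vec" assume xy: "x \<in> carrier_vec d" "y \<in> carrier_vec d" "S x = S y"
    show "x = y"
    proof (rule eq_vecI)
      fix j assume "j < dim_vec y"
      hence j: "j < d" using xy by simp
      have "(\<Sum>i<d. Const (x $ i) * e i) - (\<Sum>i<d. Const (y $ i) * e i) \<in> ideal_of f"
        using xy(3) by (simp add: S_def residue_eq_iff[OF nil])
      hence "((\<Sum>i<d. Const (x $ i) * e i) - (\<Sum>i<d. Const (y $ i) * e i)) * e j \<in> ideal_of f"
        by (rule ideal_of_mult')
      from l(2)[OF this] have "(- 1) ^ j * x $ j = (- 1) ^ j * y $ j"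
        by (simp add: left_diff_distrib functional_diff[OF l(1)] coords[OF j])
      thus "x $ j = y $ j" by simp
    qed (use xy in simp)
  qed
  have surj: "S ` carrier_vec d = carrier (local_algebra f)"
  proof
    show "carrier (local_algebra f) \<subseteq> S ` carrier_vec d"
    proof
      fix X assume "X \<in> carrier (local_algebra f)"
      then obtain r where X: "X = residue f r" using local_algebra_carrier[OF nil] by auto
      define y where "y = vec d (\<lambda>i. (- 1) ^ i * l (r * e i))"
      have "(\<Sum>i<d. Const (y $ i) * e i) = (\<Sum>i<d. Const ((- 1) ^ i * l (r * e i)) * e i)"
        by (rule sum.cong) (simp_all add: y_def)
      hence "X = S y" unfolding X S_def residue_eq_iff[OF nil] using expand[of r] by simp
      thus "X \<in> S ` carrier_vec d" by (auto simp: y_def)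
    qed
  qed (auto simp: S_def local_algebra_carrier[OF nil])
  have form: "\<beta> (S x) (S y) = mat_form (alt_diag d) x y" if "x \<in> carrier_vec d" "y \<in> carrier_vec d" for x y
  proof -
    have "\<beta> (S x) (S y) = l ((\<Sum>j<d. Const (y $ j) * e j) * (\<Sum>i<d. Const (x $ i) * e i))"
      by (simp add: S_def \<beta> mult.commute)
    also have "\<dots> = (\<Sum>i<d. x $ i * l ((\<Sum>j<d. Const (y $ j) * e j) * e i))"
      by (simp add: sum_distrib_left[of "\<Sum>j<d. Const (y $ j) * e j"] functional_sum[OF l(1)]
          mult.left_commute[of "\<Sum>j<d. Const (y $ j) * e j"] functional_scale[OF l(1)])
    also have "\<dots> = mat_form (alt_diag d) x y"
      unfolding mat_form_alt_diag[OF that] by (rule sum.cong[OF refl], subst coords) (simp_all add: mult.left_commute)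
    finally show ?thesis .
  qed
  have "isometric (coord_space d) (mat_form (alt_diag d)) (local_algebra f) \<beta>"
    unfolding isometric_def using lin inj surj form
    by (intro exI[of _ S]) (simp add: bij_betw_def module_vec_simps)
  from gw_class_eqI[OF gram_mat_alt_diag, of "local_algebra f" \<beta> d] isometric_sym[OF this]
  have "gw_class (local_algebra f) \<beta> = gw_of (abs_form_class (alt_diag d))"
    by (simp add: alt_diag_def)
  thus "gw_class (local_algebra f) \<beta> = of_nat k * (gw_unit 1 + gw_unit (- 1))"
    by (simp add: d_def gw_of_alt_diag_even)
  have "vectorspace.dim class_ring (coord_space d :: ('k, 'k vec) module) = vectorspace.dim class_ring (local_algebra f)"
    using linear_map.dim_eq[OF lin] inj surj vec_space.fin_dim[of d, where 'a = 'k]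
    by (simp add: module_vec_simps)
  thus "local_degree f = 2 * k"
    unfolding local_degree_def using vec_space.dim_is_n[of d, where 'a = 'k] by (simp add: d_def)
qed

lemma degree_and_class_of_functional:
  fixes f :: "'n::finite \<Rightarrow> ('n, 'k::field) mpoly"
  assumes char: "CHAR('k) \<noteq> 2" and pow: "\<And>j. Var j ^ N \<in> ideal_of f"
    and A: "\<And>i. apply_mat A Var i = f i"
    and s: "comm_ring_hom s" "\<And>p. s (s p) = p" "\<And>c. s (Const c) = Const c" "\<And>i. s (f i) = f i"
      "s (det A) + det A \<in> ideal_of f"
    and \<phi>: "linear_map class_ring (local_algebra f) self_module \<phi>" "\<phi> (residue f (det A)) = 1"
  shows "even (local_degree f)"
    and "gw_class (local_algebra f) (\<lambda>a b. \<phi> (a \<otimes>\<^bsub>local_algebra f\<^esub> b)) =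
      of_nat (local_degree f div 2) * (gw_unit 1 + gw_unit (- 1))"
proof -
  have nil: "nil_mod f" by (rule nil_modI[OF pow])
  define l where "l p = \<phi> (residue f p)" for p
  have car: "residue f p \<in> carrier (local_algebra f)" for p by (simp add: local_algebra_carrier[OF nil])
  have l: "functional l"
    unfolding functional_def
  proof (intro conjI allI)
    fix p q c
    show "l (p + q) = l p + l q"
      using linear_mapD(4)[OF \<phi>(1) car car, of p q] by (simp add: l_def local_algebra_add)
    show "l (Const c * p) = c * l p"
      using linear_mapD(5)[OF \<phi>(1) car, of c p] by (simp add: l_def local_algebra_smult)
  qed
  have l0: "l p = 0" if "p \<in> ideal_of f" for p
  proof -
    have "residue f p = residue f 0" using that by (simp add: residue_eq_iff[OF nil])
    hence "l p = l 0" by (simp add: l_def)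
    thus ?thesis by (simp add: functional_zero[OF l])
  qed
  have l1: "l (det A) = 1" by (simp add: l_def \<phi>(2))
  obtain k p q where basis: "hyperbolic_basis f l k p q"
    by (rule hyperbolic_basis_exists[where s = s and l = l, OF char pow A s l l0 l1])
  have \<beta>: "\<phi> (residue f p \<otimes>\<^bsub>local_algebra f\<^esub> residue f q) = l (p * q)" for p q
    by (simp add: l_def local_algebra_mult)
  note cls = gw_class_of_hyperbolic_basis[where \<beta> = "\<lambda>a b. \<phi> (a \<otimes>\<^bsub>local_algebra f\<^esub> b)", OF nil l l0 basis \<beta>]
  show "even (local_degree f)" by (simp add: cls(1))
  show "gw_class (local_algebra f) (\<lambda>a b. \<phi> (a \<otimes>\<^bsub>local_algebra f\<^esub> b)) =
      of_nat (local_degree f div 2) * (gw_unit 1 + gw_unit (- 1))"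
    by (simp add: cls)
qed

lemma functional_descends:
  fixes f :: "'n::finite \<Rightarrow> ('n, 'k::field) mpoly"
  assumes nil: "nil_mod f" and l: "functional l" "\<And>p. p \<in> ideal_of f \<Longrightarrow> l p = 0"
  obtains \<phi> where "linear_map class_ring (local_algebra f) self_module \<phi>" "\<And>p. \<phi> (residue f p) = l p"
proof -
  define \<phi> where "\<phi> X = l (SOME p. residue f p = X)" for X
  have \<phi>: "\<phi> (residue f p) = l p" for p
  proof -
    have "residue f (SOME q. residue f q = residue f p) = residue f p" by (rule someI) (rule refl)
    hence "(SOME q. residue f q = residue f p) - p \<in> ideal_of f" by (simp only: residue_eq_iff[OF nil])
    from functional_mod[OF l this] show ?thesis by (simp only: \<phi>_def)
  qed
  have "linear_map class_ring (local_algebra f) self_module \<phi>"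
  proof (rule linear_mapI[OF local_algebra_vectorspace[OF nil] self_vs])
    fix x c assume "x \<in> carrier (local_algebra f)"
    then obtain p where p: "x = residue f p" by (auto simp: local_algebra_carrier[OF nil])
    show "\<phi> (c \<odot>\<^bsub>local_algebra f\<^esub> x) = c \<odot>\<^bsub>self_module\<^esub> \<phi> x"
      by (simp add: p local_algebra_smult \<phi> functional_scale[OF l(1)])
    fix y assume "y \<in> carrier (local_algebra f)"
    then obtain q where q: "y = residue f q" by (auto simp: local_algebra_carrier[OF nil])
    show "\<phi> (x \<oplus>\<^bsub>local_algebra f\<^esub> y) = \<phi> x \<oplus>\<^bsub>self_module\<^esub> \<phi> y"
      by (simp add: p q local_algebra_add \<phi> functional_add[OF l(1)])
  qed simp
  from this \<phi> show ?thesis by (rule that)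
qed

lemma matrix_of_zero_at_origin:
  fixes f :: "'n::finite \<Rightarrow> ('n, 'k::field) mpoly"
  assumes "\<And>i. eval0 (f i) = 0"
  obtains A :: "('n, 'k) mpoly ^ 'n ^ 'n" where "\<And>i. apply_mat A Var i = f i"
proof -
  have "\<forall>i. \<exists>c. f i = (\<Sum>j\<in>UNIV. c j * Var j)"
  proof
    fix i
    obtain c where "f i = (\<Sum>j\<in>UNIV. c j * Var j)"
      by (rule ideal_ofE[OF eval0_zero_in_ideal[OF assms]])
    thus "\<exists>c. f i = (\<Sum>j\<in>UNIV. c j * Var j)" by blast
  qed
  from choice[OF this] obtain c where c: "\<forall>i. f i = (\<Sum>j\<in>UNIV. c i j * Var j)" by (rule exE)
  show ?thesis by (rule that[of "\<chi> i j. c i j"]) (use c in simp)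
qed

theorem proposition1:
  fixes smul :: "'k::field \<Rightarrow> 'v::ab_group_add \<Rightarrow> 'v"
    and b :: "'n::finite \<Rightarrow> 'v"
    and G :: "('g, 'z) monoid_scheme"
    and \<rho> :: "'g \<Rightarrow> 'v \<Rightarrow> 'v"
    and f :: "'n \<Rightarrow> ('n, 'k) mpoly"
  assumes "CHAR('k) \<noteq> 2"
    and "vector_space smul"
    and "vs_basis smul b"
    and "group G" and "finite (carrier G)"
    and "linear_action smul G \<rho>"
    and "polynomial_generators f (invariant_polys smul b G \<rho>)"
    and "\<forall>i. eval0 (f i) = 0"
    and "\<exists>g\<in>carrier G. simple_reflection smul (\<rho> g)"
  shows "even (local_degree f) \<and>
    ekl_degree f = of_nat (local_degree f div 2) * (gw_unit 1 + gw_unit (- 1))"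
proof -
  note char = assms(1) and vs = assms(2,3)
  have f0: "eval0 (f i) = 0" for i using assms(8) by blast
  define N where "N = card (carrier G)"
  have N: "N > 0" using assms(4,5) group.is_monoid[OF assms(4)] monoid.one_closed
    unfolding N_def by (auto simp: card_gt_0_iff)
  have pow: "Var j ^ N \<in> ideal_of f" for j
    unfolding N_def by (rule Var_power_in_invariant_ideal[OF vs assms(4-7) f0])
  obtain g where g: "g \<in> carrier G" "simple_reflection smul (\<rho> g)" using assms(9) by (rule bexE)
  define s where "s = pullback smul b (\<rho> g)"
  have lin: "Vector_Spaces.linear smul smul (\<rho> g)" using assms(6) g(1) by (simp add: linear_action_def)
  have sf: "s (f i) = f i" for i
    using generator_invariant[OF assms(7), of i] g(1) by (simp add: s_def invariant_polys_def)
  have s: "comm_ring_hom s" "s (Const c) = Const c" for c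
    unfolding s_def by (rule pullback_hom, rule pullback_Const)
  note refl = reflection_pullback[OF vs char lin g(2) sf[unfolded s_def], folded s_def]
  let ?h = "of_nat (local_degree f div 2) * (gw_unit 1 + gw_unit (- 1)) :: 'k gw"
  have hyperbolic: "even (local_degree f) \<and>
      gw_class (local_algebra f) (\<lambda>a b. \<phi> (a \<otimes>\<^bsub>local_algebra f\<^esub> b)) = ?h"
    if A: "\<And>i. apply_mat A Var i = f i" and \<phi>: "linear_map class_ring (local_algebra f) self_module \<phi>"
      "\<phi> (residue f (det A)) = 1" for A \<phi>
    using degree_and_class_of_functional[OF char pow A s(1) refl(1)[OF A] s(2) sf refl(2)[OF A] \<phi>] by (rule conjI)
  obtain A :: "('n, 'k) mpoly ^ 'n ^ 'n" where A: "\<And>i. apply_mat A Var i = f i"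
    by (rule matrix_of_zero_at_origin[of f, OF f0], rule that) assumption
  obtain l where l: "functional l" "\<And>p. p \<in> ideal_of f \<Longrightarrow> l p = 0" "l (det A) = 1"
    by (rule dual_functional_exists[OF char N pow A], rule that) assumption+
  obtain \<phi> where \<phi>: "linear_map class_ring (local_algebra f) self_module \<phi>" "\<And>p. \<phi> (residue f p) = l p"
    by (rule functional_descends[where f = f and l = l, OF nil_modI[OF pow] l(1,2)]) (assumption | rule that)+
  have A\<phi>: "\<phi> (residue f (det A)) = 1" by (simp add: \<phi>(2) l(3))
  have "ekl_degree f = ?h"
    unfolding ekl_degree_def
  proof (rule the_equality)
    show "\<exists>(A :: ('n, 'k) mpoly ^ 'n ^ 'n) \<phi>.
       (\<forall>i. f i = apply_mat A Var i) \<and> linear_map class_ring (local_algebra f) self_module \<phi> \<and>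
       \<phi> (residue f (det A)) = 1 \<and>
       ?h = gw_class (local_algebra f) (\<lambda>a b. \<phi> (a \<otimes>\<^bsub>local_algebra f\<^esub> b))"
      using A \<phi>(1) A\<phi> hyperbolic[OF A \<phi>(1) A\<phi>] by (intro exI[of _ A] exI[of _ \<phi>]) simp
    fix d assume "\<exists>(A :: ('n, 'k) mpoly ^ 'n ^ 'n) \<phi>.
       (\<forall>i. f i = apply_mat A Var i) \<and> linear_map class_ring (local_algebra f) self_module \<phi> \<and>
       \<phi> (residue f (det A)) = 1 \<and>
       d = gw_class (local_algebra f) (\<lambda>a b. \<phi> (a \<otimes>\<^bsub>local_algebra f\<^esub> b))"
    then obtain A' :: "('n, 'k) mpoly ^ 'n ^ 'n" and \<phi>' where *: "\<forall>i. f i = apply_mat A' Var i"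
      "linear_map class_ring (local_algebra f) self_module \<phi>'" "\<phi>' (residue f (det A')) = 1"
      "d = gw_class (local_algebra f) (\<lambda>a b. \<phi>' (a \<otimes>\<^bsub>local_algebra f\<^esub> b))"
      by (elim exE conjE)
    have A': "apply_mat A' Var i = f i" for i using *(1) by simp
    show "d = ?h" unfolding *(4) using hyperbolic[OF A' *(2,3)] by (rule conjunct2)
  qed
  with hyperbolic[OF A \<phi>(1) A\<phi>] show ?thesis by blast
qed

end
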